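(* Let $\delta\in(0,1)$. Suppose the inliers follow Assumption 1 and the outliers follow Assumption 3 (both in the context). Let $\mathcal{A}=\sqrt{\frac2\pi}\frac{n_i}{\sqrt r}-2\sqrt{n_i}-\sqrt{\frac{2n_i\log\frac1\delta}{r-1}}$. If (i) $\mathcal{A}>2n_z'\|\mathbf{U}^T\mathbf{U}_o\|+2\|\mathbf{U}^T\mathbf{U}_o\|\sqrt{n_o\log(n_o/\delta)}$; (ii) $\mathcal{A}>\frac{2\|\mathbf{U}^T\mathbf{U}_o\|}{\xi}\Big(\frac{n_o}{\sqrt{r_o}}+2\sqrt{n_o}+\sqrt{\frac{2n_o\log\frac1\delta}{r_o-1}}+2\sqrt{(\frac{n_o}{r_o}+\eta'_\delta)\log\frac{n_o}{\delta}}+n_z'\Big)$; (iii) $\mathcal{A}>\Big(\frac{\chi n_o}{\sqrt{r_o}}+2\sqrt{\chi n_o}+\sqrt{\chi\frac{2n_o\log\frac1\delta}{r_o-1}}\Big)\|\mathbf{U}_o^T\mathbf{U}^\perp\|$, then with probability at least $1-5\delta$ every outlier has a strictly larger Innovation Value than every inlier, i.e. $\max_{n_o<i\le M_2}1/\|\mathbf{D}^T\mathbf{c}_i^*\|_1<\min_{1\le j\le n_o}1/\|\mathbf{D}^T\mathbf{c}_j^*\|_1$, and $\mathcal{U}$ is recovered exactly (the span of the columns with the smallest Innovation Values, added in increasing order until they span an $r$-dimensional subspace, equals $\mathcal{U}$).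
   Context: $\mathbb{S}^{M_1-1}$ is the unit sphere in $\mathbb{R}^{M_1}$; $\mathcal{U}$ is an $r$-dimensional subspace with orthonormal basis $\mathbf{U}$, and $\mathbf{U}^\perp$ is an orthonormal basis of its orthogonal complement. $\mathbf{D}=[\mathbf{B}\ \mathbf{A}]\in\mathbb{R}^{M_1\times M_2}$, $M_2=n_o+n_i$, columns $\mathbf{d}_1,\dots,\mathbf{d}_{M_2}$, the first $n_o$ being the outliers $\mathbf{b}_1,\dots,\mathbf{b}_{n_o}$. Assumption 1 (inliers): columns of $\mathbf{A}$ i.i.d. uniform on $\mathcal{U}\cap\mathbb{S}^{M_1-1}$. Assumption 3 (outliers): $\mathcal{U}_o$ is an $r_o$-dimensional subspace with orthonormal basis $\mathbf{U}_o$ such that neither of $\mathcal{U}_o,\mathcal{U}$ is contained in the other; the columns of $\mathbf{B}$ are i.i.d. uniform on $\mathbb{S}^{M_1-1}\cap\mathcal{U}_o$. $\|\cdot\|$ on matrices is the spectral norm. For each $j$, $\mathbf{c}_j^*$ is an optimal point of $\min_{\mathbf{c}}\|\mathbf{c}^T\mathbf{D}\|_1$ s.t. $\mathbf{c}^T\mathbf{d}_j=1$; Innovation Value of $\mathbf{d}_j$ is $1/\|\mathbf{D}^T\mathbf{c}_j^*\|_1$. $\chi=\max_{j\le n_o}\|\mathbf{c}_j^*\|_2$, $n_z'=\max_{j\le n_o}|\{i\in[n_o]:(\mathbf{c}_j^* )^T\mathbf{b}_i=0\}|$. $\eta'_\delta=\max(\frac43\log\frac{2r_o}{\delta},\sqrt{4\frac{n_o}{r_o}\log\frac{2r_o}{\delta}})$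 and $\xi=\frac{\min_{j\le n_o}\|\mathbf{b}_j^T\mathbf{U}^\perp\|_2}{\|\mathbf{U}_o^T\mathbf{U}^\perp\|}$. *)

theory Defs
  imports "HOL-Probability.Probability"
begin

definition spec_norm :: "real^'n^'m \<Rightarrow> real" where
  "spec_norm A = onorm (\<lambda>x. A *v x)"

text \<open>Uniform (normalized surface) measure on the unit sphere of R^n: the radial
  projection of the uniform distribution on the unit ball (cone measure).\<close>
definition unif_sphere :: "(real^'n) measure" where
  "unif_sphere = distr (uniform_measure lborel (ball 0 1)) borel (\<lambda>x. x /\<^sub>R norm x)"

text \<open>Uniform distribution on the unit sphere of the column space of a matrix
  with orthonormal columns Q (the image of the uniform sphere measure under Q).\<close>
definition unif_sphere_in :: "real^'k^'m \<Rightarrow> (real^'m) measure" where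
  "unif_sphere_in Q = distr (unif_sphere :: (real^'k) measure) borel (\<lambda>x. Q *v x)"

definition l1obj :: "nat \<Rightarrow> (nat \<Rightarrow> real^'m) \<Rightarrow> real^'m \<Rightarrow> real" where
  "l1obj M2 d c = (\<Sum>i<M2. \<bar>c \<bullet> d i\<bar>)"

definition opt_point :: "nat \<Rightarrow> (nat \<Rightarrow> real^'m) \<Rightarrow> nat \<Rightarrow> real^'m \<Rightarrow> bool" where
  "opt_point M2 d j c \<longleftrightarrow> c \<bullet> d j = 1 \<and>
     (\<forall>c'. c' \<bullet> d j = 1 \<longrightarrow> l1obj M2 d c \<le> l1obj M2 d c')"

text \<open>Innovation value of column i, computed from the chosen optimal point c i.\<close>
definition innov_value :: "nat \<Rightarrow> (nat \<Rightarrow> real^'m) \<Rightarrow> (nat \<Rightarrow> real^'m) \<Rightarrow> nat \<Rightarrow> real" where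
  "innov_value M2 d c i = 1 / l1obj M2 d (c i)"

end

theory Submission
  imports Defs
begin

text \<open>Every feasible point of the problem of an inlier has \<open>l1\<close>-objective at least \<open>\<A>\<close>: its component in the
  inlier subspace has norm at least one, and the sums \<open>\<Sum>\<bar>u \<bullet> a i\<bar>\<close> are bounded below by \<open>\<A>\<close> uniformly over
  unit vectors \<open>u\<close>. The uniform bound comes from symmetrization and contraction for the mean of the supremum
  and from a one-sided exponential Efron--Stein inequality with the sharp variance factor \<open>1 / r\<close>.

  For an outlier \<open>b j\<close> the projection of \<open>b j\<close> to the orthogonal complement of the inlier subspace, suitably
  normalized, is feasible, vanishes on all inliers, and has objective at most \<open>(1 + T) / \<xi>\<close>, where \<open>T\<close> bounds
  the sums of \<open>\<bar>v \<bullet> b i\<bar>\<close>, \<open>i \<noteq> j\<close>, in a direction \<open>v\<close> independent of the other outliers. By condition (ii) the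
  optimal points of outliers are orthogonal to all inliers, so that \<open>chi\<close> is at least the reciprocal of the
  smallest distance of an outlier from the inlier subspace; then (ii) or (iii) gives \<open>(1 + T) / \<xi> < \<A>\<close>. As
  (iii) has only \<open>sqrt chi\<close> in its deviation terms, the moment bound for \<open>T\<close> has to be exact to first order,
  which is achieved by \<open>exp \<bar>t\<bar> = 2 * cosh t - exp (- \<bar>t\<bar>)\<close>.\<close>

section \<open>Exponential moments of bounded random variables\<close>

text \<open>The optimal points, and with them \<open>chi\<close> and \<open>nz\<close>, are
  quantified after the sample, so no event may mention them. The probabilistic part therefore
  delivers just three constants, \<A>, \<open>S\<close> and \<open>T\<close>, and whatever concerns
  optimal points is deterministic on one event. For the same reason the exponent \<open>l\<close>
  behind \<open>T\<close> may depend on \<delta>, the number of outliers and their dimension, but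
  not on the random distance of the outliers from the inlier subspace.

  The factor \<open>1 / r\<close> in the deviation term of \<A> would be lost with bounded
  differences. It survives because exchanging one inlier can lower the worst deficit only through
  the new vector, whose square in a fixed direction averages to \<open>1 / r\<close>. For sums
  bounded from above this asymmetry points the wrong way; there the exponential moment of the
  squared norm of the sum is used. Its cruder constants are affordable, as \<open>S\<close> enters
  only multiplied by \<kappa>.

  For 5\<delta> \<ge> 1 the claim is void; otherwise ln (1/\<delta>) \<ge> 3/2, on which the
  numerical estimates rely.\<close>

text \<open>The quotient (exp w - 1 - w) / w^2 is nondecreasing, so its value at \<open>W\<close>
  serves for all smaller \<open>w\<close>. For nonnegative \<open>w\<close> this is seen termwise in
  the power series, for negative \<open>w\<close> through the intermediate value 1/2 of the quotient
  at 0.\<close>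

lemma exp_le_quadratic:
  fixes w W :: real
  assumes "0 < W" "w \<le> W"
  shows "exp w \<le> 1 + w + (exp W - 1 - W) / W\<^sup>2 * w\<^sup>2"
proof (cases "0 \<le> w")
  case True
  define t where "t = w / W"
  have t: "0 \<le> t" "t \<le> 1" "w = t * W" using assms True by (auto simp: t_def)
  have *: "(\<lambda>n. inverse (fact n) * x ^ n) sums exp x" for x :: real
    using exp_converges[of x] by (simp add: field_simps)
  have s: "(\<lambda>n. inverse (fact (n+2)) * x ^ (n+2)) sums (exp x - 1 - x)" for x :: real
    using sums_split_initial_segment[OF *[of x], of 2] by (simp add: numeral_2_eq_2 algebra_simps)
  have "exp (t*W) - 1 - t*W \<le> t\<^sup>2 * (exp W - 1 - W)"
  proof (rule sums_le[OF _ s sums_mult[OF s]])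
    fix n
    have "t ^ (n+2) \<le> t\<^sup>2" using t by (intro power_decreasing) auto
    then have "(t * W) ^ (n+2) \<le> t\<^sup>2 * W ^ (n+2)"
      unfolding power_mult_distrib using assms by (intro mult_right_mono) auto
    then show "inverse (fact (n+2)) * (t * W) ^ (n+2) \<le> t\<^sup>2 * (inverse (fact (n+2)) * W ^ (n+2))"
      using mult_left_mono[of "(t * W) ^ (n+2)" "t\<^sup>2 * W ^ (n+2)" "inverse (fact (n+2))"]
      by (simp add: mult_ac)
  qed
  moreover have "(exp W - 1 - W) / W\<^sup>2 * w\<^sup>2 = t\<^sup>2 * (exp W - 1 - W)"
    using assms by (simp add: t(3) power_mult_distrib)
  ultimately show ?thesis unfolding t(3)[symmetric] by linarith
next
  case False
  have "1 + W + W\<^sup>2/2 \<le> exp W"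
    using exp_lower_Taylor_quadratic[of W] assms by simp
  then have "1/2 \<le> (exp W - 1 - W) / W\<^sup>2"
    using assms by (simp add: field_simps)
  then have "1/2 * w\<^sup>2 \<le> (exp W - 1 - W) / W\<^sup>2 * w\<^sup>2"
    by (intro mult_right_mono) auto
  moreover have "exp w \<le> 1 + w + w\<^sup>2/2"
  proof -
    define h where "h = (\<lambda>w::real. 1 + w + w\<^sup>2/2 - exp w)"
    have "h 0 \<le> h w"
    proof (rule DERIV_nonpos_imp_nonincreasing[of w 0 h])
      fix x assume "w \<le> x" "x \<le> 0"
      have "(h has_real_derivative (1 + x - exp x)) (at x)"
        unfolding h_def by (auto intro!: derivative_eq_intros)
      then show "\<exists>y. (h has_real_derivative y) (at x) \<and> y \<le> 0"
        using exp_ge_add_one_self[of x] by (intro exI[of _ "1 + x - exp x"]) auto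
    qed (use False in auto)
    then show ?thesis by (simp add: h_def)
  qed
  ultimately show ?thesis by linarith
qed

section \<open>Power series of the hyperbolic functions\<close>

lemma cosh_even_series: "(\<lambda>n. x ^ (2*n) /\<^sub>R fact (2*n)) sums cosh x" for x :: real
proof -
  have "(\<lambda>n. (if even (2*n) then x ^ (2*n) /\<^sub>R fact (2*n) else 0)) sums cosh x"
    using cosh_converges[of x]
    by (subst sums_mono_reindex[of "\<lambda>n::nat. 2*n" "\<lambda>n. if even n then x ^ n /\<^sub>R fact n else 0"])
      (auto simp: strict_mono_def elim!: evenE)
  then show ?thesis by simp
qed

lemma sinh_odd_series: "(\<lambda>n. x ^ (2*n+1) /\<^sub>R fact (2*n+1)) sums sinh x" for x :: real
proof -
  have "(\<lambda>n. (if even (2*n+1) then 0 else x ^ (2*n+1) /\<^sub>R fact (2*n+1))) sums sinh x"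
    using sinh_converges[of x]
    by (subst sums_mono_reindex[of "\<lambda>n::nat. 2*n+1" "\<lambda>n. if even n then 0 else x ^ n /\<^sub>R fact n"])
      (auto simp: strict_mono_def elim!: oddE)
  then show ?thesis by simp
qed

text \<open>As a function of \<rho>^2, cosh (c \<rho>) is convex, and the left side is its tangent
  at \<rho>^2 = 1; termwise this is Bernoulli's inequality. A random \<rho> with mean square 1 that
  is independent of \<open>c\<close> can thus only raise the mean of cosh.\<close>

lemma cosh_ge_tangent_in_square:
  fixes c \<rho> :: real
  shows "cosh c + c * sinh c / 2 * (\<rho>\<^sup>2 - 1) \<le> cosh (c * \<rho>)"
proof -
  \<comment> \<open>Coefficients of the derivative of the cosh series with respect to \<rho>^2 at 1.
    As \<open>f 0 = 0\<close>, the shifted series can be summed to c / 2 * sinh c.\<close>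
  define f where "f n = real n * (c ^ (2*n) /\<^sub>R fact (2*n))" for n
  have "f (Suc n) = c / 2 * (c ^ (2*n+1) /\<^sub>R fact (2*n+1))" for n
  proof -
    have "fact (2 * Suc n) = (2 * real (Suc n)) * (fact (2*n+1) :: real)" by (simp add: algebra_simps)
    moreover have "c ^ (2 * Suc n) = c * c ^ (2*n+1)" by simp
    moreover have "y * ((c * b) /\<^sub>R (2 * y * a)) = c / 2 * (b /\<^sub>R a)" if "y \<noteq> 0" for y a b :: real
      using that by (simp add: field_simps)
    ultimately show ?thesis unfolding f_def by (metis nat.simps(3) of_nat_eq_0_iff)
  qed
  then have "(\<lambda>n. f (Suc n)) sums (c / 2 * sinh c)"
    by (simp only: sums_mult[OF sinh_odd_series])
  then have f: "f sums (c / 2 * sinh c)" using sums_Suc[of f] by (simp add: f_def)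
  have "cosh c + (\<rho>\<^sup>2 - 1) * (c / 2 * sinh c) \<le> cosh (c * \<rho>)"
  proof (rule sums_le[OF _ sums_add[OF cosh_even_series sums_mult[OF f]] cosh_even_series])
    fix n
    have "1 + real n * (\<rho>\<^sup>2 - 1) \<le> (1 + (\<rho>\<^sup>2 - 1)) ^ n" by (rule Bernoulli_inequality) simp
    then have "(1 + real n * (\<rho>\<^sup>2 - 1)) * (c ^ (2*n) /\<^sub>R fact (2*n)) \<le> \<rho> ^ (2*n) * (c ^ (2*n) /\<^sub>R fact (2*n))"
      by (intro mult_right_mono) (auto simp: power_mult intro!: zero_le_even_power)
    then show "c ^ (2*n) /\<^sub>R fact (2*n) + (\<rho>\<^sup>2 - 1) * f n \<le> (c * \<rho>) ^ (2*n) /\<^sub>R fact (2*n)"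
      by (simp add: f_def algebra_simps power_mult_distrib)
  qed
  then show ?thesis by (simp add: algebra_simps)
qed

text \<open>Termwise comparison of the power series, by 2^n * n! \<le> (2n)!.\<close>

lemma cosh_le_exp_square: "cosh x \<le> exp (x\<^sup>2 / 2)" for x :: real
proof -
  note c = cosh_even_series[of x]
  have e: "(\<lambda>n. (x\<^sup>2/2) ^ n /\<^sub>R fact n) sums exp (x\<^sup>2/2)" by (rule exp_converges)
  have f: "2 ^ n * fact n \<le> (fact (2*n) :: real)" for n
  proof (induction n)
    case (Suc n)
    have "2 ^ Suc n * fact (Suc n) = (2 * (real n+1)) * (2 ^ n * fact n)" by (simp add: algebra_simps)
    also have "\<dots> \<le> (2 * (real n+1)) * fact (2*n)" using Suc by (intro mult_left_mono) auto
    also have "\<dots> \<le> (2*real n+1) * ((2 * (real n+1)) * fact (2*n))"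
      using mult_right_mono[of 1 "2*real n+1" "(2 * (real n+1)) * fact (2*n)"] by simp
    also have "\<dots> = fact (2 * Suc n)" by (simp add: algebra_simps)
    finally show ?case .
  qed simp
  show ?thesis
  proof (rule sums_le[OF _ c e])
    fix n
    have "x ^ (2*n) / fact (2*n) \<le> x ^ (2*n) / (2 ^ n * fact n)"
      using f[of n] by (intro divide_left_mono) (auto intro: zero_le_even_power)
    also have "\<dots> = (x\<^sup>2/2) ^ n /\<^sub>R fact n"
    proof -
      have "(x\<^sup>2/2) ^ n = x ^ (2*n) / 2 ^ n" by (simp only: power_divide power_mult)
      then show ?thesis by (simp add: field_simps)
    qed
    finally show "x ^ (2*n) /\<^sub>R fact (2*n) \<le> (x\<^sup>2/2) ^ n /\<^sub>R fact n"
      by (metis divide_inverse_commute real_scaleR_def)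
  qed
qed

section \<open>Moments of bounded random variables\<close>

lemma (in prob_space) integrable_bounded:
  fixes g :: "'a \<Rightarrow> real"
  assumes "g \<in> borel_measurable M" and "\<And>y. \<bar>g y\<bar> \<le> B"
  shows "integrable M g"
  by (rule integrable_const_bound[of _ B]) (use assms in auto)

lemma (in prob_space) integrable_square_bounded:
  fixes g :: "'a \<Rightarrow> real"
  assumes [measurable]: "g \<in> borel_measurable M" and "\<And>y. \<bar>g y\<bar> \<le> B"
  shows "integrable M (\<lambda>y. (g y)\<^sup>2)"
  by (rule integrable_bounded[of _ "B\<^sup>2"]) (use power_mono[OF assms(2) abs_ge_zero, where n=2] in auto)

lemma (in prob_space) expectation_const: "expectation (\<lambda>_. c) = (c :: real)"
  by (simp add: prob_space)

lemma (in prob_space) abs_expectation_le: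
  fixes g :: "'a \<Rightarrow> real"
  assumes "\<And>y. \<bar>g y\<bar> \<le> B"
  shows "\<bar>expectation g\<bar> \<le> B"
proof (cases "integrable M g")
  case True
  have "\<bar>expectation g\<bar> \<le> expectation (\<lambda>y. \<bar>g y\<bar>)" using integral_norm_bound[of M g] by simp
  also have "\<dots> \<le> expectation (\<lambda>_. B)" by (intro integral_mono) (use True assms in auto)
  finally show ?thesis by (simp add: prob_space)
next
  \<comment> \<open>A function that is not integrable has integral 0, and \<open>B\<close> is
    nonnegative as a bound of an absolute value.\<close>
  case False
  then show ?thesis using assms[of undefined] by (simp add: not_integrable_integral_eq)
qed

lemma (in prob_space) square_expectation_le:
  fixes g :: "'a \<Rightarrow> real"
  assumes [measurable]: "g \<in> borel_measurable M" and "\<And>y. \<bar>g y\<bar> \<le> B"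
  shows "(expectation g)\<^sup>2 \<le> expectation (\<lambda>y. (g y)\<^sup>2)"
proof -
  have "integrable M g" by (rule integrable_bounded) fact+
  moreover have "integrable M (\<lambda>y. (g y)\<^sup>2)" by (rule integrable_square_bounded) fact+
  ultimately have "variance g = expectation (\<lambda>y. (g y)\<^sup>2) - (expectation g)\<^sup>2"
    by (rule variance_eq)
  then show ?thesis using variance_positive[of g] by linarith
qed

text \<open>The parabola of \<open>exp_le_quadratic\<close> touches \<open>exp\<close> at \<open>- \<surd>v\<close> and meets it at \<open>\<surd>v\<close>, so the
  symmetric two-point law on \<open>\<plusminus> \<surd>v\<close> is extremal.\<close>

lemma (in prob_space) exp_moment_bounded_above:
  fixes X :: "'a \<Rightarrow> real"
  assumes [measurable]: "X \<in> borel_measurable M" and B: "\<And>y. \<bar>X y\<bar> \<le> B"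
    and X0: "expectation X = 0" and Xs: "\<And>y. y \<in> space M \<Longrightarrow> X y \<le> sqrt v" and var: "expectation (\<lambda>y. (X y)\<^sup>2) \<le> v"
    and l: "0 \<le> l"
  shows "expectation (\<lambda>y. exp (l * X y)) \<le> exp (l\<^sup>2 * v / 2)"
proof -
  have v0: "0 \<le> v" using var order_trans[OF integral_nonneg_AE[of "\<lambda>y. (X y)\<^sup>2" M]] by auto
  have iX: "integrable M X" by (rule integrable_const_bound[of _ B]) (use B in auto)
  have iX2: "integrable M (\<lambda>y. (X y)\<^sup>2)" by (rule integrable_square_bounded) fact+
  have iE: "integrable M (\<lambda>y. exp (l * X y))"
    by (rule integrable_const_bound[of _ "exp (l*B)"]) (use B l in \<open>auto intro!: AE_I2 mult_left_mono simp: abs_le_iff\<close>)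
  \<comment> \<open>The exponent at the extremal points is \<plusminus> \<theta>. Shifting by
    \<theta> below moves the touching point to 0, where the parabola of
    \<open>exp_le_quadratic\<close> touches, and turns the upper end into
    \<open>2 * \<theta>\<close>.\<close>
  define \<theta> where "\<theta> = l * sqrt v"
  show ?thesis
  proof (cases "\<theta> = 0")
    case True
    then consider "l = 0" | "v = 0" by (auto simp: \<theta>_def)
    then show ?thesis
    proof cases
      case 2
      have "expectation (\<lambda>y. exp (l * X y)) \<le> expectation (\<lambda>y. 1)"
        by (rule integral_mono[OF iE]) (use Xs 2 l in \<open>auto simp: mult_le_0_iff\<close>)
      then show ?thesis using 2 by (simp add: prob_space)
    qed (simp add: prob_space)
  next
    case False
    then have t: "0 < \<theta>" using l v0 by (simp add: \<theta>_def less_le)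
    define C where "C = (exp (2*\<theta>) - 1 - 2*\<theta>) / (2*\<theta>)\<^sup>2"
    have C0: "0 \<le> C" unfolding C_def
      using exp_ge_add_one_self[of "2*\<theta>"] by (intro divide_nonneg_nonneg) (linarith, simp)
    have pt: "exp (l * X y) \<le> exp (-\<theta>) * (1 + \<theta> + C * \<theta>\<^sup>2 + l * (1 + 2*C*\<theta>) * X y + C * l\<^sup>2 * (X y)\<^sup>2)"
      if "y \<in> space M" for y
    proof -
      have "l * X y + \<theta> \<le> 2 * \<theta>" using mult_left_mono[OF Xs[OF that] l] by (simp add: \<theta>_def)
      then have "exp (l * X y + \<theta>) \<le> 1 + (l * X y + \<theta>) + C * (l * X y + \<theta>)\<^sup>2"
        unfolding C_def using t by (intro exp_le_quadratic) auto
      also have "\<dots> = 1 + \<theta> + C * \<theta>\<^sup>2 + l * (1 + 2*C*\<theta>) * X y + C * l\<^sup>2 * (X y)\<^sup>2"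
        by (simp add: power2_eq_square algebra_simps)
      finally have "exp (-\<theta>) * exp (l * X y + \<theta>) \<le> exp (-\<theta>) * \<dots>" by (intro mult_left_mono) auto
      then show ?thesis by (simp add: exp_add[symmetric])
    qed
    have 1: "C * l\<^sup>2 * v = C * \<theta>\<^sup>2" using v0 by (simp add: \<theta>_def power_mult_distrib)
    have 2: "C * \<theta>\<^sup>2 = (exp (2*\<theta>) - 1 - 2*\<theta>) / 4" using t by (simp add: C_def power_mult_distrib)
    have 3: "1 + \<theta> + C * \<theta>\<^sup>2 + C * l\<^sup>2 * v = (1 + exp (2*\<theta>)) / 2"
      unfolding 1 2 by (simp add: field_simps)
    \<comment> \<open>At variance exactly \<open>v\<close> the mean of the parabola is the
      exponential moment of the symmetric two-point law.\<close>
    have 4: "exp (-\<theta>) * (1 + \<theta> + C * \<theta>\<^sup>2 + C * l\<^sup>2 * v) = cosh \<theta>"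
      unfolding 3 by (simp add: cosh_def field_simps exp_add[symmetric])
    have "expectation (\<lambda>y. exp (l * X y)) \<le>
        expectation (\<lambda>y. exp (-\<theta>) * (1 + \<theta> + C * \<theta>\<^sup>2 + l * (1 + 2*C*\<theta>) * X y + C * l\<^sup>2 * (X y)\<^sup>2))"
      by (rule integral_mono[OF iE]) (use iX iX2 pt in auto)
    also have "\<dots> = exp (-\<theta>) * (1 + \<theta> + C * \<theta>\<^sup>2 + C * l\<^sup>2 * expectation (\<lambda>y. (X y)\<^sup>2))"
      using iX iX2 X0 by (simp add: prob_space)
    also have "\<dots> \<le> exp (-\<theta>) * (1 + \<theta> + C * \<theta>\<^sup>2 + C * l\<^sup>2 * v)"
      using var C0 by (intro mult_left_mono add_left_mono) auto
    also note 4
    also have "cosh \<theta> \<le> exp (\<theta>\<^sup>2 / 2)" by (rule cosh_le_exp_square)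
    also have "\<theta>\<^sup>2 = l\<^sup>2 * v" using v0 by (simp add: \<theta>_def power_mult_distrib)
    finally show ?thesis .
  qed
qed

text \<open>Only the positive part of \<open>f y - f z\<close> is controlled, and only on average over \<open>z\<close>; by symmetry this
  still bounds the variance, and it also bounds \<open>f\<close> minus its mean from above.\<close>

lemma (in prob_space) exp_moment_one_sided_increments:
  fixes f :: "'a \<Rightarrow> real"
  assumes [measurable]: "f \<in> borel_measurable M" and B: "\<And>y. \<bar>f y\<bar> \<le> B"
    and inc: "\<And>y. y \<in> space M \<Longrightarrow> expectation (\<lambda>z. (max 0 (f y - f z))\<^sup>2) \<le> v"
    and l: "0 \<le> l"
  shows "expectation (\<lambda>y. exp (l * f y)) \<le> exp (l * expectation f + l\<^sup>2 * v / 2)"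
proof -
  have i[simp]: "integrable M f" by (rule integrable_const_bound[of _ B]) (use B in auto)
  have i2[simp]: "integrable M (\<lambda>y. (f y)\<^sup>2)" by (rule integrable_square_bounded) fact+
  have mB: "\<bar>max 0 (f y - f z)\<bar> \<le> 2*B" for y z using B[of y] B[of z] by (auto simp: abs_le_iff max_def)
  have mB2: "(max 0 (f y - f z))\<^sup>2 \<le> (2*B)\<^sup>2" for y z using power_mono[OF mB abs_ge_zero, of y z 2] by auto
  have im[simp]: "integrable M (\<lambda>z. max 0 (f y - f z))" for y
    by (rule integrable_const_bound[of _ "2*B"]) (use mB in auto)
  have im2[simp]: "integrable M (\<lambda>z. (max 0 (f y - f z))\<^sup>2)" for y
    by (rule integrable_const_bound[of _ "(2*B)\<^sup>2"]) (use mB2 in auto)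
  define \<mu> where "\<mu> = expectation f"
  have muB: "\<bar>\<mu>\<bar> \<le> B" unfolding \<mu>_def by (rule abs_expectation_le[OF B])
  \<comment> \<open>The mean of \<open>f y - f z\<close> over \<open>z\<close> is at most that of
    its positive part, and Cauchy-Schwarz passes to squares. This is the upper bound demanded by
    \<open>exp_moment_bounded_above\<close>.\<close>
  have up: "f y - \<mu> \<le> sqrt v" if "y \<in> space M" for y
  proof -
    have "f y - \<mu> = expectation (\<lambda>z. f y - f z)" by (simp add: \<mu>_def prob_space)
    also have "\<dots> \<le> expectation (\<lambda>z. max 0 (f y - f z))" by (intro integral_mono) auto
    also have "\<dots> \<le> sqrt (expectation (\<lambda>z. (max 0 (f y - f z))\<^sup>2))"
      using mB by (intro real_le_rsqrt square_expectation_le[of _ "2*B"]) auto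
    also have "\<dots> \<le> sqrt v" using inc[OF that] by simp
    finally show ?thesis .
  qed
  interpret MM: pair_prob_space M M ..
  have bd: "integrable (M \<Otimes>\<^sub>M M) (\<lambda>(y,z). (max 0 (f y - f z))\<^sup>2)"
    by (rule MM.integrable_const_bound[of _ "(2*B)\<^sup>2"]) (use mB2 in auto)
  \<comment> \<open>Assembles the facts below in their order: the variance, its double as a mean
    over pairs, the splitting of pairs by sign, equality of the two halves by exchange, and the
    bound for one half.\<close>
  have le: "A = a \<Longrightarrow> 2 * a = D \<Longrightarrow> D = P + Q \<Longrightarrow> Q = P \<Longrightarrow> P \<le> c \<Longrightarrow> A \<le> c" for A a D P Q c :: real
    by linarith
  have "expectation (\<lambda>y. (f y - \<mu>)\<^sup>2) = expectation (\<lambda>y. (f y)\<^sup>2) - \<mu>\<^sup>2"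
    using variance_eq[of f] by (simp add: \<mu>_def)
  moreover have "2 * (expectation (\<lambda>y. (f y)\<^sup>2) - \<mu>\<^sup>2) = expectation (\<lambda>y. expectation (\<lambda>z. (f y - f z)\<^sup>2))"
  proof -
    have h: "expectation (\<lambda>z. (f y - f z)\<^sup>2) = (f y)\<^sup>2 - 2 * f y * \<mu> + expectation (\<lambda>y. (f y)\<^sup>2)" for y
    proof -
      have "expectation (\<lambda>z. (f y - f z)\<^sup>2) = expectation (\<lambda>z. (f y)\<^sup>2 - 2 * f y * f z + (f z)\<^sup>2)"
        by (simp add: power2_diff algebra_simps)
      also have "\<dots> = (f y)\<^sup>2 - 2 * f y * \<mu> + expectation (\<lambda>y. (f y)\<^sup>2)"
        by (simp add: \<mu>_def prob_space)
      finally show ?thesis .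
    qed
    show ?thesis unfolding h by (simp add: prob_space) (simp add: \<mu>_def power2_eq_square)
  qed
  moreover have "expectation (\<lambda>y. expectation (\<lambda>z. (f y - f z)\<^sup>2))
      = expectation (\<lambda>y. expectation (\<lambda>z. (max 0 (f y - f z))\<^sup>2)) + expectation (\<lambda>y. expectation (\<lambda>z. (max 0 (f z - f y))\<^sup>2))"
  proof -
    have bd': "integrable (M \<Otimes>\<^sub>M M) (\<lambda>(y,z). (max 0 (f z - f y))\<^sup>2)"
      by (rule MM.integrable_const_bound[of _ "(2*B)\<^sup>2"]) (use mB2 in auto)
    have im2': "integrable M (\<lambda>z. (max 0 (f z - f y))\<^sup>2)" for y
      by (rule integrable_const_bound[of _ "(2*B)\<^sup>2"]) (use mB2 in auto)
    have sq: "(f y - f z)\<^sup>2 = (max 0 (f y - f z))\<^sup>2 + (max 0 (f z - f y))\<^sup>2" for y z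
      by (cases "f y \<le> f z") (simp_all add: max_absorb1 max_absorb2 power2_commute[of "f y" "f z"])
    have "expectation (\<lambda>z. (f y - f z)\<^sup>2) = expectation (\<lambda>z. (max 0 (f y - f z))\<^sup>2) + expectation (\<lambda>z. (max 0 (f z - f y))\<^sup>2)" for y
      unfolding sq by (rule Bochner_Integration.integral_add[OF im2 im2'])
    then have "expectation (\<lambda>y. expectation (\<lambda>z. (f y - f z)\<^sup>2))
       = expectation (\<lambda>y. expectation (\<lambda>z. (max 0 (f y - f z))\<^sup>2) + expectation (\<lambda>z. (max 0 (f z - f y))\<^sup>2))"
      by presburger
    also have "\<dots> = expectation (\<lambda>y. expectation (\<lambda>z. (max 0 (f y - f z))\<^sup>2)) + expectation (\<lambda>y. expectation (\<lambda>z. (max 0 (f z - f y))\<^sup>2))"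
      by (rule Bochner_Integration.integral_add) (use MM.integrable_fst'[OF bd] MM.integrable_fst'[OF bd'] in simp_all)
    finally show ?thesis .
  qed
  moreover have "expectation (\<lambda>y. expectation (\<lambda>z. (max 0 (f z - f y))\<^sup>2)) = expectation (\<lambda>y. expectation (\<lambda>z. (max 0 (f y - f z))\<^sup>2))"
    using MM.Fubini_integral[of "\<lambda>y z. (max 0 (f y - f z))\<^sup>2"] bd by simp
  moreover have "expectation (\<lambda>y. expectation (\<lambda>z. (max 0 (f y - f z))\<^sup>2)) \<le> expectation (\<lambda>y. v)"
    using MM.integrable_fst'[OF bd] inc by (intro integral_mono) auto
  ultimately have var: "expectation (\<lambda>y. (f y - \<mu>)\<^sup>2) \<le> v"
    unfolding expectation_const by (rule le)
  have "expectation (\<lambda>y. exp (l * (f y - \<mu>))) \<le> exp (l\<^sup>2 * v / 2)"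
  proof (rule exp_moment_bounded_above[of _ "2*B", OF _ _ _ up var l])
    show "\<bar>f y - \<mu>\<bar> \<le> 2*B" for y using B[of y] muB by linarith
  qed (auto simp: \<mu>_def prob_space)
  moreover have "expectation (\<lambda>y. exp (l * (f y - \<mu>))) = exp (- l * \<mu>) * expectation (\<lambda>y. exp (l * f y))"
    by (subst integral_mult_right_zero[symmetric]) (simp add: exp_add[symmetric] algebra_simps)
  ultimately have "exp (l * \<mu>) * (exp (- l * \<mu>) * expectation (\<lambda>y. exp (l * f y))) \<le> exp (l * \<mu>) * exp (l\<^sup>2 * v / 2)"
    by (intro mult_left_mono) auto
  moreover have "exp (l * \<mu>) * (exp (- l * \<mu>) * x) = x" for x
    by (simp add: mult.assoc[symmetric] mult_exp_exp)
  ultimately show ?thesis by (simp only: \<mu>_def exp_add)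
qed

section \<open>The uniform distribution on the sphere\<close>

abbreviation direction :: "real^'n \<Rightarrow> real^'n" where
  "direction x \<equiv> x /\<^sub>R norm x"

lemma emeasure_ball_finite: "emeasure lborel (ball (0::real^'n) R) < \<infinity>"
  by (rule emeasure_bounded_finite) simp

lemma emeasure_ball_nonzero: "R > 0 \<Longrightarrow> emeasure lborel (ball (0::real^'n) R) \<noteq> 0"
  using open_not_negligible[of "ball (0::real^'n) R"]
  by (auto simp: negligible_iff_null_sets null_sets_completion_iff)

lemma direction_vimage[measurable]: "A \<in> sets borel \<Longrightarrow> direction -` A \<in> sets borel"
  by (rule measurable_sets_borel[of _ borel]) simp_all

lemma norm_vimage[measurable]: "A \<in> sets borel \<Longrightarrow> (norm :: real^'n \<Rightarrow> real) -` A \<in> sets borel"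
  by (rule measurable_sets_borel[of _ borel]) simp_all

lemma emeasure_cone_scale:
  fixes A :: "(real^'n) set"
  assumes [measurable]: "A \<in> sets borel" and R: "0 < R"
  shows "emeasure lborel {x \<in> ball 0 R. direction x \<in> A} =
    ennreal (R ^ CARD('n)) * emeasure lborel {x \<in> ball 0 1. direction x \<in> A}"
proof -
  have "(\<lambda>x. 0 + R *\<^sub>R x) -` {x \<in> ball 0 R. direction x \<in> A} = {x \<in> ball (0::real^'n) 1. direction x \<in> A}"
    using R by (auto simp: field_simps)
  moreover have "emeasure lborel {x \<in> ball 0 R. direction x \<in> A} =
     emeasure (density (distr lborel borel (\<lambda>x. 0 + R *\<^sub>R x)) (\<lambda>_. \<bar>R\<bar>^DIM(real^'n))) {x \<in> ball (0::real^'n) R. direction x \<in> A}"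
    using R by (subst lborel_affine[of R 0]) auto
  moreover have "{x \<in> ball 0 R. direction x \<in> A} \<in> sets borel" by measurable
  ultimately show ?thesis using R
    by (simp add: emeasure_density nn_integral_cmult_indicator emeasure_distr)
qed

lemma sets_unif_sphere[simp, measurable_cong]: "sets unif_sphere = sets borel"
  by (simp add: unif_sphere_def)

lemma space_unif_sphere[simp]: "space unif_sphere = UNIV"
  by (simp add: unif_sphere_def)

lemma emeasure_unif_sphere:
  fixes A :: "(real^'n) set"
  assumes [measurable]: "A \<in> sets borel"
  shows "emeasure unif_sphere A * emeasure lborel (ball (0::real^'n) 1) = emeasure lborel {x \<in> ball 0 1. direction x \<in> A}"
proof -
  have "emeasure unif_sphere A = emeasure (uniform_measure lborel (ball (0::real^'n) 1)) (direction -` A)"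
    unfolding unif_sphere_def by (subst emeasure_distr) auto
  also have "\<dots> = emeasure lborel (ball 0 1 \<inter> direction -` A) / emeasure lborel (ball (0::real^'n) 1)"
    by (rule emeasure_uniform_measure) auto
  also have "ball 0 1 \<inter> direction -` A = {x \<in> ball 0 1. direction x \<in> A}" by auto
  finally have *: "emeasure unif_sphere A = emeasure lborel {x \<in> ball 0 1. direction x \<in> A} / emeasure lborel (ball (0::real^'n) 1)" .
  have "emeasure lborel (ball (0::real^'n) 1) < \<infinity>" "emeasure lborel (ball (0::real^'n) 1) \<noteq> 0"
    by (simp_all add: emeasure_ball_finite emeasure_ball_nonzero del: infinity_ennreal_def)
  then show ?thesis
    unfolding * by (simp add: ennreal_divide_times)
qed

lemma prob_space_unif_sphere: "prob_space (unif_sphere :: (real^'n) measure)"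
  unfolding unif_sphere_def
  by (intro prob_space.prob_space_distr prob_space_uniform_measure)
    (simp_all add: emeasure_ball_nonzero emeasure_ball_finite[unfolded infinity_ennreal_def, THEN less_imp_neq])

lemma AE_unif_sphere_norm: "AE x in (unif_sphere :: (real^'n) measure). norm x = 1"
proof -
  have "AE x in uniform_measure lborel (ball (0::real^'n) 1). x \<noteq> 0"
    by (rule AE_uniform_measureI) (use AE_lborel_singleton[of "0::real^'n"] in auto)
  then show ?thesis unfolding unif_sphere_def
    by (subst AE_distr_iff) (auto elim: eventually_mono)
qed

text \<open>Norm and direction are independent under Lebesgue measure. By the scaling of cones, the
  radial measure of the cone over \<open>A\<close> is a fixed multiple of that of the whole space on
  every ray \<open>{..<R}\<close>, and these rays form an intersection-stable generator of the Borel
  sets.\<close>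

lemma polar_factorization:
  fixes A :: "(real^'n) set" and w :: "real \<Rightarrow> ennreal"
  assumes [measurable]: "A \<in> sets borel" "w \<in> borel_measurable borel"
  shows "(\<integral>\<^sup>+x. w (norm x) * indicator A (direction x) \<partial>lborel) = (\<integral>\<^sup>+x. w (norm x) \<partial>(lborel :: (real^'n) measure)) * emeasure unif_sphere A"
proof -
  let ?s = "emeasure unif_sphere A"
  define m1 where "m1 = distr (density lborel (\<lambda>x. indicator A (direction x))) borel (norm :: real^'n \<Rightarrow> real)"
  define m2 where "m2 = distr (density lborel (\<lambda>_. ?s)) borel (norm :: real^'n \<Rightarrow> real)"
  have e1: "emeasure m1 {..<R} = emeasure lborel {x \<in> ball 0 R. direction x \<in> A}" for R
  proof -
    have "emeasure m1 {..<R} = (\<integral>\<^sup>+x. indicator A (direction x) * indicator (norm -` {..<R}) x \<partial>lborel)"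
      unfolding m1_def by (subst emeasure_distr, simp, simp, subst emeasure_density) auto
    also have "\<dots> = (\<integral>\<^sup>+x. indicator {x \<in> ball 0 R. direction x \<in> A} x \<partial>lborel)"
      by (intro nn_integral_cong) (auto split: split_indicator)
    finally show ?thesis by simp
  qed
  have e2: "emeasure m2 {..<R} = ?s * emeasure lborel (ball (0::real^'n) R)" for R
  proof -
    have "norm -` {..<R} = ball (0::real^'n) R" by auto
    then show ?thesis unfolding m2_def
      by (subst emeasure_distr, simp, simp, subst emeasure_density) (auto simp: nn_integral_cmult_indicator)
  qed
  have eq: "emeasure m1 {..<R} = emeasure m2 {..<R}" for R
  proof (cases "R > 0")
    case True
    then show ?thesis
      using emeasure_cone_scale[of A R] emeasure_cone_scale[of "UNIV :: (real^'n) set" R]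
      by (simp add: e1 e2 mult_ac emeasure_unif_sphere[of A, symmetric] del: mem_ball mem_ball_0)
  next
    case False
    then have b: "ball (0::real^'n) R = {}" by simp
    then have e: "{x \<in> ball (0::real^'n) R. direction x \<in> A} = {}" by blast
    show ?thesis unfolding e1 e2 b e by simp
  qed
  have "m1 = m2"
  proof (rule measure_eqI_generator_eq[where E="range lessThan" and A="\<lambda>i. {..<real i}" and \<Omega>=UNIV])
    show "Int_stable (range lessThan :: real set set)"
    proof -
      have "{..<a} \<inter> {..<b} = {..<min a b}" for a b :: real by auto
      then show ?thesis by (auto simp: Int_stable_def)
    qed
    show "sets m1 = sigma_sets UNIV (range lessThan)" "sets m2 = sigma_sets UNIV (range lessThan)"
      by (simp_all add: m1_def m2_def borel_Iio)
    show "(\<Union>i. {..<real i}) = UNIV" using reals_Archimedean2 by auto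
    show "emeasure m1 {..<real i} \<noteq> \<infinity>" for i
    proof -
      have "emeasure m1 {..<real i} \<le> emeasure lborel (ball (0::real^'n) (real i))"
        unfolding e1 by (intro emeasure_mono) auto
      moreover have "emeasure lborel (ball (0::real^'n) (real i)) < \<infinity>" by (rule emeasure_ball_finite)
      ultimately show ?thesis by (auto simp: top_unique)
    qed
  qed (use eq in auto)
  have "(\<integral>\<^sup>+x. w (norm x) * indicator A (direction x) \<partial>lborel) = (\<integral>\<^sup>+x. w x \<partial>m1)"
    unfolding m1_def by (simp add: nn_integral_distr nn_integral_density mult.commute)
  also have "\<dots> = (\<integral>\<^sup>+x. w x \<partial>m2)" by (simp add: \<open>m1 = m2\<close>)
  also have "\<dots> = (\<integral>\<^sup>+x. w (norm x) \<partial>(lborel :: (real^'n) measure)) * ?s"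
    unfolding m2_def by (simp add: nn_integral_distr nn_integral_density nn_integral_cmult mult.commute)
  finally show ?thesis .
qed

text \<open>All radial probability densities share one law of directions, so the ball in the
  definition of \<open>unif_sphere\<close> may be exchanged for a Gaussian carrying an arbitrary
  radial weight.\<close>

lemma unif_sphere_eq_distr_radial:
  fixes w :: "real \<Rightarrow> ennreal"
  assumes [measurable]: "w \<in> borel_measurable borel" and w1: "(\<integral>\<^sup>+x. w (norm x) \<partial>(lborel :: (real^'n) measure)) = 1"
  shows "distr (density lborel (\<lambda>x. w (norm x))) borel direction = (unif_sphere :: (real^'n) measure)"
proof (rule measure_eqI)
  fix A :: "(real^'n) set" assume "A \<in> sets (distr (density lborel (\<lambda>x. w (norm x))) borel direction)"
  then have [measurable]: "A \<in> sets borel" by simp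
  have "emeasure (distr (density lborel (\<lambda>x. w (norm x))) borel direction) A = (\<integral>\<^sup>+x. w (norm x) * indicator (direction -` A) x \<partial>lborel)"
    by (subst emeasure_distr, simp, simp, subst emeasure_density) auto
  also have "\<dots> = (\<integral>\<^sup>+x. w (norm x) * indicator A (direction x) \<partial>lborel)"
    by (intro nn_integral_cong) (auto split: split_indicator)
  also have "\<dots> = emeasure unif_sphere A" by (simp add: polar_factorization w1)
  finally show "emeasure (distr (density lborel (\<lambda>x. w (norm x))) borel direction) A = emeasure unif_sphere A" .
qed simp

section \<open>Standard Gaussian vectors\<close>

definition std_gauss :: "(real^'n) measure" where
  "std_gauss = density lborel (\<lambda>x. ennreal (\<Prod>b\<in>Basis. std_normal_density (x \<bullet> b)))"

lemma std_gauss_radial: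
  "(\<Prod>b\<in>Basis. std_normal_density (x \<bullet> b)) = (1 / sqrt (2 * pi)) ^ CARD('n) * exp (- (norm x)\<^sup>2 / 2)" for x :: "real^'n"
proof -
  have "(norm x)\<^sup>2 = (\<Sum>b\<in>Basis. (x \<bullet> b)\<^sup>2)"
    by (subst power2_norm_eq_inner, subst euclidean_inner) (simp add: power2_eq_square)
  then have "exp (- (norm x)\<^sup>2 / 2) = (\<Prod>b\<in>Basis. exp (- (x \<bullet> b)\<^sup>2 / 2))"
    by (subst exp_sum[symmetric]) (simp_all add: sum_negf sum_divide_distrib)
  then show ?thesis
    by (simp add: std_normal_density_def prod.distrib power_one_over prod_dividef)
qed

lemma sets_std_gauss[simp, measurable_cong]: "sets std_gauss = sets borel"
  by (simp add: std_gauss_def)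

lemma space_std_gauss[simp]: "space std_gauss = UNIV"
  by (simp add: std_gauss_def)

lemma distr_std_gauss_coordinates:
  "distr (std_gauss :: (real^'n) measure) (PiM Basis (\<lambda>_. borel)) (\<lambda>x. \<lambda>b\<in>Basis. x \<bullet> b)
    = PiM Basis (\<lambda>_. density lborel std_normal_density)"
proof -
  interpret prob_space "density lborel std_normal_density" by (rule prob_space_normal_density) simp
  interpret product_sigma_finite "\<lambda>_::real^'n. density lborel std_normal_density" by standard
  show ?thesis
  proof (rule PiM_eqI)
    show "sets (distr std_gauss (PiM Basis (\<lambda>_. borel)) (\<lambda>x. \<lambda>b\<in>Basis. x \<bullet> b)) = sets (PiM Basis (\<lambda>_::real^'n. density lborel std_normal_density))"
      by (simp cong: sets_PiM_cong)
    fix A :: "real^'n \<Rightarrow> real set" assume A: "\<And>i. i \<in> Basis \<Longrightarrow> A i \<in> sets (density lborel std_normal_density)"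
    then have [measurable]: "\<And>i. i \<in> Basis \<Longrightarrow> A i \<in> sets borel" by simp
    have m[measurable]: "(\<lambda>x::real^'n. \<lambda>b\<in>Basis. x \<bullet> b) \<in> measurable borel (PiM Basis (\<lambda>_. borel))" by measurable
    have PA: "Pi\<^sub>E Basis A \<in> sets (PiM Basis (\<lambda>_. borel))" by (intro sets_PiM_I_finite) auto
    have "emeasure (distr std_gauss (PiM Basis (\<lambda>_. borel)) (\<lambda>x. \<lambda>b\<in>Basis. x \<bullet> b)) (Pi\<^sub>E Basis A)
        = emeasure std_gauss ((\<lambda>x. \<lambda>b\<in>Basis. x \<bullet> b) -` Pi\<^sub>E Basis A)"
      by (subst emeasure_distr) (use PA in auto)
    also have "\<dots> = (\<integral>\<^sup>+x. ennreal (\<Prod>b\<in>Basis. std_normal_density (x \<bullet> b)) * indicator ((\<lambda>x. \<lambda>b\<in>Basis. x \<bullet> b) -` Pi\<^sub>E Basis A) x \<partial>lborel)"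
      unfolding std_gauss_def by (rule emeasure_density) (use measurable_sets_borel[OF m] measurable_sets[OF m PA] in auto)
    also have "\<dots> = (\<integral>\<^sup>+x. (\<Prod>b\<in>Basis. ennreal (std_normal_density (x \<bullet> b)) * indicator (A b) (x \<bullet> b)) \<partial>lborel)"
    proof (intro nn_integral_cong)
      fix x :: "real^'n"
      have "indicator ((\<lambda>x. \<lambda>b\<in>Basis. x \<bullet> b) -` Pi\<^sub>E Basis A) x = (\<Prod>b\<in>Basis. indicator (A b) (x \<bullet> b) :: ennreal)"
        by (auto simp: indicator_def PiE_iff prod_zero_iff)
      then show "ennreal (\<Prod>b\<in>Basis. std_normal_density (x \<bullet> b)) * indicator ((\<lambda>x. \<lambda>b\<in>Basis. x \<bullet> b) -` Pi\<^sub>E Basis A) x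
        = (\<Prod>b\<in>Basis. ennreal (std_normal_density (x \<bullet> b)) * indicator (A b) (x \<bullet> b))"
        by (simp add: prod.distrib prod_ennreal)
    qed
    also have "\<dots> = (\<Prod>b\<in>Basis. \<integral>\<^sup>+x. ennreal (std_normal_density x) * indicator (A b) x \<partial>lborel)"
      by (subst nn_integral_lborel_prod) auto
    also have "\<dots> = (\<Prod>b\<in>Basis. emeasure (density lborel std_normal_density) (A b))"
      by (intro prod.cong) (auto simp: emeasure_density)
    finally show "emeasure (distr std_gauss (PiM Basis (\<lambda>_. borel)) (\<lambda>x. \<lambda>b\<in>Basis. x \<bullet> b)) (Pi\<^sub>E Basis A)
        = (\<Prod>b\<in>Basis. emeasure (density lborel std_normal_density) (A b))" .
  qed simp
qed

lemma prob_space_std_gauss: "prob_space (std_gauss :: (real^'n) measure)"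
proof (rule prob_spaceI)
  interpret N: prob_space "density lborel std_normal_density" by (rule prob_space_normal_density) simp
  interpret product_prob_space "\<lambda>_::real^'n. density lborel std_normal_density" by standard
  have "emeasure (std_gauss :: (real^'n) measure) (space std_gauss) = emeasure (distr (std_gauss :: (real^'n) measure) (PiM Basis (\<lambda>_. borel)) (\<lambda>x. \<lambda>b\<in>Basis. x \<bullet> b)) (space (PiM Basis (\<lambda>_. borel)))"
  proof -
    have "(\<lambda>x::real^'n. \<lambda>b\<in>Basis. x \<bullet> b) -` (Basis \<rightarrow>\<^sub>E UNIV) = UNIV" by auto
    then show ?thesis by (subst emeasure_distr) (simp_all add: space_PiM)
  qed
  also have "\<dots> = emeasure (PiM Basis (\<lambda>_. density lborel std_normal_density)) (space (PiM Basis (\<lambda>_::real^'n. density lborel std_normal_density)))"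
    unfolding distr_std_gauss_coordinates by (simp add: space_PiM)
  finally show "emeasure (std_gauss :: (real^'n) measure) (space std_gauss) = 1"
    using prob_space.emeasure_space_1[OF prob_space_PiM[of Basis "\<lambda>_. density lborel std_normal_density"]] N.prob_space_axioms by simp
qed

lemma distr_std_gauss_coordinate:
  assumes b: "b \<in> (Basis :: (real^'n) set)"
  shows "distr std_gauss borel (\<lambda>x. x \<bullet> b) = density lborel std_normal_density"
proof -
  interpret N: prob_space "density lborel std_normal_density" by (rule prob_space_normal_density) simp
  interpret product_prob_space "\<lambda>_::real^'n. density lborel std_normal_density" by standard
  have "distr std_gauss borel (\<lambda>x. x \<bullet> b) = distr (distr std_gauss (PiM Basis (\<lambda>_. borel)) (\<lambda>x. \<lambda>b\<in>Basis. x \<bullet> b)) borel (\<lambda>f. f b)"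
    using b by (subst distr_distr) (auto simp: comp_def)
  also have "\<dots> = distr (PiM Basis (\<lambda>_. density lborel std_normal_density)) (density lborel std_normal_density) (\<lambda>f. f b)"
    unfolding distr_std_gauss_coordinates by (rule distr_cong) auto
  also have "\<dots> = density lborel std_normal_density"
    by (rule distr_PiM_component) (use b N.prob_space_axioms in auto)
  finally show ?thesis .
qed

lemma distr_std_gauss_inner:
  assumes u: "norm (u :: real^'n) = 1"
  shows "distr std_gauss borel (\<lambda>x. u \<bullet> x) = density lborel std_normal_density"
proof -
  interpret prob_space "std_gauss :: (real^'n) measure" by (rule prob_space_std_gauss)
  \<comment> \<open>Coordinates with coefficient 0 are left out because a normal density needs a
    positive standard deviation.\<close>
  define I where "I = {b \<in> Basis. u \<bullet> b \<noteq> 0}"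
  have sq: "(\<Sum>b\<in>I. \<bar>u \<bullet> b\<bar>\<^sup>2) = 1"
  proof -
    have "1 = (\<Sum>b\<in>Basis. (u \<bullet> b)\<^sup>2)"
      using power2_norm_eq_inner[of u] u by (subst (asm) euclidean_inner) (simp add: power2_eq_square)
    also have "\<dots> = (\<Sum>b\<in>I. (u \<bullet> b)\<^sup>2)"
      unfolding I_def by (intro sum.mono_neutral_right) auto
    finally show ?thesis by simp
  qed
  then have I: "finite I" "I \<noteq> {}" by (auto simp: I_def intro: ccontr)
  have "indep_vars (\<lambda>_. borel) (\<lambda>b x. x \<bullet> b) (Basis :: (real^'n) set)"
    by (subst indep_vars_iff_distr_eq_PiM') (auto simp: distr_std_gauss_coordinates distr_std_gauss_coordinate intro!: PiM_cong)
  then have "indep_vars (\<lambda>_. borel) (\<lambda>b x. x \<bullet> b) I"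
    by (rule indep_vars_subset) (auto simp: I_def)
  then have "indep_vars (\<lambda>_. borel) (\<lambda>b x. 0 + (u \<bullet> b) * (x \<bullet> b)) I"
    by (rule indep_vars_compose2[where Y="\<lambda>b t. 0 + (u \<bullet> b) * t"]) auto
  moreover have "distributed std_gauss lborel (\<lambda>x. 0 + (u \<bullet> b) * (x \<bullet> b)) (normal_density (0 + (u \<bullet> b) * 0) (\<bar>u \<bullet> b\<bar> * 1))"
    if "b \<in> I" for b
    using that by (intro normal_density_affine) (auto simp: distributed_def distr_std_gauss_coordinate I_def cong: distr_cong)
  ultimately have "distributed std_gauss lborel (\<lambda>x. \<Sum>b\<in>I. 0 + (u \<bullet> b) * (x \<bullet> b)) (normal_density (\<Sum>b\<in>I. 0) (sqrt (\<Sum>b\<in>I. \<bar>u \<bullet> b\<bar>\<^sup>2)))"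
    by (intro sum_indep_normal I) (auto simp: I_def)
  moreover have "(\<Sum>b\<in>I. 0 + (u \<bullet> b) * (x \<bullet> b)) = u \<bullet> x" for x
    by (subst euclidean_inner) (auto simp: I_def intro!: sum.mono_neutral_left)
  ultimately have "distributed std_gauss lborel (\<lambda>x. u \<bullet> x) std_normal_density"
    by (simp only: sq) simp
  then show ?thesis by (simp add: distributed_def cong: distr_cong)
qed

lemma integral_std_gauss_inner:
  fixes f :: "real \<Rightarrow> real"
  assumes u: "norm (u :: real^'n) = 1" and [measurable]: "f \<in> borel_measurable borel"
  shows "(\<integral>x. f (u \<bullet> x) \<partial>std_gauss) = (\<integral>t. std_normal_density t * f t \<partial>lborel)"
    and "integrable std_gauss (\<lambda>x. f (u \<bullet> x)) \<longleftrightarrow> integrable lborel (\<lambda>t. std_normal_density t * f t)"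
proof -
  have "(\<integral>x. f (u \<bullet> x) \<partial>std_gauss) = (\<integral>t. f t \<partial>distr std_gauss borel (\<lambda>x. u \<bullet> x))"
    by (rule integral_distr[symmetric]) auto
  also have "\<dots> = (\<integral>t. std_normal_density t * f t \<partial>lborel)"
    unfolding distr_std_gauss_inner[OF u] by (simp add: integral_density)
  finally show "(\<integral>x. f (u \<bullet> x) \<partial>std_gauss) = (\<integral>t. std_normal_density t * f t \<partial>lborel)" .
  have "integrable std_gauss (\<lambda>x. f (u \<bullet> x)) \<longleftrightarrow> integrable (distr std_gauss borel (\<lambda>x. u \<bullet> x)) f"
    by (rule integrable_distr_eq[symmetric]) auto
  also have "\<dots> \<longleftrightarrow> integrable lborel (\<lambda>t. std_normal_density t * f t)"
    unfolding distr_std_gauss_inner[OF u] by (simp add: integrable_density)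
  finally show "integrable std_gauss (\<lambda>x. f (u \<bullet> x)) \<longleftrightarrow> integrable lborel (\<lambda>t. std_normal_density t * f t)" .
qed

lemma std_normal_exp:
  "integrable lborel (\<lambda>t. std_normal_density t * exp (l * t))" (is ?A)
  "(\<integral>t. std_normal_density t * exp (l * t) \<partial>lborel) = exp (l\<^sup>2 / 2)" (is ?B)
proof -
  have "std_normal_density t * exp (l * t) = exp (l\<^sup>2 / 2) * normal_density l 1 t" for t
    by (simp add: normal_density_def exp_add[symmetric] power2_eq_square field_simps)
  then show ?A ?B by (simp_all)
qed

lemma std_normal_cosh:
  "integrable lborel (\<lambda>t. std_normal_density t * cosh (l * t))"
  "(\<integral>t. std_normal_density t * cosh (l * t) \<partial>lborel) = exp (l\<^sup>2 / 2)"
  using std_normal_exp[of l] std_normal_exp[of "-l"]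
  by (simp_all add: cosh_def distrib_left add_divide_distrib)

lemma std_normal_square:
  "integrable lborel (\<lambda>t. std_normal_density t * t\<^sup>2)"
  "(\<integral>t. std_normal_density t * t\<^sup>2 \<partial>lborel) = 1"
  using std_normal_moment_even[of 1] by (simp_all add: has_bochner_integral_iff)

lemma std_normal_abs:
  "integrable lborel (\<lambda>t. std_normal_density t * \<bar>t\<bar>)"
  "(\<integral>t. std_normal_density t * \<bar>t\<bar> \<partial>lborel) = sqrt (2 / pi)"
  using std_normal_moment_abs_odd[of 0] by (simp_all add: has_bochner_integral_iff)

lemma std_gauss_norm_square:
  "integrable (std_gauss :: (real^'n) measure) (\<lambda>x. (norm x)\<^sup>2)"
  "(\<integral>x. (norm x)\<^sup>2 \<partial>(std_gauss :: (real^'n) measure)) = CARD('n)"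
proof -
  have eq: "(norm x)\<^sup>2 = (\<Sum>b\<in>Basis. (b \<bullet> x)\<^sup>2)" for x :: "real^'n"
    by (subst power2_norm_eq_inner, subst euclidean_inner) (simp add: power2_eq_square inner_commute)
  show "integrable (std_gauss :: (real^'n) measure) (\<lambda>x. (norm x)\<^sup>2)"
    unfolding eq by (intro Bochner_Integration.integrable_sum)
      (simp add: integral_std_gauss_inner(2)[where f="\<lambda>t. t\<^sup>2"] std_normal_square)
  show "(\<integral>x. (norm x)\<^sup>2 \<partial>(std_gauss :: (real^'n) measure)) = CARD('n)"
    unfolding eq by (subst Bochner_Integration.integral_sum)
      (simp_all add: integral_std_gauss_inner[where f="\<lambda>t. t\<^sup>2"] std_normal_square)
qed

section \<open>Moments of the sphere from Gaussian moments\<close>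

text \<open>The weight \<open>h\<close> is free up to normalization. A multiple of t^2 or of the
  absolute value restores the power of the norm lost in \<open>direction x\<close>, so that
  homogeneous integrands become functions of u \<bullet> x alone; comparing two weights shows that
  functions of the direction are uncorrelated with functions of the norm.\<close>

lemma unif_sphere_via_gauss:
  fixes h :: "real \<Rightarrow> real" and f :: "real^'n \<Rightarrow> real"
  assumes [measurable]: "h \<in> borel_measurable borel" "f \<in> borel_measurable borel" and h: "\<And>t. 0 \<le> h t"
    and ih: "integrable (std_gauss :: (real^'n) measure) (\<lambda>x. h (norm x))"
    and h1: "(\<integral>x. h (norm x) \<partial>(std_gauss :: (real^'n) measure)) = 1"
  shows "(\<integral>x. f x \<partial>unif_sphere) = (\<integral>x. h (norm x) * f (direction x) \<partial>std_gauss)"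
proof -
  define g where "g t = (1 / sqrt (2 * pi)) ^ CARD('n) * exp (- t\<^sup>2 / 2)" for t :: real
  have [measurable]: "g \<in> borel_measurable borel" unfolding g_def by measurable
  have gauss: "(std_gauss :: (real^'n) measure) = density lborel (\<lambda>x. ennreal (g (norm x)))"
    by (simp add: std_gauss_def std_gauss_radial g_def)
  have d: "density std_gauss (\<lambda>x. ennreal (h (norm x))) = density lborel (\<lambda>x::real^'n. ennreal (g (norm x)) * ennreal (h (norm x)))"
    unfolding gauss by (rule density_density_eq) auto
  have "(\<integral>\<^sup>+x. ennreal (g (norm x)) * ennreal (h (norm x)) \<partial>(lborel :: (real^'n) measure)) = (\<integral>\<^sup>+x. ennreal (h (norm x)) \<partial>(std_gauss :: (real^'n) measure))"
    unfolding gauss by (subst nn_integral_density) auto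
  also have "\<dots> = 1"
    using nn_integral_eq_integral[OF ih] h1 h by simp
  finally have eq: "unif_sphere = distr (density std_gauss (\<lambda>x. ennreal (h (norm x)))) borel (direction :: real^'n \<Rightarrow> _)"
    unfolding d by (subst unif_sphere_eq_distr_radial[where w="\<lambda>t. ennreal (g t) * ennreal (h t)"]) auto
  show "(\<integral>x. f x \<partial>unif_sphere) = (\<integral>x. h (norm x) * f (direction x) \<partial>std_gauss)"
    unfolding eq by (subst integral_distr) (auto simp: integral_density h)
qed

lemma unif_sphere_inner_square:
  assumes u: "norm (u :: real^'n) = 1"
  shows "(\<integral>x. (u \<bullet> x)\<^sup>2 \<partial>unif_sphere) = 1 / CARD('n)"
proof -
  have "(\<integral>x. (u \<bullet> x)\<^sup>2 \<partial>unif_sphere) = (\<integral>x. (norm x)\<^sup>2 / CARD('n) * (u \<bullet> direction x)\<^sup>2 \<partial>std_gauss)"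
    by (rule unif_sphere_via_gauss[where h="\<lambda>t. t\<^sup>2 / CARD('n)"])
      (simp_all add: std_gauss_norm_square)
  also have "\<dots> = (\<integral>x. (u \<bullet> x)\<^sup>2 / CARD('n) \<partial>std_gauss)"
    by (intro Bochner_Integration.integral_cong) (auto simp: power_divide field_simps)
  also have "\<dots> = 1 / CARD('n)"
    using integral_std_gauss_inner[OF u, of "\<lambda>t. t\<^sup>2"] by (simp add: std_normal_square)
  finally show ?thesis .
qed

text \<open>Weighting by the norm divided by its Gaussian mean \<open>m\<close> turns the integral
  into \<open>sqrt (2 / pi) / m\<close>, and \<open>m\<close> is at most the root mean square
  \<open>sqrt CARD('n)\<close>. This is the origin of the leading term of \<A>.\<close>

lemma unif_sphere_inner_abs:
  assumes u: "norm (u :: real^'n) = 1"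
  shows "(\<integral>x. \<bar>u \<bullet> x\<bar> \<partial>unif_sphere) \<ge> sqrt (2 / pi) / sqrt CARD('n)"
proof -
  interpret prob_space "std_gauss :: (real^'n) measure" by (rule prob_space_std_gauss)
  define m where "m = (\<integral>x. norm x \<partial>(std_gauss :: (real^'n) measure))"
  have i: "integrable (std_gauss :: (real^'n) measure) norm"
  proof (rule Bochner_Integration.integrable_bound)
    show "integrable (std_gauss :: (real^'n) measure) (\<lambda>x. 1 + (norm x)\<^sup>2)"
      by (simp add: std_gauss_norm_square)
    show "AE x in (std_gauss :: (real^'n) measure). norm (norm x) \<le> norm (1 + (norm x)\<^sup>2)"
    proof (rule AE_I2)
      fix x :: "real^'n"
      have "0 \<le> (norm x - 1)\<^sup>2" by simp
      then have "2 * norm x \<le> 1 + (norm x)\<^sup>2" by (simp add: power2_diff)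
      then show "norm (norm x) \<le> norm (1 + (norm x)\<^sup>2)" by simp (smt (verit) norm_ge_zero)
    qed
  qed simp
  have m2: "m\<^sup>2 \<le> CARD('n)"
    using variance_positive[of norm] variance_eq[OF i std_gauss_norm_square(1)] by (simp add: m_def std_gauss_norm_square(2))
  have ia: "integrable std_gauss (\<lambda>x. \<bar>u \<bullet> x\<bar>)" and ea: "(\<integral>x. \<bar>u \<bullet> x\<bar> \<partial>std_gauss) = sqrt (2 / pi)"
    using integral_std_gauss_inner[OF u, of abs] by (simp_all add: std_normal_abs)
  \<comment> \<open>Gives the positivity of \<open>m\<close>, by which the weight is
    divided.\<close>
  have "sqrt (2 / pi) \<le> m" unfolding m_def ea[symmetric]
    by (rule integral_mono[OF ia i]) (use Cauchy_Schwarz_ineq2[of u] u in auto)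
  moreover have "0 < sqrt (2 / pi)" by simp
  ultimately have m0: "0 < m" by linarith
  have "(\<integral>x. \<bar>u \<bullet> x\<bar> \<partial>unif_sphere) = (\<integral>x. \<bar>norm x\<bar> / m * \<bar>u \<bullet> direction x\<bar> \<partial>std_gauss)"
    by (rule unif_sphere_via_gauss[where h="\<lambda>t. \<bar>t\<bar> / m"]) (use m0 i in \<open>simp_all add: m_def[symmetric]\<close>)
  also have "\<dots> = (\<integral>x. \<bar>u \<bullet> x\<bar> / m \<partial>std_gauss)"
    by (intro Bochner_Integration.integral_cong) (auto simp: abs_mult field_simps)
  also have "\<dots> = sqrt (2 / pi) / m" by (simp add: ea)
  also have "\<dots> \<ge> sqrt (2 / pi) / sqrt CARD('n)"
    using m0 m2 by (intro divide_left_mono) (auto intro!: real_le_rsqrt)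
  finally show ?thesis .
qed

text \<open>The sphere in dimension k is no worse than a Gaussian of variance 1 / k. In polar form
  the Gaussian moment averages cosh over a radius of mean square 1, and the tangent of
  \<open>cosh_ge_tangent_in_square\<close> keeps only the mean on the sphere.\<close>

lemma unif_sphere_cosh:
  assumes u: "norm (u :: real^'n) = 1"
  shows "(\<integral>x. cosh (l * (u \<bullet> x)) \<partial>unif_sphere) \<le> exp (l\<^sup>2 / (2 * real CARD('n)))"
proof -
  interpret prob_space "std_gauss :: (real^'n) measure" by (rule prob_space_std_gauss)
  let ?k = "real CARD('n)"
  define a where "a = (\<lambda>x. cosh (l * (u \<bullet> direction x)))"
  define b where "b = (\<lambda>x. l * (u \<bullet> direction x) * sinh (l * (u \<bullet> direction x)) / 2)"
  have [measurable]: "(cosh :: real \<Rightarrow> real) \<in> borel_measurable borel" "(sinh :: real \<Rightarrow> real) \<in> borel_measurable borel"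
    by (intro borel_measurable_continuous_onI continuous_intros)+
  have am[measurable]: "a \<in> borel_measurable borel" "b \<in> borel_measurable borel" unfolding a_def b_def by measurable
  have ud: "\<bar>u \<bullet> direction x\<bar> \<le> 1" for x
    using Cauchy_Schwarz_ineq2[of u "direction x"] u by (cases "x = 0") auto
  have lu: "\<bar>l * (u \<bullet> direction x)\<bar> \<le> \<bar>l\<bar>" for x
    using mult_left_mono[OF ud, of "\<bar>l\<bar>" x] by (simp add: abs_mult)
  have aB: "\<bar>a x\<bar> \<le> cosh \<bar>l\<bar>" for x
  proof -
    have "cosh \<bar>l * (u \<bullet> direction x)\<bar> \<le> cosh \<bar>l\<bar>"
      by (rule cosh_real_nonneg_le_iff[THEN iffD2]) (use lu in auto)
    then show ?thesis by (simp add: a_def cosh_real_nonneg del: abs_mult)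
  qed
  have ia: "integrable std_gauss a" by (rule integrable_bounded[OF _ aB]) auto
  have bB: "\<bar>b x\<bar> \<le> \<bar>l\<bar> * sinh \<bar>l\<bar>" for x
  proof -
    have "\<bar>sinh (l * (u \<bullet> direction x))\<bar> \<le> sinh \<bar>l\<bar>"
      unfolding sinh_real_abs[symmetric] by (rule sinh_real_le_iff[THEN iffD2]) (use lu in simp)
    then have "\<bar>l * (u \<bullet> direction x)\<bar> * \<bar>sinh (l * (u \<bullet> direction x))\<bar> \<le> \<bar>l\<bar> * sinh \<bar>l\<bar>"
      using lu[of x] by (intro mult_mono) auto
    moreover have "0 \<le> \<bar>l\<bar> * sinh \<bar>l\<bar>" by simp
    ultimately show ?thesis unfolding b_def abs_divide abs_mult[of "l * _"] by linarith
  qed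
  have ib: "integrable std_gauss b" by (rule integrable_bounded[OF _ bB]) auto
  have ib2: "integrable std_gauss (\<lambda>x. (norm x)\<^sup>2 * b x)"
  proof (rule Bochner_Integration.integrable_bound)
    define K where "K = \<bar>l\<bar> * sinh \<bar>l\<bar>"
    show "integrable (std_gauss :: (real^'n) measure) (\<lambda>x. (norm x)\<^sup>2 * K)"
      by (simp add: std_gauss_norm_square)
    have "\<bar>(norm x)\<^sup>2 * b x\<bar> \<le> \<bar>(norm x)\<^sup>2 * K\<bar>" for x
      unfolding abs_mult using bB[of x] by (intro mult_left_mono) (auto simp: K_def simp del: sinh_real_abs)
    then show "AE x in std_gauss. norm ((norm x)\<^sup>2 * b x) \<le> norm ((norm x)\<^sup>2 * K)"
      by simp
  qed simp
  have e1: "(\<integral>x. cosh (l * (u \<bullet> x)) \<partial>unif_sphere) = (\<integral>x. a x \<partial>std_gauss)"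
    using unif_sphere_via_gauss[of "\<lambda>_. 1" "\<lambda>x. cosh (l * (u \<bullet> x))"] by (simp add: a_def prob_space[simplified])
  \<comment> \<open>One integral on the sphere computed with two weights, 1 here and the normalized
    squared norm in \<open>e3\<close>. Hence the linear term of the tangent has mean 0.\<close>
  have e2: "(\<integral>x. l * (u \<bullet> x) * sinh (l * (u \<bullet> x)) / 2 \<partial>unif_sphere) = (\<integral>x. b x \<partial>std_gauss)"
    using unif_sphere_via_gauss[of "\<lambda>_. 1" "\<lambda>x. l * (u \<bullet> x) * sinh (l * (u \<bullet> x)) / 2"] by (simp add: b_def prob_space[simplified])
  have e3: "(\<integral>x. l * (u \<bullet> x) * sinh (l * (u \<bullet> x)) / 2 \<partial>unif_sphere) = (\<integral>x. (norm x)\<^sup>2 / ?k * b x \<partial>std_gauss)"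
    unfolding b_def by (rule unif_sphere_via_gauss[where h="\<lambda>t. t\<^sup>2 / ?k"]) (simp_all add: std_gauss_norm_square)
  define l' where "l' = l / sqrt ?k"
  have "(\<integral>x. a x \<partial>std_gauss) = (\<integral>x. a x + b x * ((norm x)\<^sup>2 / ?k - 1) \<partial>std_gauss)"
  proof -
    have "(\<integral>x. a x + b x * ((norm x)\<^sup>2 / ?k - 1) \<partial>std_gauss) = (\<integral>x. a x + ((norm x)\<^sup>2 / ?k * b x - b x) \<partial>std_gauss)"
      by (simp add: algebra_simps)
    also have "\<dots> = (\<integral>x. a x \<partial>std_gauss) + ((\<integral>x. (norm x)\<^sup>2 / ?k * b x \<partial>std_gauss) - (\<integral>x. b x \<partial>std_gauss))"
      using ia ib ib2 by simp
    finally show ?thesis using e2 e3 by simp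
  qed
  also have "\<dots> \<le> (\<integral>x. cosh (l' * (u \<bullet> x)) \<partial>std_gauss)"
  proof (rule integral_mono)
    show "integrable std_gauss (\<lambda>x. a x + b x * ((norm x)\<^sup>2 / ?k - 1))"
      using ia ib ib2 by (simp add: algebra_simps)
    show "integrable std_gauss (\<lambda>x. cosh (l' * (u \<bullet> x)))"
      using integral_std_gauss_inner(2)[OF u, of "\<lambda>t. cosh (l' * t)"] std_normal_cosh(1)[of l'] by simp
    fix x :: "real^'n"
    have "cosh (l * (u \<bullet> direction x)) + l * (u \<bullet> direction x) * sinh (l * (u \<bullet> direction x)) / 2 * ((norm x / sqrt ?k)\<^sup>2 - 1)
        \<le> cosh (l * (u \<bullet> direction x) * (norm x / sqrt ?k))" by (rule cosh_ge_tangent_in_square)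
    also have "l * (u \<bullet> direction x) * (norm x / sqrt ?k) = l' * (u \<bullet> x)" by (cases "x = 0") (auto simp: l'_def)
    finally show "a x + b x * ((norm x)\<^sup>2 / ?k - 1) \<le> cosh (l' * (u \<bullet> x))"
      by (simp add: a_def b_def power_divide)
  qed
  also have "\<dots> = exp (l'\<^sup>2 / 2)"
    using integral_std_gauss_inner(1)[OF u, of "\<lambda>t. cosh (l' * t)"] std_normal_cosh(2)[of l'] by simp
  also have "l'\<^sup>2 / 2 = l\<^sup>2 / (2 * ?k)" by (simp add: l'_def power_divide)
  finally show ?thesis unfolding e1 .
qed

section \<open>Reflection and proper subspaces\<close>

lemma distr_unif_sphere_uminus: "distr unif_sphere borel uminus = (unif_sphere :: (real^'n) measure)"
proof -
  have u: "distr lborel borel uminus = (lborel :: (real^'n) measure)"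
    using lborel_affine[of "-1" "0::real^'n"] by (simp add: density_1)
  have "emeasure (distr lborel borel uminus) A = emeasure lborel A" if "A \<in> sets borel" for A :: "(real^'n) set"
    by (simp add: u)
  then have *: "emeasure lborel (uminus -` A) = emeasure lborel A" if "A \<in> sets borel" for A :: "(real^'n) set"
    using that by (simp add: emeasure_distr)
  show ?thesis
  proof (rule measure_eqI)
    fix A :: "(real^'n) set" assume "A \<in> sets (distr unif_sphere borel uminus)"
    then have [measurable]: "A \<in> sets borel" by simp
    have mA: "A \<in> sets borel" "uminus -` A \<in> sets borel" by (simp, rule measurable_sets_borel[of _ borel], simp_all)
    have e: "{x \<in> ball 0 1. direction x \<in> uminus -` A} = uminus -` {x \<in> ball (0::real^'n) 1. direction x \<in> A}" by auto
    have "{x \<in> ball (0::real^'n) 1. direction x \<in> A} \<in> sets borel" by measurable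
    then have "emeasure lborel {x \<in> ball 0 1. direction x \<in> uminus -` A} = emeasure lborel {x \<in> ball 0 1. direction x \<in> A}"
      unfolding e by (rule *)
    then have "emeasure unif_sphere (uminus -` A) * emeasure lborel (ball (0::real^'n) 1) = emeasure unif_sphere A * emeasure lborel (ball (0::real^'n) 1)"
      unfolding emeasure_unif_sphere[OF mA(1)] emeasure_unif_sphere[OF mA(2)] .
    moreover have "emeasure lborel (ball (0::real^'n) 1) \<noteq> 0" "emeasure lborel (ball (0::real^'n) 1) < \<infinity>"
      by (simp_all add: emeasure_ball_finite emeasure_ball_nonzero del: infinity_ennreal_def)
    ultimately have "emeasure unif_sphere (uminus -` A) = emeasure unif_sphere A"
      by (metis infinity_ennreal_def mult_divide_eq_ennreal order_less_irrefl)
    then show "emeasure (distr unif_sphere borel uminus) A = emeasure unif_sphere A"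
      by (simp add: emeasure_distr)
  qed simp
qed

text \<open>A proper subspace is Lebesgue null and invariant under scaling. This keeps outliers off
  the inlier subspace almost surely.\<close>

lemma AE_unif_sphere_not_in_subspace:
  assumes V: "subspace V" "V \<noteq> (UNIV :: (real^'n) set)"
  shows "AE x in unif_sphere. x \<notin> V"
proof -
  have "span V \<noteq> UNIV" using V by (simp add: span_eq_iff[THEN iffD2])
  then have "dim V \<noteq> DIM(real^'n)" using dim_eq_full[of V] by simp
  then have "dim V < DIM(real^'n)" using dim_subset_UNIV[of V] by linarith
  then have "negligible V" by (rule negligible_lowdim)
  moreover have cV: "closed V" by (rule closed_subspace) fact
  ultimately have "V \<in> null_sets lborel"
    by (metis borel_closed negligible_iff_null_sets null_sets_completion_iff sets_lborel)
  then have "AE x in lborel. x \<notin> V" by (rule AE_not_in)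
  then have "AE x in uniform_measure lborel (ball (0::real^'n) 1). x \<notin> V"
    by (intro AE_uniform_measureI) auto
  then have "AE x in uniform_measure lborel (ball (0::real^'n) 1). direction x \<notin> V"
  proof (rule eventually_mono)
    fix x assume x: "x \<notin> V"
    then have "x \<noteq> 0" using subspace_0[OF V(1)] by auto
    then have "x = norm x *\<^sub>R direction x" by simp
    then show "direction x \<notin> V" using x subspace_scale[OF V(1)] by metis
  qed
  moreover have "{x. x \<notin> V} \<in> sets borel"
    using cV by (simp add: Compl_eq[symmetric] borel_comp borel_closed)
  ultimately show ?thesis unfolding unif_sphere_def
    by (subst AE_distr_iff) auto
qed

section \<open>A one-sided exponential Efron--Stein inequality\<close>

locale iid_product = prob_space N for N :: "'a measure"
begin

abbreviation P :: "nat \<Rightarrow> (nat \<Rightarrow> 'a) measure" where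
  "P n \<equiv> PiM {..<n} (\<lambda>_. N)"

lemma prob_space_P: "prob_space (P n)"
  by (rule prob_space_PiM) (rule prob_space_axioms)

lemma fun_upd_measurable[measurable]:
  "(\<lambda>(x, y). x(n := y)) \<in> measurable (P n \<Otimes>\<^sub>M N) (P (Suc n))"
  using measurable_add_dim[of n "{..<n}" "\<lambda>_. N"] by (simp add: lessThan_Suc)

lemma fun_upd_in_space: "x \<in> space (P n) \<Longrightarrow> y \<in> space N \<Longrightarrow> x(n := y) \<in> space (P (Suc n))"
  by (auto simp: space_PiM PiE_def Pi_def extensional_def)

lemma fun_upd_in_space': "x \<in> space (P n) \<Longrightarrow> i < n \<Longrightarrow> y \<in> space N \<Longrightarrow> x(i := y) \<in> space (P n)"
  by (auto simp: space_PiM PiE_def Pi_def extensional_def)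

text \<open>Collects what an induction on the number of coordinates needs when the last one is split
  off: both orders of integration, and measurability and bounds of the inner integrals. The eight
  conclusions are cited by position.\<close>

lemma integral_P_Suc:
  fixes F :: "(nat \<Rightarrow> 'a) \<Rightarrow> real"
  assumes [measurable]: "F \<in> borel_measurable (P (Suc n))" and B: "\<And>x. \<bar>F x\<bar> \<le> B"
  shows "(\<integral>x. F x \<partial>P (Suc n)) = (\<integral>x. (\<integral>y. F (x(n := y)) \<partial>N) \<partial>P n)"
    and "(\<integral>x. F x \<partial>P (Suc n)) = (\<integral>y. (\<integral>x. F (x(n := y)) \<partial>P n) \<partial>N)"
    and "(\<lambda>x. \<integral>y. F (x(n := y)) \<partial>N) \<in> borel_measurable (P n)"
    and "(\<lambda>y. \<integral>x. F (x(n := y)) \<partial>P n) \<in> borel_measurable N"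
    and "\<bar>\<integral>y. F (x(n := y)) \<partial>N\<bar> \<le> B"
    and "x \<in> space (P n) \<Longrightarrow> (\<lambda>y. F (x(n := y))) \<in> borel_measurable N"
    and "y \<in> space N \<Longrightarrow> (\<lambda>x. F (x(n := y))) \<in> borel_measurable (P n)"
    and "\<bar>\<integral>x. F (x(n := y)) \<partial>P n\<bar> \<le> B"
proof -
  interpret Pn: prob_space "P n" by (rule prob_space_P)
  interpret PS: prob_space "P (Suc n)" by (rule prob_space_P)
  interpret PN: pair_prob_space "P n" N ..
  interpret product_sigma_finite "\<lambda>_::nat. N" by standard
  have i: "integrable (P (Suc n)) F" by (rule PS.integrable_bounded) fact+
  have m[measurable]: "(\<lambda>(x, y). F (x(n := y))) \<in> borel_measurable (P n \<Otimes>\<^sub>M N)"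
    using measurable_compose[OF fun_upd_measurable assms(1)] by (simp add: split_def)
  have i2: "integrable (P n \<Otimes>\<^sub>M N) (\<lambda>(x, y). F (x(n := y)))"
    by (rule PN.integrable_bounded[of _ B]) (use B m in auto)
  show "(\<integral>x. F x \<partial>P (Suc n)) = (\<integral>x. (\<integral>y. F (x(n := y)) \<partial>N) \<partial>P n)"
    using product_integral_insert[of "{..<n}" n F] i by (simp add: lessThan_Suc)
  also have "\<dots> = (\<integral>y. (\<integral>x. F (x(n := y)) \<partial>P n) \<partial>N)"
    using PN.Fubini_integral[OF i2] by simp
  finally show "(\<integral>x. F x \<partial>P (Suc n)) = (\<integral>y. (\<integral>x. F (x(n := y)) \<partial>P n) \<partial>N)" .
  show "(\<lambda>x. \<integral>y. F (x(n := y)) \<partial>N) \<in> borel_measurable (P n)"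
    using borel_measurable_lebesgue_integral[OF m] by simp
  show "(\<lambda>y. \<integral>x. F (x(n := y)) \<partial>P n) \<in> borel_measurable N"
    using Pn.borel_measurable_lebesgue_integral[of "\<lambda>y x. F (x(n := y))"] measurable_pair_swap[OF m] by simp
  show m1: "(\<lambda>y. F (x(n := y))) \<in> borel_measurable N" if "x \<in> space (P n)" for x
    using measurable_Pair2[OF m that] by simp
  show m2: "(\<lambda>x. F (x(n := y))) \<in> borel_measurable (P n)" if "y \<in> space N" for y
    using measurable_Pair1[OF m that] by simp
  show "\<bar>\<integral>y. F (x(n := y)) \<partial>N\<bar> \<le> B"
    using abs_expectation_le[of "\<lambda>y. F (x(n := y))" B] B by simp
  show "\<bar>\<integral>x. F (x(n := y)) \<partial>P n\<bar> \<le> B"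
    using Pn.abs_expectation_le[of "\<lambda>x. F (x(n := y))" B] B by simp
qed

text \<open>Averaging out the last coordinate preserves the hypothesis by Jensen's inequality, so the one-dimensional estimate can be iterated.\<close>

lemma exp_moment_efron_stein:
  fixes F :: "(nat \<Rightarrow> 'a) \<Rightarrow> real"
  assumes "F \<in> borel_measurable (P n)" and "\<And>x. \<bar>F x\<bar> \<le> B"
    and "\<And>x i. x \<in> space (P n) \<Longrightarrow> i < n \<Longrightarrow> (\<integral>y. (max 0 (F x - F (x(i := y))))\<^sup>2 \<partial>N) \<le> v"
    and "0 \<le> l"
  shows "(\<integral>x. exp (l * F x) \<partial>P n) \<le> exp (l * (\<integral>x. F x \<partial>P n) + n * l\<^sup>2 * v / 2)"
  using assms(1-3)
proof (induction n arbitrary: F)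
  case 0
  show ?case by (simp add: PiM_empty lebesgue_integral_count_space_finite)
next
  case (Suc n)
  note [measurable] = Suc.prems(1) and B = Suc.prems(2)
  interpret Pn: prob_space "P n" by (rule prob_space_P)
  note FS = integral_P_Suc[OF Suc.prems(1,2)]
  define G where "G x = (\<integral>y. F (x(n := y)) \<partial>N)" for x
  have Gm[measurable]: "G \<in> borel_measurable (P n)" unfolding G_def by (rule FS)
  have GB: "\<bar>G x\<bar> \<le> B" for x unfolding G_def by (rule FS)
  have EB: "\<bar>exp (l * F x)\<bar> \<le> exp (l * B)" for x using B[of x] \<open>0 \<le> l\<close> by (auto intro!: mult_left_mono)
  note ES = integral_P_Suc[of "\<lambda>x. exp (l * F x)", OF _ EB]
  have row: "(\<integral>y. exp (l * F (x(n := y))) \<partial>N) \<le> exp (l * G x + l\<^sup>2 * v / 2)" if x: "x \<in> space (P n)" for x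
    unfolding G_def
  proof (rule exp_moment_one_sided_increments[OF FS(6)[OF x] B _ \<open>0 \<le> l\<close>])
    fix y assume y: "y \<in> space N"
    show "(\<integral>z. (max 0 (F (x(n := y)) - F (x(n := z))))\<^sup>2 \<partial>N) \<le> v"
      using Suc.prems(3)[OF fun_upd_in_space[OF x y] lessI] by (simp only: fun_upd_upd)
  qed
  have "(\<integral>x. exp (l * F x) \<partial>P (Suc n)) = (\<integral>x. (\<integral>y. exp (l * F (x(n := y))) \<partial>N) \<partial>P n)"
    by (rule ES) measurable
  also have "\<dots> \<le> (\<integral>x. exp (l * G x + l\<^sup>2 * v / 2) \<partial>P n)"
  proof (rule integral_mono)
    show "integrable (P n) (\<lambda>x. \<integral>y. exp (l * F (x(n := y))) \<partial>N)"
      by (rule Pn.integrable_bounded[OF ES(3) ES(5)]) measurable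
    show "integrable (P n) (\<lambda>x. exp (l * G x + l\<^sup>2 * v / 2))"
      by (rule Pn.integrable_bounded[of _ "exp (l * B + l\<^sup>2 * v / 2)"])
        (use GB \<open>0 \<le> l\<close> in \<open>auto simp: abs_le_iff intro!: mult_left_mono\<close>)
  qed (rule row)
  also have "\<dots> = exp (l\<^sup>2 * v / 2) * (\<integral>x. exp (l * G x) \<partial>P n)"
    by (simp add: exp_add mult.commute)
  also have "(\<integral>x. exp (l * G x) \<partial>P n) \<le> exp (l * (\<integral>x. G x \<partial>P n) + n * l\<^sup>2 * v / 2)"
  proof (rule Suc.IH[OF Gm GB])
    fix x i assume x: "x \<in> space (P n)" and i: "i < n"
    \<comment> \<open>Increment in coordinate \<open>i\<close> with the last coordinate equal to
      \<open>z\<close> on both sides. The positive part of a mean is at most the mean of the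
      positive parts, so averages of \<open>h\<close> dominate the increments of
      \<open>G\<close>.\<close>
    define h where "h y z = max 0 (F (x(n := z)) - F ((x(i := y))(n := z)))" for y z
    have hB: "\<bar>h y z\<bar> \<le> 2 * B" for y z
      using B[of "x(n := z)"] B[of "(x(i := y))(n := z)"] unfolding h_def by linarith
    have u: "(\<lambda>y. x(i := y)) \<in> measurable N (P n)"
      by (rule measurable_fun_upd[where J="{..<n}"]) (use i x in auto)
    have [measurable]: "(\<lambda>p. (x(i := fst p))(n := snd p)) \<in> measurable (N \<Otimes>\<^sub>M N) (P (Suc n))"
      by (rule measurable_fun_upd[where J="{..<n}"]) (auto intro: measurable_compose[OF measurable_fst u])
    have [measurable]: "(\<lambda>z. x(n := z)) \<in> measurable N (P (Suc n))"
      by (rule measurable_fun_upd[where J="{..<n}"]) (use x in auto)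
    have [measurable]: "(\<lambda>p. x(n := snd p)) \<in> measurable (N \<Otimes>\<^sub>M N) (P (Suc n))"
      by (rule measurable_compose[OF measurable_snd]) measurable
    have hm: "(\<lambda>p. h (fst p) (snd p)) \<in> borel_measurable (N \<Otimes>\<^sub>M N)"
      unfolding h_def by measurable
    have hm1: "h y \<in> borel_measurable N" if "y \<in> space N" for y
      using measurable_Pair2[OF hm that] by simp
    interpret NN: pair_prob_space N N ..
    have ih: "integrable (N \<Otimes>\<^sub>M N) (\<lambda>(y, z). (h y z)\<^sup>2)"
      using NN.integrable_square_bounded[OF hm, of "2*B"] hB by (simp add: split_def)
    have "(\<integral>y. (max 0 (G x - G (x(i := y))))\<^sup>2 \<partial>N) \<le> (\<integral>y. (\<integral>z. (h y z)\<^sup>2 \<partial>N) \<partial>N)"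
    proof (rule integral_mono)
      have "(\<lambda>y. G (x(i := y))) \<in> borel_measurable N" by (rule measurable_compose[OF u Gm])
      then have "(\<lambda>y. max 0 (G x - G (x(i := y)))) \<in> borel_measurable N" by measurable
      moreover have "\<bar>max 0 (G x - G (x(i := y)))\<bar> \<le> 2 * B" for y
        using GB[of x] GB[of "x(i := y)"] by (auto simp: abs_le_iff max_def)
      ultimately show "integrable N (\<lambda>y. (max 0 (G x - G (x(i := y))))\<^sup>2)"
        by (rule integrable_square_bounded)
      show "integrable N (\<lambda>y. \<integral>z. (h y z)\<^sup>2 \<partial>N)"
        using NN.integrable_fst'[OF ih] by simp
      fix y assume y: "y \<in> space N"
      have xy: "x(i := y) \<in> space (P n)" by (rule fun_upd_in_space'[OF x i y])
      have i1: "integrable N (\<lambda>z. F (x(n := z)))" by (rule integrable_bounded[OF FS(6)[OF x] B])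
      have i2: "integrable N (\<lambda>z. F ((x(i := y))(n := z)))" by (rule integrable_bounded[OF FS(6)[OF xy] B])
      have ihy: "integrable N (h y)" by (rule integrable_bounded[OF hm1[OF y] hB])
      have "G x - G (x(i := y)) = (\<integral>z. F (x(n := z)) - F ((x(i := y))(n := z)) \<partial>N)"
        unfolding G_def by (rule Bochner_Integration.integral_diff[OF i1 i2, symmetric])
      also have "\<dots> \<le> (\<integral>z. h y z \<partial>N)"
        by (rule integral_mono) (use i1 i2 ihy in \<open>auto simp: h_def\<close>)
      finally have "max 0 (G x - G (x(i := y))) \<le> (\<integral>z. h y z \<partial>N)"
        by (auto simp: h_def intro!: integral_nonneg_AE)
      then have "(max 0 (G x - G (x(i := y))))\<^sup>2 \<le> (\<integral>z. h y z \<partial>N)\<^sup>2"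
        by (intro power_mono) auto
      also have "\<dots> \<le> (\<integral>z. (h y z)\<^sup>2 \<partial>N)"
        by (rule square_expectation_le[OF hm1[OF y] hB])
      finally show "(max 0 (G x - G (x(i := y))))\<^sup>2 \<le> (\<integral>z. (h y z)\<^sup>2 \<partial>N)" .
    qed
    \<comment> \<open>The exchange moves the mean over the replacement \<open>y\<close> inside,
      where the hypothesis on \<open>F\<close> applies for each fixed \<open>z\<close>.\<close>
    also have "\<dots> = (\<integral>z. (\<integral>y. (h y z)\<^sup>2 \<partial>N) \<partial>N)"
      using NN.Fubini_integral[OF ih] by simp
    also have "\<dots> \<le> (\<integral>z. v \<partial>N)"
    proof (rule integral_mono)
      show "integrable N (\<lambda>z. \<integral>y. (h y z)\<^sup>2 \<partial>N)"
        using NN.integrable_snd[OF ih] by simp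
      fix z assume z: "z \<in> space N"
      have eq: "(x(i := y))(n := z) = (x(n := z))(i := y)" for y using i by (simp add: fun_upd_twist)
      show "(\<integral>y. (h y z)\<^sup>2 \<partial>N) \<le> v"
        using Suc.prems(3)[OF fun_upd_in_space[OF x z] less_SucI[OF i]] by (simp only: h_def eq)
    qed simp
    finally show "(\<integral>y. (max 0 (G x - G (x(i := y))))\<^sup>2 \<partial>N) \<le> v" by (simp add: prob_space)
  qed
  also have "(\<integral>x. G x \<partial>P n) = (\<integral>x. F x \<partial>P (Suc n))" unfolding G_def by (rule FS(1)[symmetric])
  finally show ?case
    by (simp add: exp_add[symmetric] algebra_simps add_divide_distrib)
qed

end

section \<open>Symmetrization and contraction\<close>

text \<open>The maxima with \<open>\<plusminus> \<bar>x u\<bar>\<close> are dominated, in one order or the other, by those with \<open>\<plusminus> x u\<close>,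
  depending on the sign of \<open>x\<close> at the first maximizer.\<close>

lemma contraction_Max:
  fixes \<Phi> :: "real \<Rightarrow> real" and x R :: "'u \<Rightarrow> real"
  assumes T: "finite T" "T \<noteq> {}" and \<Phi>: "mono \<Phi>"
  shows "\<Phi> (MAX u\<in>T. R u + \<bar>x u\<bar>) + \<Phi> (MAX u\<in>T. R u - \<bar>x u\<bar>) \<le> \<Phi> (MAX u\<in>T. R u + x u) + \<Phi> (MAX u\<in>T. R u - x u)"
proof -
  have max: "(MAX u\<in>T. f u) \<in> f ` T" for f :: "'u \<Rightarrow> real" using T by (intro Max_in) auto
  have le: "f u \<le> (MAX u\<in>T. f u)" if "u \<in> T" for f :: "'u \<Rightarrow> real" and u using T that by (intro Max_ge) auto
  obtain u where u: "u \<in> T" "(MAX u\<in>T. R u + \<bar>x u\<bar>) = R u + \<bar>x u\<bar>" using max[of "\<lambda>u. R u + \<bar>x u\<bar>"] by auto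
  obtain v where v: "v \<in> T" "(MAX u\<in>T. R u - \<bar>x u\<bar>) = R v - \<bar>x v\<bar>" using max[of "\<lambda>u. R u - \<bar>x u\<bar>"] by auto
  show ?thesis
  proof (cases "0 \<le> x u")
    case True
    have "R u + \<bar>x u\<bar> \<le> (MAX u\<in>T. R u + x u)" using le[OF u(1), of "\<lambda>u. R u + x u"] True by simp
    moreover have "R v - \<bar>x v\<bar> \<le> (MAX u\<in>T. R u - x u)" using le[OF v(1), of "\<lambda>u. R u - x u"] by linarith
    ultimately show ?thesis unfolding u(2) v(2) using monoD[OF \<Phi>] by (meson add_mono)
  next
    case False
    have "R u + \<bar>x u\<bar> \<le> (MAX u\<in>T. R u - x u)" using le[OF u(1), of "\<lambda>u. R u - x u"] False by simp
    moreover have "R v - \<bar>x v\<bar> \<le> (MAX u\<in>T. R u + x u)" using le[OF v(1), of "\<lambda>u. R u + x u"] by linarith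
    ultimately show ?thesis unfolding u(2) v(2) using monoD[OF \<Phi>] by (smt (verit))
  qed
qed

lemma borel_measurable_MAX:
  fixes f :: "'u \<Rightarrow> 'b \<Rightarrow> real"
  assumes "finite T" "T \<noteq> {}" "\<And>u. u \<in> T \<Longrightarrow> f u \<in> borel_measurable M"
  shows "(\<lambda>x. MAX u\<in>T. f u x) \<in> borel_measurable M"
  using assms by (intro borel_measurable_Max) auto

lemma abs_MAX_le:
  fixes f :: "'u \<Rightarrow> real"
  assumes "finite T" "T \<noteq> {}" "\<And>u. u \<in> T \<Longrightarrow> \<bar>f u\<bar> \<le> B"
  shows "\<bar>MAX u\<in>T. f u\<bar> \<le> B"
proof -
  have "(MAX u\<in>T. f u) \<in> f ` T" using assms by (intro Max_in) auto
  then show ?thesis using assms(3) by auto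
qed

lemma mono_abs_le:
  fixes \<Phi> :: "real \<Rightarrow> real"
  assumes "mono \<Phi>" "\<bar>t\<bar> \<le> B"
  shows "\<bar>\<Phi> t\<bar> \<le> \<bar>\<Phi> B\<bar> + \<bar>\<Phi> (-B)\<bar>"
  using monoD[OF assms(1), of t B] monoD[OF assms(1), of "-B" t] assms(2) by (auto simp: abs_le_iff)

text \<open>Symmetry of the law of \<open>p\<close> takes the place of Rademacher signs. The second
  and exponential moments are those of, or dominated by, a Gaussian of variance 1 / r in each
  direction.\<close>

locale iid_vectors = iid_product N for N :: "'a measure" +
  fixes p :: "'a \<Rightarrow> real^'r"
  assumes p_measurable[measurable]: "p \<in> borel_measurable N"
    and p_norm: "norm (p y) \<le> 1"
    and p_symmetric: "distr N borel (\<lambda>y. - p y) = distr N borel p"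
    and p_square: "norm u = 1 \<Longrightarrow> (\<integral>y. (u \<bullet> p y)\<^sup>2 \<partial>N) = 1 / real CARD('r)"
    and p_cosh: "norm u = 1 \<Longrightarrow> (\<integral>y. cosh (l * (u \<bullet> p y)) \<partial>N) \<le> exp (l\<^sup>2 / (2 * real CARD('r)))"
begin

lemma inner_p: "\<bar>u \<bullet> p y\<bar> \<le> norm u"
  using Cauchy_Schwarz_ineq2[of u "p y"] mult_left_mono[OF p_norm norm_ge_zero, of u y] by simp

lemma expectation_symmetric:
  fixes f :: "real^'r \<Rightarrow> real"
  assumes [measurable]: "f \<in> borel_measurable borel"
  shows "(\<integral>y. f (- p y) \<partial>N) = (\<integral>y. f (p y) \<partial>N)"
  using arg_cong[OF p_symmetric, of "\<lambda>M. \<integral>x. f x \<partial>M"] by (simp add: integral_distr)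

lemma expectation_inner_p: "(\<integral>y. u \<bullet> p y \<partial>N) = 0"
  using expectation_symmetric[of "\<lambda>x. u \<bullet> x"] by simp

lemma expectation_inner_square: "(\<integral>y. (u \<bullet> p y)\<^sup>2 \<partial>N) = (norm u)\<^sup>2 / real CARD('r)"
proof (cases "u = 0")
  case False
  have "(\<integral>y. (u \<bullet> p y)\<^sup>2 \<partial>N) = (\<integral>y. (norm u)\<^sup>2 * ((u /\<^sub>R norm u) \<bullet> p y)\<^sup>2 \<partial>N)"
    using False by (simp add: power_mult_distrib field_simps)
  then show ?thesis using p_square[of "u /\<^sub>R norm u"] False by simp
qed simp

lemma expectation_cosh: "(\<integral>y. cosh (u \<bullet> p y) \<partial>N) \<le> exp ((norm u)\<^sup>2 / (2 * real CARD('r)))"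
proof (cases "u = 0")
  case False
  then have eq: "norm u * ((u /\<^sub>R norm u) \<bullet> p y) = u \<bullet> p y" for y by simp
  have "norm (u /\<^sub>R norm u) = 1" using False by simp
  from p_cosh[OF this, of "norm u"] show ?thesis unfolding eq .
qed (simp add: prob_space)

lemma expectation_exp: "(\<integral>y. exp (u \<bullet> p y) \<partial>N) \<le> exp ((norm u)\<^sup>2 / (2 * real CARD('r)))"
proof -
  have i: "integrable N (\<lambda>y. exp (u \<bullet> p y))" for u
    by (rule integrable_bounded[of _ "exp (norm u)"]) (use inner_p[of u] in \<open>auto simp: abs_le_iff\<close>)
  have "(\<integral>y. cosh (u \<bullet> p y) \<partial>N) = (\<integral>y. exp (u \<bullet> p y) / 2 + exp ((-u) \<bullet> p y) / 2 \<partial>N)"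
    by (simp add: cosh_def add_divide_distrib)
  also have "\<dots> = (\<integral>y. exp (u \<bullet> p y) \<partial>N) / 2 + (\<integral>y. exp ((-u) \<bullet> p y) \<partial>N) / 2"
    using i[of u] i[of "-u"] by simp
  also have "(\<integral>y. exp ((-u) \<bullet> p y) \<partial>N) = (\<integral>y. exp (u \<bullet> p y) \<partial>N)"
    using expectation_symmetric[of "\<lambda>x. exp (u \<bullet> x)"] by simp
  finally show ?thesis using expectation_cosh[of u] by simp
qed

definition mean_abs :: "real^'r \<Rightarrow> real" where
  "mean_abs u = (\<integral>y. \<bar>u \<bullet> p y\<bar> \<partial>N)"

lemma mean_abs_bounds: "0 \<le> mean_abs u" "mean_abs u \<le> norm u"
proof -
  show "0 \<le> mean_abs u" unfolding mean_abs_def by (rule integral_nonneg_AE) simp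
  show "mean_abs u \<le> norm u"
    unfolding mean_abs_def using abs_expectation_le[of "\<lambda>y. \<bar>u \<bullet> p y\<bar>" "norm u"] inner_p[of u] by simp
qed

lemma mean_abs_le: "mean_abs u \<le> norm u / sqrt (real CARD('r))"
proof -
  have "(mean_abs u)\<^sup>2 \<le> (\<integral>y. \<bar>u \<bullet> p y\<bar>\<^sup>2 \<partial>N)"
    unfolding mean_abs_def by (rule square_expectation_le[of _ "norm u"]) (use inner_p[of u] in auto)
  also have "\<dots> = (norm u / sqrt (real CARD('r)))\<^sup>2"
    by (simp add: expectation_inner_square power_divide)
  finally show ?thesis by (rule power2_le_imp_le) simp
qed

lemma norm_sum_p: "norm (\<Sum>i<n. p (x i)) \<le> real n"
  using order_trans[OF norm_sum[of "\<lambda>i. p (x i)" "{..<n}"] sum_bounded_above[of "{..<n}" "\<lambda>i. norm (p (x i))" 1]] p_norm by simp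

text \<open>With Y the absolute inner product, R + s (Y - E Y) is the midpoint of R + 2 s Y and R -
  2 s E Y, and Jensen bounds the second by the maximum with reflected sign. Both signs of 2 Y then
  occur with weight 1/2, as under a random sign, and \<open>contraction_Max\<close> removes the
  absolute values. The factor 2 of symmetrization is this doubling.\<close>

lemma symmetrization_step:
  fixes \<Phi> :: "real \<Rightarrow> real" and R :: "real^'r \<Rightarrow> real"
  assumes T: "finite T" "T \<noteq> {}" "\<And>u. u \<in> T \<Longrightarrow> norm u \<le> 1"
    and \<Phi>: "mono \<Phi>" "convex_on UNIV \<Phi>" and s: "\<bar>s\<bar> = 1"
  shows "(\<integral>y. \<Phi> (MAX u\<in>T. R u + s * (\<bar>u \<bullet> p y\<bar> - mean_abs u)) \<partial>N) \<le> (\<integral>y. \<Phi> (MAX u\<in>T. R u + 2 * (u \<bullet> p y)) \<partial>N)"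
proof -
  define K where "K = (MAX u\<in>T. \<bar>R u\<bar>)"
  have RK: "\<bar>R u\<bar> \<le> K" if "u \<in> T" for u unfolding K_def using T that by (intro Max_ge) auto
  have \<Phi>m[measurable]: "\<Phi> \<in> borel_measurable borel" by (rule borel_measurable_mono) fact
  have ip: "\<bar>u \<bullet> p y\<bar> \<le> 1" if "u \<in> T" for u y using inner_p[of u y] T(3)[OF that] by linarith
  have iMAX: "integrable N (\<lambda>y. MAX u\<in>T. R u + a * \<bar>u \<bullet> p y\<bar> + b * (u \<bullet> p y) + c u)"
    and i\<Phi>: "integrable N (\<lambda>y. \<Phi> (MAX u\<in>T. R u + a * \<bar>u \<bullet> p y\<bar> + b * (u \<bullet> p y) + c u))" for a b :: real and c
  proof -
    define C where "C = (MAX u\<in>T. \<bar>c u\<bar>)"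
    have C: "\<bar>c u\<bar> \<le> C" if "u \<in> T" for u unfolding C_def using T that by (intro Max_ge) auto
    have m: "(\<lambda>y. MAX u\<in>T. R u + a * \<bar>u \<bullet> p y\<bar> + b * (u \<bullet> p y) + c u) \<in> borel_measurable N"
      by (intro borel_measurable_MAX T) measurable
    have B: "\<bar>MAX u\<in>T. R u + a * \<bar>u \<bullet> p y\<bar> + b * (u \<bullet> p y) + c u\<bar> \<le> K + \<bar>a\<bar> + \<bar>b\<bar> + C" for y
    proof (rule abs_MAX_le[OF T(1,2)])
      fix u assume u: "u \<in> T"
      have "\<bar>a * \<bar>u \<bullet> p y\<bar>\<bar> \<le> \<bar>a\<bar>" "\<bar>b * (u \<bullet> p y)\<bar> \<le> \<bar>b\<bar>"
        using ip[OF u, of y] by (simp_all add: abs_mult mult_left_le)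
      then show "\<bar>R u + a * \<bar>u \<bullet> p y\<bar> + b * (u \<bullet> p y) + c u\<bar> \<le> K + \<bar>a\<bar> + \<bar>b\<bar> + C"
        using RK[OF u] C[OF u] by linarith
    qed
    show "integrable N (\<lambda>y. MAX u\<in>T. R u + a * \<bar>u \<bullet> p y\<bar> + b * (u \<bullet> p y) + c u)"
      by (rule integrable_bounded[OF m B])
    show "integrable N (\<lambda>y. \<Phi> (MAX u\<in>T. R u + a * \<bar>u \<bullet> p y\<bar> + b * (u \<bullet> p y) + c u))"
      by (rule integrable_bounded[OF measurable_compose[OF m \<Phi>m] mono_abs_le[OF \<Phi>(1) B]])
  qed
  define A where "A t y = (MAX u\<in>T. R u + t * \<bar>u \<bullet> p y\<bar>)" for t y
  define D where "D t y = (MAX u\<in>T. R u + t * (u \<bullet> p y))" for t y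
  have iA: "integrable N (A t)" "integrable N (\<lambda>y. \<Phi> (A t y))" for t
    using iMAX[of t 0 "\<lambda>_. 0"] i\<Phi>[of t 0 "\<lambda>_. 0"] by (simp_all add: A_def[abs_def])
  have iD: "integrable N (D t)" "integrable N (\<lambda>y. \<Phi> (D t y))" for t
    using iMAX[of 0 t "\<lambda>_. 0"] i\<Phi>[of 0 t "\<lambda>_. 0"] by (simp_all add: D_def[abs_def])
  define E where "E = (\<integral>y. A (- 2 * s) y \<partial>N)"
  have iabs: "integrable N (\<lambda>y. \<bar>u \<bullet> p y\<bar>)" for u
    by (rule integrable_bounded[of _ "norm u"]) (use inner_p[of u] in auto)
  have meanR: "R u - 2 * s * mean_abs u \<le> E" if u: "u \<in> T" for u
  proof -
    have "R u - 2 * s * mean_abs u = (\<integral>y. R u + (- 2 * s) * \<bar>u \<bullet> p y\<bar> \<partial>N)"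
      using iabs[of u] by (simp add: mean_abs_def prob_space)
    also have "\<dots> \<le> E" unfolding E_def
      by (rule integral_mono) (use iabs iA T u in \<open>auto simp: A_def\<close>)
    finally show ?thesis .
  qed
  have pt: "\<Phi> (MAX u\<in>T. R u + s * (\<bar>u \<bullet> p y\<bar> - mean_abs u)) \<le> \<Phi> (A (2 * s) y) / 2 + \<Phi> E / 2" for y
  proof -
    have "(MAX u\<in>T. R u + s * (\<bar>u \<bullet> p y\<bar> - mean_abs u)) \<le> A (2 * s) y / 2 + E / 2"
    proof (subst Max_le_iff, goal_cases)
      case 3
      show ?case
      proof (intro ballI, elim imageE, clarify)
        fix u assume u: "u \<in> T"
        have "R u + 2 * s * \<bar>u \<bullet> p y\<bar> \<le> A (2 * s) y" unfolding A_def using T u by (intro Max_ge) auto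
        then show "R u + s * (\<bar>u \<bullet> p y\<bar> - mean_abs u) \<le> A (2 * s) y / 2 + E / 2"
          using meanR[OF u] by (simp add: algebra_simps)
      qed
    qed (use T in auto)
    then have "\<Phi> (MAX u\<in>T. R u + s * (\<bar>u \<bullet> p y\<bar> - mean_abs u)) \<le> \<Phi> ((1/2) *\<^sub>R A (2 * s) y + (1/2) *\<^sub>R E)"
      by (intro monoD[OF \<Phi>(1)]) simp
    also have "\<dots> \<le> 1/2 * \<Phi> (A (2 * s) y) + 1/2 * \<Phi> E"
      using convex_onD[OF \<Phi>(2), of "1/2" "A (2 * s) y" E] by simp
    finally show ?thesis by simp
  qed
  have "(\<integral>y. \<Phi> (MAX u\<in>T. R u + s * (\<bar>u \<bullet> p y\<bar> - mean_abs u)) \<partial>N) \<le> (\<integral>y. \<Phi> (A (2 * s) y) / 2 + \<Phi> E / 2 \<partial>N)"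
    using i\<Phi>[of s 0 "\<lambda>u. - s * mean_abs u"] iA(2)[of "2 * s"] pt
    by (intro integral_mono) (auto simp: algebra_simps)
  also have "\<dots> = (\<integral>y. \<Phi> (A (2 * s) y) \<partial>N) / 2 + \<Phi> E / 2"
    using iA(2)[of "2 * s"] by (simp add: prob_space)
  also have "\<Phi> E \<le> (\<integral>y. \<Phi> (A (- 2 * s) y) \<partial>N)"
    unfolding E_def by (rule jensens_inequality[OF iA(1) _ _ iA(2) \<Phi>(2)]) auto
  also have "(\<integral>y. \<Phi> (A (2 * s) y) \<partial>N) / 2 + (\<integral>y. \<Phi> (A (- 2 * s) y) \<partial>N) / 2
      = (\<integral>y. (\<Phi> (A 2 y) + \<Phi> (A (-2) y)) / 2 \<partial>N)"
    using s iA(2)[of 2] iA(2)[of "-2"] by (cases "s = 1") (auto simp: abs_if add_divide_distrib split: if_splits)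
  also have "\<dots> \<le> (\<integral>y. (\<Phi> (D 2 y) + \<Phi> (D (- 2) y)) / 2 \<partial>N)"
  proof (rule integral_mono)
    fix y
    show "(\<Phi> (A 2 y) + \<Phi> (A (-2) y)) / 2 \<le> (\<Phi> (D 2 y) + \<Phi> (D (- 2) y)) / 2"
      using contraction_Max[OF T(1,2) \<Phi>(1), of R "\<lambda>u. 2 * (u \<bullet> p y)"] by (simp add: A_def D_def abs_mult)
  qed (use iA(2) iD(2) in auto)
  also have "\<dots> = ((\<integral>y. \<Phi> (D 2 y) \<partial>N) + (\<integral>y. \<Phi> (D (- 2) y) \<partial>N)) / 2"
    using iD(2) by simp
  also have "(\<integral>y. \<Phi> (D (- 2) y) \<partial>N) = (\<integral>y. \<Phi> (D 2 y) \<partial>N)"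
  proof -
    have [measurable]: "(\<lambda>x. MAX u\<in>T. R u + 2 * (u \<bullet> x)) \<in> borel_measurable borel"
      by (intro borel_measurable_MAX T) measurable
    show ?thesis
      using expectation_symmetric[of "\<lambda>x. \<Phi> (MAX u\<in>T. R u + 2 * (u \<bullet> x))"] by (simp add: D_def)
  qed
  finally show ?thesis by (simp add: D_def)
qed

lemma iid_p_measurable[measurable]: "i < n \<Longrightarrow> (\<lambda>x. p (x i)) \<in> borel_measurable (P n)"
  by (rule measurable_compose[OF measurable_component_singleton[of i "{..<n}" "\<lambda>_. N"] p_measurable]) simp

text \<open>Coordinates are exchanged one at a time, and \<open>R\<close> is arbitrary because it
  absorbs those already made linear. A general \<Phi> covers both the mean, with the identity, and
  exponential moments.\<close>

lemma symmetrization: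
  fixes \<Phi> :: "real \<Rightarrow> real" and R :: "real^'r \<Rightarrow> real"
  assumes T: "finite T" "T \<noteq> {}" "\<And>u. u \<in> T \<Longrightarrow> norm u \<le> 1"
    and \<Phi>: "mono \<Phi>" "convex_on UNIV \<Phi>" and s: "\<bar>s\<bar> = 1"
  shows "(\<integral>x. \<Phi> (MAX u\<in>T. R u + (\<Sum>i<n. s * (\<bar>u \<bullet> p (x i)\<bar> - mean_abs u))) \<partial>P n)
    \<le> (\<integral>x. \<Phi> (MAX u\<in>T. R u + 2 * (u \<bullet> (\<Sum>i<n. p (x i)))) \<partial>P n)"
proof (induction n arbitrary: R)
  case (Suc n)
  interpret Pn: prob_space "P n" by (rule prob_space_P)
  define K where "K = (MAX u\<in>T. \<bar>R u\<bar>)"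
  have RK: "\<bar>R u\<bar> \<le> K" if "u \<in> T" for u unfolding K_def using T that by (intro Max_ge) auto
  have \<Phi>m[measurable]: "\<Phi> \<in> borel_measurable borel" by (rule borel_measurable_mono) fact
  have ip: "\<bar>u \<bullet> p y\<bar> \<le> 1" if "u \<in> T" for u y using inner_p[of u y] T(3)[OF that] by linarith
  have ia: "\<bar>s * (\<bar>u \<bullet> p y\<bar> - mean_abs u)\<bar> \<le> 1" if u: "u \<in> T" for u y
    using s ip[OF u, of y] mean_abs_bounds[of u] T(3)[OF u] by (auto simp: abs_mult abs_le_iff)
  define F1 where "F1 x = \<Phi> (MAX u\<in>T. R u + (\<Sum>i<Suc n. s * (\<bar>u \<bullet> p (x i)\<bar> - mean_abs u)))" for x
  \<comment> \<open>The hybrid: the last coordinate is linear, the others are still centred absolute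
    values.\<close>
  define F2 where "F2 x = \<Phi> (MAX u\<in>T. (R u + 2 * (u \<bullet> p (x n))) + (\<Sum>i<n. s * (\<bar>u \<bullet> p (x i)\<bar> - mean_abs u)))" for x
  define F3 where "F3 x = \<Phi> (MAX u\<in>T. R u + 2 * (u \<bullet> (\<Sum>i<Suc n. p (x i))))" for x
  define BB where "BB = \<bar>\<Phi> (K + 2 * Suc n)\<bar> + \<bar>\<Phi> (-(K + 2 * Suc n))\<bar>"
  have m1: "F1 \<in> borel_measurable (P (Suc n))" unfolding F1_def
    by (intro measurable_compose[OF _ \<Phi>m] borel_measurable_MAX T) measurable
  have m2: "F2 \<in> borel_measurable (P (Suc n))" unfolding F2_def
    by (intro measurable_compose[OF _ \<Phi>m] borel_measurable_MAX T) measurable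
  have m3: "F3 \<in> borel_measurable (P (Suc n))" unfolding F3_def
    by (intro measurable_compose[OF _ \<Phi>m] borel_measurable_MAX T) measurable
  have sb: "\<bar>\<Sum>i<m. f i\<bar> \<le> m" if "\<And>i. \<bar>f i\<bar> \<le> 1" for f :: "nat \<Rightarrow> real" and m
    using order_trans[OF sum_abs[of f "{..<m}"] sum_bounded_above[of "{..<m}" "\<lambda>i. \<bar>f i\<bar>" 1]] that by simp
  have b1: "\<bar>F1 x\<bar> \<le> BB" for x unfolding F1_def BB_def
  proof (intro mono_abs_le \<Phi> abs_MAX_le T(1,2))
    fix u assume u: "u \<in> T"
    show "\<bar>R u + (\<Sum>i<Suc n. s * (\<bar>u \<bullet> p (x i)\<bar> - mean_abs u))\<bar> \<le> K + 2 * Suc n"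
      using order_trans[OF abs_triangle_ineq add_mono[OF RK[OF u] sb[of "\<lambda>i. s * (\<bar>u \<bullet> p (x i)\<bar> - mean_abs u)" "Suc n", OF ia[OF u]]]]
      by simp
  qed
  have b2: "\<bar>F2 x\<bar> \<le> BB" for x unfolding F2_def BB_def
  proof (intro mono_abs_le \<Phi> abs_MAX_le T(1,2))
    fix u assume u: "u \<in> T"
    have "real (2 * Suc n) = 2 * real n + 2" by simp
    then show "\<bar>(R u + 2 * (u \<bullet> p (x n))) + (\<Sum>i<n. s * (\<bar>u \<bullet> p (x i)\<bar> - mean_abs u))\<bar> \<le> K + 2 * Suc n"
      using RK[OF u] sb[of "\<lambda>i. s * (\<bar>u \<bullet> p (x i)\<bar> - mean_abs u)" n, OF ia[OF u]] ip[OF u, of "x n"] by linarith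
  qed
  have b3: "\<bar>F3 x\<bar> \<le> BB" for x unfolding F3_def BB_def
  proof (intro mono_abs_le \<Phi> abs_MAX_le T(1,2))
    fix u assume u: "u \<in> T"
    have "\<bar>u \<bullet> (\<Sum>i<Suc n. p (x i))\<bar> \<le> Suc n"
      unfolding inner_sum_right by (rule sb) (rule ip[OF u])
    moreover have "\<bar>a\<bar> \<le> k \<Longrightarrow> \<bar>b\<bar> \<le> m \<Longrightarrow> \<bar>a + 2 * b\<bar> \<le> k + 2 * m" for a b k m :: real by linarith
    ultimately have "\<bar>R u + 2 * (u \<bullet> (\<Sum>i<Suc n. p (x i)))\<bar> \<le> K + 2 * real (Suc n)"
      using RK[OF u] by blast
    then show "\<bar>R u + 2 * (u \<bullet> (\<Sum>i<Suc n. p (x i)))\<bar> \<le> K + 2 * Suc n" by simp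
  qed
  note I1 = integral_P_Suc[OF m1 b1] and I2 = integral_P_Suc[OF m2 b2] and I3 = integral_P_Suc[OF m3 b3]
  have "(\<integral>x. F1 x \<partial>P (Suc n)) = (\<integral>x. (\<integral>y. F1 (x(n := y)) \<partial>N) \<partial>P n)" by (rule I1)
  also have "\<dots> \<le> (\<integral>x. (\<integral>y. F2 (x(n := y)) \<partial>N) \<partial>P n)"
  proof (rule integral_mono)
    fix x
    show "(\<integral>y. F1 (x(n := y)) \<partial>N) \<le> (\<integral>y. F2 (x(n := y)) \<partial>N)"
      using symmetrization_step[OF T \<Phi> s, of "\<lambda>u. R u + (\<Sum>i<n. s * (\<bar>u \<bullet> p (x i)\<bar> - mean_abs u))"]
      unfolding F1_def F2_def by (simp add: algebra_simps)
  qed (use Pn.integrable_bounded[OF I1(3,5)] Pn.integrable_bounded[OF I2(3,5)] in auto)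
  also have "\<dots> = (\<integral>y. (\<integral>x. F2 (x(n := y)) \<partial>P n) \<partial>N)" using I2(1,2) by simp
  also have "\<dots> \<le> (\<integral>y. (\<integral>x. F3 (x(n := y)) \<partial>P n) \<partial>N)"
  proof (rule integral_mono)
    fix y
    show "(\<integral>x. F2 (x(n := y)) \<partial>P n) \<le> (\<integral>x. F3 (x(n := y)) \<partial>P n)"
      using Suc.IH[of "\<lambda>u. R u + 2 * (u \<bullet> p y)"]
      unfolding F2_def F3_def by (simp add: algebra_simps)
  qed (use integrable_bounded[OF I2(4,8)] integrable_bounded[OF I3(4,8)] in auto)
  also have "\<dots> = (\<integral>x. F3 x \<partial>P (Suc n))" by (rule I3(2)[symmetric])
  finally show ?case by (simp only: F1_def F3_def)
qed simp

text \<open>The shift \<open>w\<close> carries the summands already processed; mixed terms vanish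
  because \<open>p\<close> is centred.\<close>

lemma expectation_norm_square:
  "(\<integral>x. (norm (w + (\<Sum>i<n. p (x i))))\<^sup>2 \<partial>P n) \<le> (norm w)\<^sup>2 + n"
proof (induction n arbitrary: w)
  case 0
  show ?case by (simp add: PiM_empty lebesgue_integral_count_space_finite)
next
  case (Suc n)
  define F where "F x = (norm (w + (\<Sum>i<Suc n. p (x i))))\<^sup>2" for x
  have m: "F \<in> borel_measurable (P (Suc n))" unfolding F_def by measurable
  have b: "\<bar>F x\<bar> \<le> (norm w + Suc n)\<^sup>2" for x
  proof -
    have "norm (w + (\<Sum>i<Suc n. p (x i))) \<le> norm w + Suc n"
      by (rule order_trans[OF norm_triangle_ineq]) (intro add_left_mono norm_sum_p)
    then show ?thesis unfolding F_def by (simp add: power_mono)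
  qed
  note I = integral_P_Suc[OF m b]
  have iw: "integrable N (\<lambda>y. w \<bullet> p y)" by (rule integrable_bounded[of _ "norm w"]) (use inner_p[of w] in auto)
  have "(\<integral>x. F x \<partial>P (Suc n)) = (\<integral>y. (\<integral>x. F (x(n := y)) \<partial>P n) \<partial>N)" by (rule I)
  also have "\<dots> \<le> (\<integral>y. (norm w)\<^sup>2 + 2 * (w \<bullet> p y) + 1 + n \<partial>N)"
  proof (rule integral_mono)
    show "integrable N (\<lambda>y. (norm w)\<^sup>2 + 2 * (w \<bullet> p y) + 1 + n)"
      using iw by simp
    fix y
    have "(\<integral>x. F (x(n := y)) \<partial>P n) \<le> (norm (w + p y))\<^sup>2 + n"
      using Suc.IH[of "w + p y"] by (simp add: F_def algebra_simps)
    moreover have "(norm (w + p y))\<^sup>2 = (norm w)\<^sup>2 + 2 * (w \<bullet> p y) + (norm (p y))\<^sup>2"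
      by (simp add: power2_norm_eq_inner inner_add inner_commute)
    moreover have "(norm (p y))\<^sup>2 \<le> 1" using p_norm[of y] by (simp add: power_le_one)
    ultimately show "(\<integral>x. F (x(n := y)) \<partial>P n) \<le> (norm w)\<^sup>2 + 2 * (w \<bullet> p y) + 1 + n" by linarith
  qed (rule integrable_bounded[OF I(4,8)])
  also have "\<dots> = (norm w)\<^sup>2 + 1 + n"
    using iw by (simp add: prob_space expectation_inner_p)
  finally show ?case by (simp add: F_def)
qed

text \<open>Integrating out one summand replaces the coefficient \<open>\<gamma>\<close> of the squared norm by \<open>\<gamma> + 2 * \<gamma>\<^sup>2 / r\<close>,
  so that \<open>1 / \<gamma>\<close> decreases by at most \<open>2 / r\<close>.\<close>

lemma expectation_exp_norm_square:
  assumes "0 < c"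
  shows "(\<integral>x. exp ((norm (w + (\<Sum>i<n. p (x i))))\<^sup>2 / (c + 2 * n / CARD('r))) \<partial>P n) \<le> exp (((norm w)\<^sup>2 + n) / c)"
  using assms
proof (induction n arbitrary: w c)
  case 0
  then show ?case by (simp add: PiM_empty lebesgue_integral_count_space_finite)
next
  case (Suc n)
  let ?r = "real CARD('r)"
  have r: "?r > 0" by simp
  define c' where "c' = c + 2 / ?r"
  have c': "0 < c'" using Suc.prems r by (simp add: c'_def add_pos_pos)
  define e where "e = c + 2 * Suc n / ?r"
  have e: "e = c' + 2 * n / ?r" "0 < e" using r Suc.prems by (simp_all add: e_def c'_def field_simps add_pos_nonneg)
  define F where "F x = exp ((norm (w + (\<Sum>i<Suc n. p (x i))))\<^sup>2 / e)" for x
  have m: "F \<in> borel_measurable (P (Suc n))" unfolding F_def by measurable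
  have b: "\<bar>F x\<bar> \<le> exp ((norm w + Suc n)\<^sup>2 / e)" for x
  proof -
    have "norm (w + (\<Sum>i<Suc n. p (x i))) \<le> norm w + Suc n"
      by (rule order_trans[OF norm_triangle_ineq]) (intro add_left_mono norm_sum_p)
    then show ?thesis unfolding F_def using e by (simp add: power_mono divide_right_mono)
  qed
  note I = integral_P_Suc[OF m b]
  define K where "K = exp (((norm w)\<^sup>2 + 1 + n) / c')"
  have i: "integrable N (\<lambda>y. exp (((2 / c') *\<^sub>R w) \<bullet> p y))"
    by (rule integrable_bounded[of _ "exp (norm ((2 / c') *\<^sub>R w))"]) (use inner_p[of "(2 / c') *\<^sub>R w"] in \<open>auto simp: abs_le_iff simp del: inner_scaleR_left\<close>)
  have "(\<integral>x. F x \<partial>P (Suc n)) = (\<integral>y. (\<integral>x. F (x(n := y)) \<partial>P n) \<partial>N)" by (rule I)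
  also have "\<dots> \<le> (\<integral>y. K * exp (((2 / c') *\<^sub>R w) \<bullet> p y) \<partial>N)"
  proof (rule integral_mono)
    fix y
    have "(\<integral>x. F (x(n := y)) \<partial>P n) \<le> exp (((norm (w + p y))\<^sup>2 + n) / c')"
      using Suc.IH[OF c', of "w + p y"] by (simp add: F_def e(1) algebra_simps)
    also have "\<dots> \<le> exp (((norm w)\<^sup>2 + 2 * (w \<bullet> p y) + 1 + n) / c')"
    proof -
      have "(norm (w + p y))\<^sup>2 = (norm w)\<^sup>2 + 2 * (w \<bullet> p y) + (norm (p y))\<^sup>2"
        by (simp add: power2_norm_eq_inner inner_add inner_commute)
      moreover have "(norm (p y))\<^sup>2 \<le> 1" using p_norm[of y] by (simp add: power_le_one)
      ultimately show ?thesis using c' by (simp add: divide_right_mono)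
    qed
    also have "\<dots> = K * exp (((2 / c') *\<^sub>R w) \<bullet> p y)"
      by (simp add: K_def exp_add[symmetric] add_divide_distrib)
    finally show "(\<integral>x. F (x(n := y)) \<partial>P n) \<le> K * exp (((2 / c') *\<^sub>R w) \<bullet> p y)" .
  qed (use integrable_bounded[OF I(4,8)] i in auto)
  also have "\<dots> \<le> K * exp ((norm ((2 / c') *\<^sub>R w))\<^sup>2 / (2 * ?r))"
    using expectation_exp[of "(2 / c') *\<^sub>R w"] i by (simp add: K_def)
  also have "\<dots> \<le> exp (((norm w)\<^sup>2 + Suc n) / c)"
  proof -
    \<comment> \<open>The new coefficient of the squared norm of \<open>w\<close>:
      \<open>1 / c'\<close> comes from the induction hypothesis, the second term from the
      exponential moment of the mixed product.\<close>
    have c1: "1 / c' + 2 / (c'\<^sup>2 * ?r) \<le> 1 / c"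
    proof -
      have "1 / c - 1 / c' = (2 / ?r) / (c * c')" using Suc.prems c' by (simp add: field_simps c'_def)
      also have "\<dots> \<ge> (2 / ?r) / (c' * c')"
        using Suc.prems c' r by (intro divide_left_mono mult_right_mono) (auto simp: c'_def)
      finally show ?thesis by (simp add: power2_eq_square mult_ac)
    qed
    have n2: "(norm ((2 / c') *\<^sub>R w))\<^sup>2 = 4 / c'\<^sup>2 * (norm w)\<^sup>2" by (simp add: power_mult_distrib power_divide)
    have cc: "1 / c' \<le> 1 / c" using Suc.prems c' r by (intro divide_left_mono) (simp_all add: c'_def)
    have "((norm w)\<^sup>2 + 1 + n) / c' + (norm ((2 / c') *\<^sub>R w))\<^sup>2 / (2 * ?r) = (norm w)\<^sup>2 * (1 / c' + 2 / (c'\<^sup>2 * ?r)) + Suc n * (1 / c')"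
      unfolding n2 by (simp add: algebra_simps add_divide_distrib)
    also have "\<dots> \<le> (norm w)\<^sup>2 * (1 / c) + Suc n * (1 / c)"
      using c1 cc by (intro add_mono mult_left_mono) simp_all
    finally show ?thesis by (simp add: K_def exp_add[symmetric] add_divide_distrib)
  qed
  finally show ?case by (simp only: F_def e_def of_nat_mult of_nat_numeral)
qed

end

section \<open>Uniform deviation bounds over the sphere\<close>

lemma (in prob_space) exp_markov:
  fixes F :: "'a \<Rightarrow> real"
  assumes [measurable]: "F \<in> borel_measurable M" and B: "\<And>x. \<bar>F x\<bar> \<le> B" and l: "0 < l"
    and E: "expectation (\<lambda>x. exp (l * F x)) \<le> exp K"
  shows "prob {x \<in> space M. a \<le> F x} \<le> exp (K - l * a)"
proof -
  have "integrable M (\<lambda>x. exp (l * F x))"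
    by (rule integrable_bounded[of _ "exp (l * B)"]) (use B l in \<open>auto simp: abs_le_iff\<close>)
  then have "prob {x \<in> space M. a \<le> F x} \<le> exp (- l * a) * expectation (\<lambda>x. exp (l * F x))"
    using Chernoff_ineq_ge[OF l, of "space M" F a]
    by (simp add: set_integrable_def set_lebesgue_integral_def
        cong: Bochner_Integration.integrable_cong Bochner_Integration.integral_cong)
  also have "\<dots> \<le> exp (- l * a) * exp K" using E by (intro mult_left_mono) auto
  finally show ?thesis by (simp add: exp_add[symmetric])
qed

text \<open>Continuity from below along an enumeration of \<open>D\<close>. Finite unions are all
  bounded by the same \<delta>, so the number of directions costs nothing.\<close>

lemma (in prob_space) countable_union_bound:
  assumes D: "countable D" "D \<noteq> {}" and Bad: "\<And>u. u \<in> D \<Longrightarrow> Bad u \<in> events"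
    and le: "\<And>T. finite T \<Longrightarrow> T \<noteq> {} \<Longrightarrow> T \<subseteq> D \<Longrightarrow> prob (\<Union>u\<in>T. Bad u) \<le> \<delta>"
  shows "prob (\<Union>u\<in>D. Bad u) \<le> \<delta>"
proof -
  define A where "A n = (\<Union>u\<in>from_nat_into D ` {..n}. Bad u)" for n :: nat
  have sub: "from_nat_into D ` {..n} \<subseteq> D" for n using from_nat_into[OF D(2)] by auto
  have "(\<Union>n. A n) = (\<Union>u\<in>range (from_nat_into D). Bad u)" unfolding A_def by auto
  then have U: "(\<Union>n. A n) = (\<Union>u\<in>D. Bad u)" by (simp add: range_from_nat_into[OF D(2,1)])
  have Am: "A n \<in> events" for n unfolding A_def using sub[of n] Bad by (intro sets.finite_UN) auto
  have "(\<lambda>n. prob (A n)) \<longlonglongrightarrow> prob (\<Union>n. A n)"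
  proof (rule finite_Lim_measure_incseq)
    show "incseq A" unfolding A_def incseq_def by (intro allI impI UN_mono image_mono) auto
  qed (use Am in auto)
  then show ?thesis unfolding U
    by (rule LIMSEQ_le_const2) (use le[OF _ _ sub] in \<open>auto simp: A_def\<close>)
qed

text \<open>Only finite maxima occur, so no supremum has to be measurable; a countable dense set and
  closedness of \<open>{u. h u x \<le> c}\<close> reach all unit vectors. There are two families
  because \<open>g\<close> is centred at the true mean, as the deviation bounds require, whereas
  \<open>h\<close> has a constant in its place and is visibly continuous in
  \<open>u\<close>.\<close>

lemma (in prob_space) uniform_over_sphere:
  fixes g h :: "real^'r \<Rightarrow> 'a \<Rightarrow> real"
  assumes [measurable]: "\<And>u. g u \<in> borel_measurable M" "\<And>u. h u \<in> borel_measurable M"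
    and cont: "\<And>x. continuous_on UNIV (\<lambda>u. h u x)" and hg: "\<And>u x. norm u = 1 \<Longrightarrow> h u x \<le> g u x"
    and le: "\<And>T. finite T \<Longrightarrow> T \<noteq> {} \<Longrightarrow> T \<subseteq> sphere 0 1 \<Longrightarrow> prob {x \<in> space M. c \<le> (MAX u\<in>T. g u x)} \<le> \<delta>"
  shows "\<exists>E \<in> events. 1 - \<delta> \<le> prob E \<and> (\<forall>x\<in>E. \<forall>u. norm u = 1 \<longrightarrow> h u x \<le> c)"
proof -
  obtain D where D: "countable D" "D \<subseteq> sphere (0 :: real^'r) 1" "sphere 0 1 \<subseteq> closure D"
    using separable[of "sphere (0 :: real^'r) 1"] by blast
  have D0: "D \<noteq> {}"
  proof
    assume "D = {}"
    then have "sphere (0 :: real^'r) 1 = {}" using D(3) by simp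
    then show False using sphere_eq_empty[of "0::real^'r" 1] by simp
  qed
  define Bad where "Bad u = {x \<in> space M. c < h u x}" for u
  have Bm: "Bad u \<in> events" for u unfolding Bad_def by measurable
  have Um: "(\<Union>u\<in>D. Bad u) \<in> events" using D(1) Bm by (intro sets.countable_UN'') auto
  have "prob (\<Union>u\<in>D. Bad u) \<le> \<delta>"
  proof (rule countable_union_bound[OF D(1) D0 Bm])
    fix T assume T: "finite T" "T \<noteq> {}" "T \<subseteq> D"
    have [measurable]: "(\<lambda>x. MAX u\<in>T. g u x) \<in> borel_measurable M"
      by (intro borel_measurable_MAX T) measurable
    have "prob (\<Union>u\<in>T. Bad u) \<le> prob {x \<in> space M. c \<le> (MAX u\<in>T. g u x)}"
    proof (rule finite_measure_mono)
      show "(\<Union>u\<in>T. Bad u) \<subseteq> {x \<in> space M. c \<le> (MAX u\<in>T. g u x)}"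
      proof (clarsimp simp: Bad_def)
        fix u x assume u: "u \<in> T" and c: "c < h u x"
        have "g u x \<le> (MAX u\<in>T. g u x)" using T u by (intro Max_ge) auto
        moreover have "h u x \<le> g u x" using T(3) D(2) u by (intro hg) auto
        ultimately show "c \<le> (MAX u\<in>T. g u x)" using c by linarith
      qed
    qed measurable
    also have "\<dots> \<le> \<delta>" using T(3) D(2) by (intro le T) auto
    finally show "prob (\<Union>u\<in>T. Bad u) \<le> \<delta>" .
  qed
  then have "1 - \<delta> \<le> prob (space M - (\<Union>u\<in>D. Bad u))" using prob_compl[OF Um] by simp
  moreover have "h u x \<le> c" if x: "x \<in> space M - (\<Union>u\<in>D. Bad u)" and u: "norm u = 1" for x u
  proof -
    have "closed {u. h u x \<le> c}" using cont[of x] by (intro closed_Collect_le) auto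
    moreover have "D \<subseteq> {u. h u x \<le> c}" using x by (auto simp: Bad_def not_less)
    ultimately have "closure D \<subseteq> {u. h u x \<le> c}" by (rule closure_minimal[rotated])
    moreover have "u \<in> closure D" using u D(3) by auto
    ultimately show ?thesis by auto
  qed
  ultimately show ?thesis using Um by (intro bexI[of _ "space M - (\<Union>u\<in>D. Bad u)"]) auto
qed

section \<open>Permeance of an i.i.d. sample of directions\<close>

context iid_vectors
begin

lemma inner_sum_bounds:
  fixes n :: nat
  assumes u: "norm u \<le> 1"
  shows "\<bar>\<Sum>i<n. \<bar>u \<bullet> p (x i)\<bar> - mean_abs u\<bar> \<le> n"
proof -
  have "\<bar>\<bar>u \<bullet> p (x i)\<bar> - mean_abs u\<bar> \<le> 1" for i
    using inner_p[of u "x i"] mean_abs_bounds[of u] u by linarith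
  then show ?thesis
    using order_trans[OF sum_abs sum_bounded_above[of "{..<n}" "\<lambda>i. \<bar>\<bar>u \<bullet> p (x i)\<bar> - mean_abs u\<bar>" 1]] by simp
qed

lemma abs_MAX_inner_le:
  assumes "finite T" "T \<noteq> {}" and T: "\<And>u. u \<in> T \<Longrightarrow> norm u \<le> 1"
  shows "\<bar>MAX u\<in>T. 0 + 2 * (u \<bullet> (x :: real^'r))\<bar> \<le> 2 * norm x"
proof (rule abs_MAX_le[OF assms(1,2)])
  fix u assume "u \<in> T"
  then show "\<bar>0 + 2 * (u \<bullet> x)\<bar> \<le> 2 * norm x"
    using Cauchy_Schwarz_ineq2[of u x] mult_right_mono[OF T norm_ge_zero, of u x] by (simp add: abs_mult)
qed

lemma lower_deviation:
  assumes n: "0 < n" and d: "0 < \<delta>" "\<delta> < 1"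
    and T: "finite T" "T \<noteq> {}" "T \<subseteq> sphere 0 1"
  shows "measure (P n) {x \<in> space (P n). 2 * sqrt (real n) + sqrt (2 * real n * ln (1/\<delta>) / real CARD('r)) \<le> (MAX u\<in>T. \<Sum>i<n. mean_abs u - \<bar>u \<bullet> p (x i)\<bar>)} \<le> \<delta>"
proof -
  interpret Pn: prob_space "P n" by (rule prob_space_P)
  let ?r = "real CARD('r)"
  have r: "?r > 0" by simp
  have T1: "norm u \<le> 1" if "u \<in> T" for u using that T(3) by auto
  define F where "F x = (MAX u\<in>T. \<Sum>i<n. mean_abs u - \<bar>u \<bullet> p (x i)\<bar>)" for x
  have Fm[measurable]: "F \<in> borel_measurable (P n)" unfolding F_def
    by (intro borel_measurable_MAX T) measurable
  have FB: "\<bar>F x\<bar> \<le> n" for x unfolding F_def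
  proof (rule abs_MAX_le[OF T(1,2)])
    fix u assume "u \<in> T"
    moreover have "(\<Sum>i<n. mean_abs u - \<bar>u \<bullet> p (x i)\<bar>) = - (\<Sum>i<n. \<bar>u \<bullet> p (x i)\<bar> - mean_abs u)" by (simp add: sum_subtractf)
    ultimately show "\<bar>\<Sum>i<n. mean_abs u - \<bar>u \<bullet> p (x i)\<bar>\<bar> \<le> n" using inner_sum_bounds[where u=u and n=n and x=x, OF T1] by simp
  qed
  define S where "S x = norm (\<Sum>i<n. p (x i))" for x
  have Sm[measurable]: "S \<in> borel_measurable (P n)" unfolding S_def by measurable
  have SB: "\<bar>S x\<bar> \<le> n" for x unfolding S_def using norm_sum_p by simp
  have "(\<integral>x. F x \<partial>P n) = (\<integral>x. (MAX u\<in>T. 0 + (\<Sum>i<n. (-1) * (\<bar>u \<bullet> p (x i)\<bar> - mean_abs u))) \<partial>P n)"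
    by (simp add: F_def)
  also have "\<dots> \<le> (\<integral>x. (MAX u\<in>T. 0 + 2 * (u \<bullet> (\<Sum>i<n. p (x i)))) \<partial>P n)"
    using symmetrization[OF T(1,2) T1, where \<Phi>="\<lambda>t. t" and s="-1" and R="\<lambda>_. 0" and n=n] by (simp add: mono_def convex_on_ident)
  also have "\<dots> \<le> (\<integral>x. 2 * S x \<partial>P n)"
  proof (rule integral_mono)
    have bd: "\<bar>MAX u\<in>T. 0 + 2 * (u \<bullet> (\<Sum>i<n. p (x i)))\<bar> \<le> 2 * S x" for x
      unfolding S_def by (rule abs_MAX_inner_le[OF T(1,2) T1])
    show "integrable (P n) (\<lambda>x. MAX u\<in>T. 0 + 2 * (u \<bullet> (\<Sum>i<n. p (x i))))"
    proof (rule Pn.integrable_bounded)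
      show "\<bar>MAX u\<in>T. 0 + 2 * (u \<bullet> (\<Sum>i<n. p (x i)))\<bar> \<le> 2 * n" for x using bd[of x] SB[of x] by linarith
      show "(\<lambda>x. MAX u\<in>T. 0 + 2 * (u \<bullet> (\<Sum>i<n. p (x i)))) \<in> borel_measurable (P n)"
        by (intro borel_measurable_MAX T) measurable
    qed
    show "integrable (P n) (\<lambda>x. 2 * S x)" using Pn.integrable_bounded[OF Sm SB] by simp
    show "(MAX u\<in>T. 0 + 2 * (u \<bullet> (\<Sum>i<n. p (x i)))) \<le> 2 * S x" for x using bd[of x] by (rule order_trans[OF abs_ge_self])
  qed
  also have "\<dots> = 2 * (\<integral>x. S x \<partial>P n)" by simp
  also have "(\<integral>x. S x \<partial>P n) \<le> sqrt (real n)"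
  proof (rule real_le_rsqrt)
    have "(\<integral>x. S x \<partial>P n)\<^sup>2 \<le> (\<integral>x. (S x)\<^sup>2 \<partial>P n)" by (rule Pn.square_expectation_le[OF Sm SB])
    also have "\<dots> \<le> n" using expectation_norm_square[where w=0 and n=n] by (simp add: S_def)
    finally show "(\<integral>x. S x \<partial>P n)\<^sup>2 \<le> n" .
  qed
  finally have EF: "(\<integral>x. F x \<partial>P n) \<le> 2 * sqrt (real n)" by simp
  have ES: "(\<integral>x. exp (l * F x) \<partial>P n) \<le> exp (l * (\<integral>x. F x \<partial>P n) + real n * l\<^sup>2 * (1 / ?r) / 2)" if l: "0 \<le> l" for l
  proof (rule exp_moment_efron_stein[OF Fm FB _ l])
    fix x i assume x: "x \<in> space (P n)" and i: "i < n"
    \<comment> \<open>The maximizer \<open>u\<close> belongs to \<open>x\<close> and does not depend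
      on the replacement \<open>y\<close>. In this direction the exchange lowers the sum by at most
      the absolute value of u \<bullet> p y, whose square has mean 1 / r.\<close>
    have "F x \<in> (\<lambda>u. \<Sum>i<n. mean_abs u - \<bar>u \<bullet> p (x i)\<bar>) ` T" unfolding F_def using T by (intro Max_in) auto
    then obtain u where u: "u \<in> T" "F x = (\<Sum>i<n. mean_abs u - \<bar>u \<bullet> p (x i)\<bar>)" by auto
    have "(\<integral>y. (max 0 (F x - F (x(i := y))))\<^sup>2 \<partial>N) \<le> (\<integral>y. (u \<bullet> p y)\<^sup>2 \<partial>N)"
    proof (rule integral_mono)
      have [measurable]: "(\<lambda>y. x(i := y)) \<in> measurable N (P n)"
        by (rule measurable_fun_upd[where J="{..<n}"]) (use i x in auto)
      have "\<bar>max 0 (F x - F (x(i := y)))\<bar> \<le> 2 * real n" for y using FB[of x] FB[of "x(i := y)"] by linarith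
      then show "integrable N (\<lambda>y. (max 0 (F x - F (x(i := y))))\<^sup>2)"
        by (intro integrable_square_bounded[of _ "2 * real n"]) auto
      show "integrable N (\<lambda>y. (u \<bullet> p y)\<^sup>2)"
        by (rule integrable_square_bounded[of _ "norm u"]) (use inner_p[of u] in auto)
      fix y
      have "F (x(i := y)) \<ge> (\<Sum>k<n. mean_abs u - \<bar>u \<bullet> p ((x(i := y)) k)\<bar>)"
        unfolding F_def using T u(1) by (intro Max_ge) auto
      moreover have "(\<Sum>k<n. mean_abs u - \<bar>u \<bullet> p ((x(i := y)) k)\<bar>) = (mean_abs u - \<bar>u \<bullet> p y\<bar>) + (\<Sum>k\<in>{..<n}-{i}. mean_abs u - \<bar>u \<bullet> p (x k)\<bar>)"
        using i by (subst sum.remove[of _ i]) (auto intro!: sum.cong)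
      moreover have "(\<Sum>k<n. mean_abs u - \<bar>u \<bullet> p (x k)\<bar>) = (mean_abs u - \<bar>u \<bullet> p (x i)\<bar>) + (\<Sum>k\<in>{..<n}-{i}. mean_abs u - \<bar>u \<bullet> p (x k)\<bar>)"
        using i by (subst sum.remove[of _ i]) auto
      ultimately have "max 0 (F x - F (x(i := y))) \<le> \<bar>u \<bullet> p y\<bar>" unfolding u(2) by linarith
      then have "(max 0 (F x - F (x(i := y))))\<^sup>2 \<le> \<bar>u \<bullet> p y\<bar>\<^sup>2" by (intro power_mono) auto
      then show "(max 0 (F x - F (x(i := y))))\<^sup>2 \<le> (u \<bullet> p y)\<^sup>2" by simp
    qed
    also have "\<dots> \<le> 1 / ?r" using T(3) u(1) by (auto simp: expectation_inner_square)
    finally show "(\<integral>y. (max 0 (F x - F (x(i := y))))\<^sup>2 \<partial>N) \<le> 1 / ?r" .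
  qed
  define L where "L = ln (1 / \<delta>)"
  have L: "0 < L" "exp (- L) = \<delta>" using d by (simp_all add: L_def ln_div)
  define t where "t = sqrt (2 * real n * L / ?r)"
  have t: "0 < t" "t\<^sup>2 = 2 * real n * L / ?r" using n L(1) by (simp_all add: t_def)
  \<comment> \<open>Minimizes n l^2 / (2 r) - l t; by the choice of \<open>t\<close> the minimum is
    - L.\<close>
  define l where "l = t * ?r / n"
  have l: "0 < l" using t n by (simp add: l_def)
  have "l * (\<integral>x. F x \<partial>P n) \<le> l * (2 * sqrt (real n))" using EF l by (intro mult_left_mono) auto
  then have "exp (l * (\<integral>x. F x \<partial>P n) + real n * l\<^sup>2 * (1 / ?r) / 2) \<le> exp (l * (2 * sqrt (real n)) + real n * l\<^sup>2 / (2 * ?r))" by simp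
  note order_trans[OF ES[OF less_imp_le[OF l]] this]
  from Pn.exp_markov[OF Fm FB l this, of "2 * sqrt (real n) + t"]
  have "measure (P n) {x \<in> space (P n). 2 * sqrt (real n) + t \<le> F x} \<le> exp (real n * l\<^sup>2 / (2 * ?r) - l * t)"
    by (simp add: algebra_simps)
  also have "real n * l\<^sup>2 / (2 * ?r) - l * t = - (t\<^sup>2 * ?r / (2 * real n))"
    using n by (simp add: l_def power2_eq_square field_simps)
  also have "\<dots> = - L" unfolding t(2) using n by simp
  finally show ?thesis unfolding L(2) unfolding F_def t_def L_def .
qed

text \<open>Increments of this maximum are controlled by the old vector in the maximizing direction,
  over which there is no averaging, so the route of \<open>lower_deviation\<close> is closed.
  Symmetrization is applied under the exponential instead, and the maximum over directions becomes
  twice the norm of the sum.\<close>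

lemma upper_deviation:
  assumes n: "0 < n" and d: "0 < \<delta>" "\<delta> < 1"
    and T: "finite T" "T \<noteq> {}" "T \<subseteq> sphere 0 1"
  shows "measure (P n) {x \<in> space (P n). sqrt (8 * real n + 16 * real n * ln (1/\<delta>) / real CARD('r)) \<le> (MAX u\<in>T. \<Sum>i<n. \<bar>u \<bullet> p (x i)\<bar> - mean_abs u)} \<le> \<delta>"
proof -
  interpret Pn: prob_space "P n" by (rule prob_space_P)
  let ?r = "real CARD('r)"
  have r: "?r > 0" by simp
  have T1: "norm u \<le> 1" if "u \<in> T" for u using that T(3) by auto
  define F where "F x = (MAX u\<in>T. \<Sum>i<n. \<bar>u \<bullet> p (x i)\<bar> - mean_abs u)" for x
  have Fm[measurable]: "F \<in> borel_measurable (P n)" unfolding F_def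
    by (intro borel_measurable_MAX T) measurable
  have FB: "\<bar>F x\<bar> \<le> n" for x unfolding F_def
    by (rule abs_MAX_le[OF T(1,2)]) (rule inner_sum_bounds[OF T1])
  define S where "S x = norm (\<Sum>i<n. p (x i))" for x
  have Sm[measurable]: "S \<in> borel_measurable (P n)" unfolding S_def by measurable
  have SB: "\<bar>S x\<bar> \<le> n" for x unfolding S_def using norm_sum_p by simp
  \<comment> \<open>This is c + 2 n / r for c = 2 n / r, so that
    \<open>expectation_exp_norm_square\<close> bounds the exponential moment of S^2 / e by exp (n /
    c) = exp (r / 2).\<close>
  define e where "e = 4 * real n / ?r"
  have e: "0 < e" using n by (simp add: e_def)
  have ES: "(\<integral>x. exp (l * F x) \<partial>P n) \<le> exp (?r / 2 + l\<^sup>2 * e)" if l: "0 < l" for l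
  proof -
    have "convex_on UNIV (\<lambda>t. exp (l * t))"
    proof (rule f''_ge0_imp_convex[where f'="\<lambda>t. l * exp (l * t)" and f''="\<lambda>t. l * (l * exp (l * t))"])
      show "((\<lambda>t. exp (l * t)) has_real_derivative l * exp (l * x)) (at x)" for x
        by (auto intro!: derivative_eq_intros)
      show "((\<lambda>t. l * exp (l * t)) has_real_derivative l * (l * exp (l * x))) (at x)" for x
        by (auto intro!: derivative_eq_intros)
    qed (use l in auto)
    moreover have "mono (\<lambda>t. exp (l * t))" using l by (auto simp: mono_def)
    ultimately have "(\<integral>x. exp (l * F x) \<partial>P n) \<le> (\<integral>x. exp (l * (MAX u\<in>T. 0 + 2 * (u \<bullet> (\<Sum>i<n. p (x i))))) \<partial>P n)"
      using symmetrization[OF T(1,2) T1, where \<Phi>="\<lambda>t. exp (l * t)" and s=1 and R="\<lambda>_. 0" and n=n] by (simp add: F_def)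
    also have "\<dots> \<le> (\<integral>x. exp (l\<^sup>2 * e) * exp ((S x)\<^sup>2 / e) \<partial>P n)"
    proof (rule integral_mono)
      have bd: "\<bar>MAX u\<in>T. 0 + 2 * (u \<bullet> (\<Sum>i<n. p (x i)))\<bar> \<le> 2 * S x" for x
        unfolding S_def by (rule abs_MAX_inner_le[OF T(1,2) T1])
      have [measurable]: "(\<lambda>x. MAX u\<in>T. 0 + 2 * (u \<bullet> (\<Sum>i<n. p (x i)))) \<in> borel_measurable (P n)"
        by (intro borel_measurable_MAX T) measurable
      show "integrable (P n) (\<lambda>x. exp (l * (MAX u\<in>T. 0 + 2 * (u \<bullet> (\<Sum>i<n. p (x i))))))"
      proof (rule Pn.integrable_bounded)
        fix x
        have "(MAX u\<in>T. 0 + 2 * (u \<bullet> (\<Sum>i<n. p (x i)))) \<le> 2 * n" using bd[of x] SB[of x] by linarith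
        then show "\<bar>exp (l * (MAX u\<in>T. 0 + 2 * (u \<bullet> (\<Sum>i<n. p (x i)))))\<bar> \<le> exp (l * (2 * real n))"
          using l by (simp add: mult_left_mono)
      qed measurable
      have "\<bar>(S x)\<^sup>2\<bar> \<le> (real n)\<^sup>2" for x using power_mono[OF SB[of x] abs_ge_zero, of 2] by simp
      then have "\<bar>exp (l\<^sup>2 * e) * exp ((S x)\<^sup>2 / e)\<bar> \<le> exp (l\<^sup>2 * e) * exp ((real n)\<^sup>2 / e)" for x
        using e by (simp add: abs_mult divide_right_mono)
      then show "integrable (P n) (\<lambda>x. exp (l\<^sup>2 * e) * exp ((S x)\<^sup>2 / e))"
        by (intro Pn.integrable_bounded) measurable
      fix x
      have "l * (MAX u\<in>T. 0 + 2 * (u \<bullet> (\<Sum>i<n. p (x i)))) \<le> l * (2 * S x)"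
        using bd[of x] l by (intro mult_left_mono) auto
      also have "\<dots> \<le> l\<^sup>2 * e + (S x)\<^sup>2 / e"
      proof -
        have "0 \<le> (l * e - S x)\<^sup>2 / e" using e by simp
        also have "\<dots> = l\<^sup>2 * e + (S x)\<^sup>2 / e - l * (2 * S x)" using e by (simp add: power2_eq_square field_simps)
        finally show ?thesis by simp
      qed
      finally show "exp (l * (MAX u\<in>T. 0 + 2 * (u \<bullet> (\<Sum>i<n. p (x i))))) \<le> exp (l\<^sup>2 * e) * exp ((S x)\<^sup>2 / e)"
        by (simp add: exp_add[symmetric])
    qed
    also have "\<dots> = exp (l\<^sup>2 * e) * (\<integral>x. exp ((S x)\<^sup>2 / e) \<partial>P n)" by simp
    also have "(\<integral>x. exp ((S x)\<^sup>2 / e) \<partial>P n) \<le> exp (?r / 2)"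
    proof -
      have "2 * real n / ?r + 2 * real n / ?r = e" by (simp add: e_def)
      moreover have "real n / (2 * real n / ?r) = ?r / 2" using n by simp
      ultimately show ?thesis using expectation_exp_norm_square[where c="2 * real n / ?r" and w=0 and n=n] n by (simp add: S_def)
    qed
    finally show ?thesis by (simp add: exp_add[symmetric] add.commute)
  qed
  define L where "L = ln (1 / \<delta>)"
  have L: "0 < L" "exp (- L) = \<delta>" using d by (simp_all add: L_def ln_div)
  define a where "a = sqrt (8 * real n + 16 * real n * L / ?r)"
  have pos: "0 < 8 * real n + 16 * real n * L / ?r" using n L(1) by (intro add_pos_nonneg) auto
  have a: "0 < a" "a\<^sup>2 = 8 * real n + 16 * real n * L / ?r" using pos by (simp_all add: a_def)
  \<comment> \<open>Minimizes r / 2 + l^2 e - l a; the value of \<open>a\<close> solves a^2 = 4 e (r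
    / 2 + L).\<close>
  define l where "l = a / (2 * e)"
  have l: "0 < l" using a e by (simp add: l_def)
  from Pn.exp_markov[OF Fm FB l ES[OF l], of a]
  have "measure (P n) {x \<in> space (P n). a \<le> F x} \<le> exp (?r / 2 + l\<^sup>2 * e - l * a)" .
  also have "?r / 2 + l\<^sup>2 * e - l * a = ?r / 2 - a\<^sup>2 / (4 * e)"
    using e by (simp add: l_def power2_eq_square field_simps)
  also have "\<dots> = - L" unfolding a(2) e_def using n by (simp add: field_simps)
  finally show ?thesis unfolding L(2) unfolding F_def a_def L_def .
qed

lemma permeance_lower_bound:
  assumes n: "0 < n" and d: "0 < \<delta>" "\<delta> < 1" and m: "\<And>u. norm u = 1 \<Longrightarrow> m \<le> mean_abs u"
  shows "\<exists>E \<in> sets (P n). 1 - \<delta> \<le> measure (P n) E \<and>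
    (\<forall>x\<in>E. \<forall>u. norm u = 1 \<longrightarrow> n * m - 2 * sqrt (real n) - sqrt (2 * real n * ln (1/\<delta>) / real CARD('r)) \<le> (\<Sum>i<n. \<bar>u \<bullet> p (x i)\<bar>))"
proof -
  interpret Pn: prob_space "P n" by (rule prob_space_P)
  let ?t = "2 * sqrt (real n) + sqrt (2 * real n * ln (1/\<delta>) / real CARD('r))"
  have cont: "continuous_on UNIV (\<lambda>u. n * m - (\<Sum>i<n. \<bar>u \<bullet> p (x i)\<bar>))" for x
    by (intro continuous_intros)
  have "n * m - (\<Sum>i<n. \<bar>u \<bullet> p (x i)\<bar>) \<le> (\<Sum>i<n. mean_abs u - \<bar>u \<bullet> p (x i)\<bar>)" if "norm u = 1" for u x
    using mult_left_mono[OF m[OF that], of "real n"] by (simp add: sum_subtractf)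
  from Pn.uniform_over_sphere[OF _ _ cont this lower_deviation[OF n d]]
  obtain E where E: "E \<in> sets (P n)" "1 - \<delta> \<le> measure (P n) E"
    "\<forall>x\<in>E. \<forall>u. norm u = 1 \<longrightarrow> n * m - (\<Sum>i<n. \<bar>u \<bullet> p (x i)\<bar>) \<le> ?t"
    by auto
  show ?thesis
  proof (intro bexI[of _ E] conjI ballI allI impI)
    fix x u assume "x \<in> E" "norm (u :: real^'r) = 1"
    then have "n * m - (\<Sum>i<n. \<bar>u \<bullet> p (x i)\<bar>) \<le> ?t" using E(3) by blast
    then show "n * m - 2 * sqrt (real n) - sqrt (2 * real n * ln (1/\<delta>) / real CARD('r)) \<le> (\<Sum>i<n. \<bar>u \<bullet> p (x i)\<bar>)"
      by linarith
  qed (rule E)+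
qed

lemma permeance_upper_bound:
  assumes n: "0 < n" and d: "0 < \<delta>" "\<delta> < 1"
  shows "\<exists>E \<in> sets (P n). 1 - \<delta> \<le> measure (P n) E \<and>
    (\<forall>x\<in>E. \<forall>u. norm u = 1 \<longrightarrow> (\<Sum>i<n. \<bar>u \<bullet> p (x i)\<bar>) \<le> real n / sqrt (real CARD('r)) + sqrt (8 * real n + 16 * real n * ln (1/\<delta>) / real CARD('r)))"
proof -
  interpret Pn: prob_space "P n" by (rule prob_space_P)
  let ?t = "sqrt (8 * real n + 16 * real n * ln (1/\<delta>) / real CARD('r))"
  have cont: "continuous_on UNIV (\<lambda>u. (\<Sum>i<n. \<bar>u \<bullet> p (x i)\<bar>) - real n / sqrt (real CARD('r)))" for x
    by (intro continuous_intros)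
  have "(\<Sum>i<n. \<bar>u \<bullet> p (x i)\<bar>) - real n / sqrt (real CARD('r)) \<le> (\<Sum>i<n. \<bar>u \<bullet> p (x i)\<bar> - mean_abs u)" if "norm u = 1" for u x
    using mult_left_mono[OF mean_abs_le[of u], of "real n"] that by (simp add: sum_subtractf)
  from Pn.uniform_over_sphere[OF _ _ cont this upper_deviation[OF n d]]
  obtain E where E: "E \<in> sets (P n)" "1 - \<delta> \<le> measure (P n) E"
    "\<forall>x\<in>E. \<forall>u. norm u = 1 \<longrightarrow> (\<Sum>i<n. \<bar>u \<bullet> p (x i)\<bar>) - real n / sqrt (real CARD('r)) \<le> ?t"
    by auto
  show ?thesis
  proof (intro bexI[of _ E] conjI ballI allI impI)
    fix x u assume "x \<in> E" "norm (u :: real^'r) = 1"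
    then have "(\<Sum>i<n. \<bar>u \<bullet> p (x i)\<bar>) - real n / sqrt (real CARD('r)) \<le> ?t" using E(3) by blast
    then show "(\<Sum>i<n. \<bar>u \<bullet> p (x i)\<bar>) \<le> real n / sqrt (real CARD('r)) + ?t" by linarith
  qed (rule E)+
qed

text \<open>Writing \<open>exp \<bar>t\<bar> = 2 cosh t - exp (- \<bar>t\<bar>)\<close> reduces the absolute moment to the two available
  estimates; to first order in \<open>l\<close> the bound is \<open>1 + l\<close>, with no second order loss.\<close>

lemma expectation_exp_abs:
  assumes w: "norm w \<le> 1" and l: "0 \<le> l"
  shows "(\<integral>y. exp (l * sqrt (real CARD('r)) * \<bar>w \<bullet> p y\<bar>) \<partial>N) \<le> 2 * exp (l\<^sup>2 / 2) - exp (- l)"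
proof -
  let ?k = "l * sqrt (real CARD('r))"
  have k: "0 \<le> ?k" using l by simp
  have ip: "\<bar>w \<bullet> p y\<bar> \<le> 1" for y using inner_p[of w y] w by linarith
  have i: "integrable N (\<lambda>y. exp (a * \<bar>w \<bullet> p y\<bar>))" for a
  proof (rule integrable_bounded)
    show "\<bar>exp (a * \<bar>w \<bullet> p y\<bar>)\<bar> \<le> exp \<bar>a\<bar>" for y
      using mult_mono[OF abs_ge_self[of a] ip[of y]] by simp
  qed measurable
  have iabs: "integrable N (\<lambda>y. \<bar>w \<bullet> p y\<bar>)"
    by (rule integrable_bounded[of _ 1]) (use ip in auto)
  have eq: "exp \<bar>t\<bar> = 2 * cosh t - exp (- \<bar>t\<bar>)" for t :: real by (cases "0 \<le> t") (simp_all add: cosh_def field_simps)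
  have eq': "cosh t = (exp \<bar>t\<bar> + exp (- \<bar>t\<bar>)) / 2" for t :: real using eq[of t] by simp
  have ic: "integrable N (\<lambda>y. cosh (?k * (w \<bullet> p y)))"
    unfolding eq' using i[of ?k] i[of "- ?k"] l by (simp add: abs_mult)
  have "(\<integral>y. exp (?k * \<bar>w \<bullet> p y\<bar>) \<partial>N) = (\<integral>y. 2 * cosh (?k * (w \<bullet> p y)) - exp (- ?k * \<bar>w \<bullet> p y\<bar>) \<partial>N)"
    using eq[of "?k * (w \<bullet> p _)"] l by (intro Bochner_Integration.integral_cong) (simp_all add: abs_mult)
  also have "\<dots> = 2 * (\<integral>y. cosh (?k * (w \<bullet> p y)) \<partial>N) - (\<integral>y. exp (- ?k * \<bar>w \<bullet> p y\<bar>) \<partial>N)"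
    using ic i[of "- ?k"] by simp
  finally have "(\<integral>y. exp (?k * \<bar>w \<bullet> p y\<bar>) \<partial>N) = 2 * (\<integral>y. cosh (?k * (w \<bullet> p y)) \<partial>N) - (\<integral>y. exp (- ?k * \<bar>w \<bullet> p y\<bar>) \<partial>N)" .
  moreover have "(\<integral>y. cosh (?k * (w \<bullet> p y)) \<partial>N) \<le> exp (l\<^sup>2 / 2)"
  proof -
    have "(\<integral>y. cosh (?k * (w \<bullet> p y)) \<partial>N) \<le> exp ((norm (?k *\<^sub>R w))\<^sup>2 / (2 * real CARD('r)))"
      using expectation_cosh[of "?k *\<^sub>R w"] by simp
    also have "(norm (?k *\<^sub>R w))\<^sup>2 / (2 * real CARD('r)) = l\<^sup>2 * (norm w)\<^sup>2 / 2"
      by (simp add: power_mult_distrib)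
    also have "\<dots> \<le> l\<^sup>2 / 2" using w by (simp add: mult_left_le power_le_one)
    finally show ?thesis by simp
  qed
  \<comment> \<open>Jensen converts the upper bound on \<open>mean_abs\<close> into a lower bound
    for the subtracted term.\<close>
  moreover have "(\<integral>y. exp (- ?k * \<bar>w \<bullet> p y\<bar>) \<partial>N) \<ge> exp (- l)"
  proof -
    have "?k * mean_abs w \<le> ?k * (1 / sqrt (real CARD('r)))"
      using k w by (intro mult_left_mono order_trans[OF mean_abs_le] divide_right_mono) auto
    then have "?k * mean_abs w \<le> l" by simp
    then have "exp (- l) \<le> exp (\<integral>y. - ?k * \<bar>w \<bullet> p y\<bar> \<partial>N)"
      by (simp add: mean_abs_def)
    also have "\<dots> \<le> (\<integral>y. exp (- ?k * \<bar>w \<bullet> p y\<bar>) \<partial>N)"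
      by (rule jensens_inequality[of _ UNIV]) (use iabs i[of "- ?k"] in \<open>auto intro: exp_convex\<close>)
    finally show ?thesis .
  qed
  ultimately show ?thesis by linarith
qed

text \<open>Given coordinate \<open>j\<close>, the direction is constant and the remaining vectors
  are independent of it, so the exponential moment factors into n - 1 equal bounds. No uniformity
  over directions has to be paid for.\<close>

lemma fixed_direction_deviation:
  fixes V :: "'a \<Rightarrow> real^'r"
  assumes [measurable]: "V \<in> borel_measurable N" and V: "\<And>y. norm (V y) \<le> 1" and l: "0 < l" and j: "j < n"
  shows "measure (P n) {x \<in> space (P n). (L + (real n - 1) * ln (2 * exp (l\<^sup>2 / 2) - exp (- l))) / (l * sqrt (real CARD('r)))
      \<le> (\<Sum>i\<in>{..<n}-{j}. \<bar>V (x j) \<bullet> p (x i)\<bar>)} \<le> exp (- L)"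
proof -
  interpret Pn: prob_space "P n" by (rule prob_space_P)
  interpret product_sigma_finite "\<lambda>_::nat. N" by standard
  let ?k = "l * sqrt (real CARD('r))"
  define h where "h = 2 * exp (l\<^sup>2 / 2) - exp (- l)"
  have k: "0 < ?k" using l by simp
  have h1: "1 \<le> h" unfolding h_def
    using l exp_ge_add_one_self[of "l\<^sup>2/2"] by (smt (verit) exp_le_one_iff zero_le_power2 divide_nonneg_nonneg)
  define I where "I = {..<n} - {j}"
  have I: "insert j I = {..<n}" "finite I" "j \<notin> I" "card I = n - 1" using j by (auto simp: I_def)
  define F where "F x = (\<Sum>i\<in>I. \<bar>V (x j) \<bullet> p (x i)\<bar>)" for x
  have Vm[measurable]: "(\<lambda>x. V (x j)) \<in> borel_measurable (P n)"
    by (rule measurable_compose[OF measurable_component_singleton[of j "{..<n}" "\<lambda>_. N"]]) (use j in auto)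
  have Fm[measurable]: "F \<in> borel_measurable (P n)"
    unfolding F_def I_def by measurable (auto intro: iid_p_measurable)
  have ip: "\<bar>V y \<bullet> p z\<bar> \<le> 1" for y z using inner_p[of "V y" z] V[of y] by linarith
  have FB: "\<bar>F x\<bar> \<le> n" for x
  proof -
    have "\<bar>F x\<bar> \<le> (\<Sum>i\<in>I. 1)" unfolding F_def by (rule order_trans[OF sum_abs]) (intro sum_mono, simp add: ip)
    then show ?thesis using I(4) by simp
  qed
  have iE: "integrable (P n) (\<lambda>x. exp (?k * F x))"
  proof (rule Pn.integrable_bounded)
    show "\<bar>exp (?k * F x)\<bar> \<le> exp (?k * n)" for x
      using mult_left_mono[of "F x" n ?k] FB[of x] k by simp
  qed measurable
  have "ennreal (\<integral>x. exp (?k * F x) \<partial>P n) = (\<integral>\<^sup>+x. ennreal (exp (?k * F x)) \<partial>P n)"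
    by (rule nn_integral_eq_integral[symmetric]) (use iE in auto)
  also have "\<dots> = (\<integral>\<^sup>+y. (\<integral>\<^sup>+x. ennreal (exp (?k * F (x(j := y)))) \<partial>PiM I (\<lambda>_. N)) \<partial>N)"
    using product_nn_integral_insert_rev[OF I(2,3), of "\<lambda>x. ennreal (exp (?k * F x))"] by (simp add: I(1))
  also have "\<dots> = (\<integral>\<^sup>+y. (\<Prod>i\<in>I. \<integral>\<^sup>+z. ennreal (exp (?k * \<bar>V y \<bullet> p z\<bar>)) \<partial>N) \<partial>N)"
  proof (rule nn_integral_cong)
    fix y
    have "ennreal (exp (?k * F (x(j := y)))) = (\<Prod>i\<in>I. ennreal (exp (?k * \<bar>V y \<bullet> p (x i)\<bar>)))" for x
    proof -
      have "F (x(j := y)) = (\<Sum>i\<in>I. \<bar>V y \<bullet> p (x i)\<bar>)" unfolding F_def using I(3) by (intro sum.cong) auto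
      then show ?thesis by (simp add: sum_distrib_left exp_sum I(2) prod_ennreal)
    qed
    then show "(\<integral>\<^sup>+x. ennreal (exp (?k * F (x(j := y)))) \<partial>PiM I (\<lambda>_. N)) = (\<Prod>i\<in>I. \<integral>\<^sup>+z. ennreal (exp (?k * \<bar>V y \<bullet> p z\<bar>)) \<partial>N)"
      using product_nn_integral_prod[OF I(2), of "\<lambda>_ z. ennreal (exp (?k * \<bar>V y \<bullet> p z\<bar>))"] by simp
  qed
  also have "\<dots> \<le> (\<integral>\<^sup>+y. ennreal (h ^ (n - 1)) \<partial>N)"
  proof (rule nn_integral_mono)
    fix y
    have "(\<integral>\<^sup>+z. ennreal (exp (?k * \<bar>V y \<bullet> p z\<bar>)) \<partial>N) = ennreal (\<integral>z. exp (?k * \<bar>V y \<bullet> p z\<bar>) \<partial>N)"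
    proof (rule nn_integral_eq_integral)
      show "integrable N (\<lambda>z. exp (?k * \<bar>V y \<bullet> p z\<bar>))"
        by (rule integrable_bounded[of _ "exp ?k"]) (use ip[of y] k in \<open>auto simp: mult_left_le\<close>)
    qed auto
    also have "\<dots> \<le> ennreal h" unfolding h_def using expectation_exp_abs[OF V[of y] less_imp_le[OF l]] by (intro ennreal_leI)
    finally show "(\<Prod>i\<in>I. \<integral>\<^sup>+z. ennreal (exp (?k * \<bar>V y \<bullet> p z\<bar>)) \<partial>N) \<le> ennreal (h ^ (n - 1))"
      using h1 by (simp add: I(4) ennreal_power[symmetric] power_mono)
  qed
  also have "\<dots> = ennreal (h ^ (n - 1))" by (simp add: emeasure_space_1)
  finally have "(\<integral>x. exp (?k * F x) \<partial>P n) \<le> h ^ (n - 1)" using h1 by simp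
  also have "h ^ (n - 1) = exp ((real n - 1) * ln h)"
    using h1 j exp_of_nat_mult[of "n - 1" "ln h"] by (simp add: of_nat_diff)
  finally have "measure (P n) {x \<in> space (P n). a \<le> F x} \<le> exp ((real n - 1) * ln h - ?k * a)" for a
    by (rule Pn.exp_markov[OF Fm FB k])
  from this[of "(L + (real n - 1) * ln h) / ?k"]
  have "measure (P n) {x \<in> space (P n). (L + (real n - 1) * ln h) / ?k \<le> F x} \<le> exp ((real n - 1) * ln h - (L + (real n - 1) * ln h))"
    using k by (simp only: times_divide_eq_right nonzero_mult_div_cancel_left[OF less_imp_neq[OF k, symmetric]])
  then show ?thesis by (simp add: F_def I_def h_def)
qed

end

section \<open>Numerical estimates\<close>

lemma exp_one_bounds: "27/10 \<le> exp (1::real)" "exp (1::real) \<le> 275/100"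
proof -
  have "(27/10::real) \<le> (\<Sum>k<6. inverse (fact k) * 1 ^ k)" by (simp add: eval_nat_numeral)
  also have "\<dots> \<le> exp 1"
    using sum_le_suminf[of "\<lambda>k. inverse (fact k) * (1::real) ^ k" "{..<6}"] summable_exp[of "1::real"]
    by (simp add: exp_def field_simps)
  finally show "27/10 \<le> exp (1::real)" .
  show "exp (1::real) \<le> 275/100" using e_less_272 by simp
qed

text \<open>The tangent of ln at e, with 10/27 as an upper bound for 1/e.\<close>

lemma ln_le_linear: "0 < x \<Longrightarrow> ln x \<le> (10/27) * x" for x :: real
proof -
  assume x: "0 < x"
  have "ln (x / exp 1) \<le> x / exp 1 - 1" using x by (intro ln_le_minus_one) simp
  then have "ln x \<le> x / exp 1" using x by (simp add: ln_div)
  also have "\<dots> \<le> x / (27/10)" using x exp_one_bounds(1) by (intro divide_left_mono) auto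
  finally show ?thesis by simp
qed

lemma exp_le_quadratic_half: "exp u \<le> 1 + u + u\<^sup>2" if "0 \<le> u" "u \<le> 1/2" for u :: real
  using exp_bound[of u] that by simp

lemma cosh_ge_partial_sum: "(\<Sum>n<k. x ^ (2*n) / fact (2*n)) \<le> cosh x" for x :: real
proof -
  have "(\<Sum>n<k. x ^ (2*n) /\<^sub>R fact (2*n)) \<le> (\<Sum>n. x ^ (2*n) /\<^sub>R fact (2*n))"
    by (rule sum_le_suminf[OF sums_summable[OF cosh_even_series]]) (auto intro!: mult_nonneg_nonneg zero_le_even_power)
  also have "\<dots> = cosh x" by (rule sums_unique[OF cosh_even_series, symmetric])
  finally show ?thesis by (simp add: divide_inverse mult.commute)
qed

section \<open>Bounds for the exponential moment of the absolute value\<close>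

text \<open>On [1, 3] the factor 2 is paid by exp (3/4), and 3/4 + l^2/2 \<le> l + l^2/4 amounts to
  (l - 1)(l - 3) \<le> 0; hence the limit 3. Below 1 the comparison goes through the series of
  cosh.\<close>

lemma abs_moment_bound_medium:
  fixes l :: real
  assumes l: "0 < l" "l \<le> 3"
  shows "2 * exp (l\<^sup>2 / 2) - exp (- l) \<le> exp (l + l\<^sup>2 / 4)"
proof (cases "1 \<le> l")
  case True
  have "(l - 1) * (l - 3) \<le> 0" using l True by (intro mult_nonneg_nonpos) auto
  then have a: "3/4 + l\<^sup>2 / 2 \<le> l + l\<^sup>2 / 4" by (simp add: power2_eq_square algebra_simps)
  have "(2::real) \<le> 1 + 3/4 + (3/4)\<^sup>2/2" by (simp add: power2_eq_square)
  also have "\<dots> \<le> exp (3/4)" by (rule exp_lower_Taylor_quadratic) simp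
  finally have "2 * exp (l\<^sup>2 / 2) \<le> exp (3/4) * exp (l\<^sup>2 / 2)" by simp
  also have "\<dots> = exp (3/4 + l\<^sup>2 / 2)" by (simp add: exp_add)
  also have "\<dots> \<le> exp (l + l\<^sup>2 / 4)" using a by simp
  finally show ?thesis using exp_ge_zero[of "-l"] by linarith
next
  case False
  then have l1: "l \<le> 1" "0 \<le> l" using l by auto
  have l2: "l\<^sup>2 \<le> 1" using l1 by (simp add: power_le_one)
  have "exp (l\<^sup>2/2) \<le> 1 + l\<^sup>2/2 + (l\<^sup>2/2)\<^sup>2" using l2 by (intro exp_le_quadratic_half) auto
  moreover have "1 + l\<^sup>2/2 + l ^ 4 / 24 \<le> cosh l"
    using cosh_ge_partial_sum[of l 3] by (simp add: eval_nat_numeral)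
  moreover have "exp l * (1 + l\<^sup>2/4) \<le> exp l * exp (l\<^sup>2/4)" using exp_ge_add_one_self[of "l\<^sup>2/4"] by (intro mult_left_mono) auto
  moreover have "(1 + l) * (l\<^sup>2/4) \<le> exp l * (l\<^sup>2/4)" using exp_ge_add_one_self[of l] by (intro mult_right_mono) auto
  moreover have "(l\<^sup>2/2)\<^sup>2 * 2 \<le> l ^ 4 / 12 + (1 + l) * (l\<^sup>2/4)"
  proof -
    have "l ^ 4 \<le> l ^ 3" "l ^ 4 \<le> l ^ 2" using l1 by (intro power_decreasing; simp)+
    moreover have "(l\<^sup>2/2)\<^sup>2 * 2 = l ^ 4 / 2" by (simp add: power_divide power2_eq_square power4_eq_xxxx)
    moreover have "(1 + l) * (l\<^sup>2/4) = l ^ 2 / 4 + l ^ 3 / 4" by (simp add: power2_eq_square power3_eq_cube algebra_simps)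
    moreover have "0 \<le> l ^ 4" by simp
    ultimately show ?thesis by linarith
  qed
  moreover have "2 * cosh l = exp l + exp (- l)" by (simp add: cosh_def)
  moreover have "exp l * (1 + l\<^sup>2/4) = exp l + exp l * (l\<^sup>2/4)" by (simp add: distrib_left)
  ultimately show ?thesis unfolding exp_add by linarith
qed

text \<open>Both 2 exp (l^2/2) and 2 cosh l begin with 2 + l^2, so the excess over exp l is of
  fourth order. With l = N^(-1/4) the accumulated excess N l^3 is only of order N^(1/4).\<close>

lemma abs_moment_bound_small:
  fixes l :: real
  assumes l: "0 < l" "l \<le> 1"
  shows "2 * exp (l\<^sup>2 / 2) - exp (- l) \<le> exp (l + l ^ 4 / 2)"
proof -
  have l2: "l\<^sup>2 \<le> 1" using l by (simp add: power_le_one)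
  have "exp (l\<^sup>2/2) \<le> 1 + l\<^sup>2/2 + (l\<^sup>2/2)\<^sup>2" using l2 by (intro exp_le_quadratic_half) auto
  moreover have "1 + l\<^sup>2/2 \<le> cosh l"
    using cosh_ge_partial_sum[of l 2] by (simp add: eval_nat_numeral)
  moreover have "(1 + l ^ 4/2) \<le> exp (l ^ 4/2)" by (rule exp_ge_add_one_self)
  then have "exp l * (1 + l ^ 4/2) \<le> exp l * exp (l ^ 4/2)" by (intro mult_left_mono) auto
  moreover have "1 * (l ^ 4/2) \<le> exp l * (l ^ 4/2)" using l by (intro mult_right_mono) auto
  moreover have "2 * (l\<^sup>2/2)\<^sup>2 = l ^ 4 / 2" by (simp add: power_divide power2_eq_square power4_eq_xxxx)
  moreover have "2 * cosh l = exp l + exp (- l)" by (simp add: cosh_def)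
  moreover have "exp l * (1 + l ^ 4/2) = exp l + exp l * (l ^ 4/2)" by (simp add: distrib_left)
  ultimately show ?thesis unfolding exp_add by linarith
qed

lemma sqrt_le_of_square: "0 \<le> y \<Longrightarrow> x \<le> y\<^sup>2 \<Longrightarrow> sqrt x \<le> y"
  by (simp add: real_le_lsqrt)

text \<open>Here \<open>T\<close> is bounded by the fixed direction deviation at exponent \<open>l\<close> after a union over \<open>n\<close>
  outliers. With \<open>L' = L + ln n\<close> the exponent is \<open>2 * sqrt (L' / n)\<close> for moderate \<open>L'\<close>, \<open>1 / root 4 n\<close> when
  \<open>ln n\<close> dominates \<open>L\<close>, and \<open>sqrt (2 * L' / n)\<close> when \<open>L'\<close> exceeds \<open>9/4 * n\<close>. In the final alternative the
  first disjunct is used unless \<open>\<kappa>\<close> is small, and then \<open>m\<close> is so close to \<open>1\<close> that \<open>sqrt m\<close> costs little.\<close>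

lemma numeric_bounds:
  fixes n :: nat and r L X :: real
  defines "z \<equiv> 2 * sqrt (real n) + sqrt (2 * real n * L / (r - 1))"
  assumes n: "1 \<le> n" and r: "2 \<le> r" and L: "3/2 \<le> L" and X: "0 \<le> X"
    and X1: "4 * (real n / r) * (L + ln (real n)) \<le> X\<^sup>2" and X2: "16/3 * L * (L + ln (real n)) \<le> X\<^sup>2"
  obtains l where "0 < l"
    "\<And>T. T \<le> (L + ln (real n) + (real n - 1) * ln (2 * exp (l\<^sup>2/2) - exp (- l))) / (l * sqrt r) \<Longrightarrow> T \<le> real n - 1 \<Longrightarrow>
      sqrt (8 * real n + 16 * real n * L / r) + 1 + T \<le> real n / sqrt r + 2 * z + 2 * X"
    "\<And>T \<kappa> m. T \<le> (L + ln (real n) + (real n - 1) * ln (2 * exp (l\<^sup>2/2) - exp (- l))) / (l * sqrt r) \<Longrightarrow> T \<le> real n - 1 \<Longrightarrow>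
      0 \<le> \<kappa> \<Longrightarrow> 0 \<le> m \<Longrightarrow> m \<le> 1 \<Longrightarrow> 1 - \<kappa>\<^sup>2 \<le> m\<^sup>2 \<Longrightarrow>
      1 + T \<le> 2 * \<kappa> * (real n / sqrt r + z + X) \<or> 1 + T \<le> real n / sqrt r + sqrt m * z"
proof -
  define N where "N = real n"
  define a where "a = sqrt N"
  define s where "s = sqrt r"
  define w where "w = sqrt (N * L / r)"
  define q where "q = sqrt (2 * N * L / (r - 1))"
  define y where "y = sqrt (2 * N * L)"
  define L' where "L' = L + ln N"
  define t where "t l = L' + (N - 1) * ln (2 * exp (l\<^sup>2/2) - exp (- l))" for l
  have N: "1 \<le> N" using n by (simp add: N_def)
  have a: "1 \<le> a" "a\<^sup>2 = N" using N by (simp_all add: a_def)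
  have s: "141/100 \<le> s" "s\<^sup>2 = r" "0 < s"
    unfolding s_def by (rule real_le_rsqrt) (use r in \<open>simp_all add: power2_eq_square\<close>)
  have lnN: "0 \<le> ln N" "ln N \<le> 10/27 * N" using N ln_le_linear[of N] by auto
  have L': "3/2 \<le> L'" "L \<le> L'" using L lnN by (simp_all add: L'_def)
  have w: "0 \<le> w" "w\<^sup>2 = N * L / r" using N L r by (simp_all add: w_def)
  have y: "0 \<le> y" "y\<^sup>2 = 2 * N * L" using N L by (simp_all add: y_def)
  have q0: "0 \<le> q" using N L r by (simp add: q_def)
  \<comment> \<open>Inequalities are multiplied by \<open>s\<close> to clear the root of
    \<open>r\<close>; the denominator r - 1 in \<open>q\<close> only helps.\<close>
  have sq: "y \<le> s * q"
  proof -
    have "2 * N * L * (r - 1) \<le> r * (2 * N * L)" using N L r by (simp add: mult.commute mult_left_mono)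
    then have "2 * N * L \<le> r * (2 * N * L / (r - 1))" using r by (simp add: field_simps)
    then have "y \<le> sqrt (r * (2 * N * L / (r - 1)))" unfolding y_def by (rule real_sqrt_le_mono)
    then show ?thesis by (simp only: s_def q_def real_sqrt_mult)
  qed
  have sw: "y = sqrt 2 * (s * w)"
  proof -
    have "2 * N * L = 2 * (r * (N * L / r))" using r by simp
    then show ?thesis by (simp only: y_def s_def w_def real_sqrt_mult)
  qed
  have sqrt2: "141/100 \<le> sqrt 2" "sqrt 2 \<le> 1415/1000"
    by (rule real_le_rsqrt, simp add: power2_eq_square) (rule sqrt_le_of_square, simp_all add: power2_eq_square)
  have qw: "141/100 * w \<le> q"
  proof -
    have "s * (141/100 * w) \<le> y" using mult_right_mono[OF sqrt2(1), of "s * w"] s w sw by simp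
    then have "s * (141/100 * w) \<le> s * q" using sq by linarith
    then show ?thesis using s by simp
  qed
  have Xw: "2 * w \<le> X"
  proof (rule power2_le_imp_le[OF _ X])
    have "(2 * w)\<^sup>2 = 4 * (N / r) * L" by (simp add: power_mult_distrib w(2))
    also have "\<dots> \<le> 4 * (N / r) * L'" using L' N r by (intro mult_left_mono) auto
    finally show "(2 * w)\<^sup>2 \<le> X\<^sup>2" using X1 by (simp add: N_def L'_def)
  qed
  \<comment> \<open>283/100 exceeds sqrt 8.\<close>
  have S: "sqrt (8 * real n + 16 * real n * L / r) \<le> 283/100 * a + 4 * w"
  proof (rule sqrt_le_of_square)
    have "8 * real n + 16 * real n * L / r = 8 * a\<^sup>2 + 16 * w\<^sup>2" by (simp add: a(2) w(2) N_def)
    also have "\<dots> \<le> 80089/10000 * a\<^sup>2 + 16 * w\<^sup>2 + 2264/100 * (a * w)"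
    proof -
      have "0 \<le> a * w" "0 \<le> a\<^sup>2" using a(1) w(1) by simp_all
      then show ?thesis by linarith
    qed
    also have "\<dots> = (283/100 * a + 4 * w)\<^sup>2" by (simp add: power2_eq_square algebra_simps)
    finally show "8 * real n + 16 * real n * L / r \<le> (283/100 * a + 4 * w)\<^sup>2" .
  qed (use a w in auto)
  have zq: "z = 2 * a + q" by (simp add: z_def a_def q_def N_def)
  have sz: "s * (93/100 * z) = 186/100 * (s * a) + 93/100 * (s * q)" unfolding zq by (simp add: algebra_simps)
  have z0: "0 \<le> z" unfolding zq using a q0 by simp
  have g: "sqrt (N * L') \<le> s * X / 2"
  proof (rule sqrt_le_of_square)
    have "4 * (N / r) * L' * r \<le> X\<^sup>2 * r" using X1 r by (intro mult_right_mono) (auto simp: N_def L'_def)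
    then show "N * L' \<le> (s * X / 2)\<^sup>2" using r by (simp add: power_divide power_mult_distrib s(2) mult_ac)
  qed (use s X in simp)
  \<comment> \<open>Twice \<open>z\<close> contributes 4 a + 2 q. The second premise balances the
    terms in \<open>a\<close>, and 4 w is covered by 2 q and the share of 2 X beyond 71/100
    X.\<close>
  have main2: "sqrt (8 * real n + 16 * real n * L / r) + 1 + T \<le> real n / sqrt r + 2 * z + 2 * X"
    if "1 + T \<le> N / s + 1 + 71/100 * X + c * a" "283/100 * a + 1 + c * a \<le> 4 * a" for T c
  proof -
    have lin: "Q + 1 + T \<le> D + 2 * (2 * a + q) + 2 * X"
      if "1 + T \<le> D + 1 + 71/100 * X + b" "283/100 * a + 1 + b \<le> 4 * a" "Q \<le> 283/100 * a + 4 * w" for Q D b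
      using that qw Xw w(1) by simp
    show ?thesis using lin[OF that S] by (simp only: zq N_def s_def)
  qed
  \<comment> \<open>The constant satisfies (93/100)^4 \<le> 3/4: for \<kappa> below 1/2 one has m^2
    \<ge> 3/4, hence sqrt m \<ge> 93/100, and otherwise 2 \<kappa> \<ge> 1 makes the first
    alternative true.\<close>
  have main1: "1 + T \<le> 2 * \<kappa> * (real n / sqrt r + z + X) \<or> 1 + T \<le> real n / sqrt r + sqrt m * z"
    if T: "1 + T \<le> N / s + 93/100 * z" and \<kappa>: "0 \<le> \<kappa>" and m: "0 \<le> m" "1 - \<kappa>\<^sup>2 \<le> m\<^sup>2" for T \<kappa> m
  proof (cases "1/2 \<le> \<kappa>")
    case True
    have "0 \<le> N / s + z + X" using N s z0 X by simp
    then have "1 * (N / s + z + X) \<le> 2 * \<kappa> * (N / s + z + X)" using True by (intro mult_right_mono) auto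
    then show ?thesis using T z0 X by (simp add: N_def s_def)
  next
    case False
    then have "\<kappa>\<^sup>2 \<le> (1/2)\<^sup>2" using \<kappa> by (intro power_mono) auto
    then have "3/4 \<le> m\<^sup>2" using m(2) by (simp add: power2_eq_square)
    moreover have "((93/100)\<^sup>2)\<^sup>2 \<le> (3/4 :: real)" by (simp add: power2_eq_square)
    ultimately have "(93/100)\<^sup>2 \<le> m" by (intro power2_le_imp_le[OF _ m(1)]) linarith
    then have "93/100 \<le> sqrt m" by (rule real_le_rsqrt)
    then have "93/100 * z \<le> sqrt m * z" using z0 by (rule mult_right_mono)
    then show ?thesis using T by (simp add: N_def s_def)
  qed
  have Ts: "T \<le> t l / (l * sqrt r) \<longleftrightarrow> s * T \<le> t l / l" if "0 < l" for T l
    using that s(3) by (simp add: s_def field_simps)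
  have from_s: "x \<le> N / s + b" if "s * x \<le> N + s * b" for x b
  proof -
    have "s * x \<le> s * (N / s + b)" using that s(3) by (simp add: algebra_simps)
    then show ?thesis using s(3) by simp
  qed
  have tl: "t l / l \<le> L' / l + (N - 1) * (c / l)" if "0 < l" "2 * exp (l\<^sup>2/2) - exp (- l) \<le> exp c" for l c
  proof -
    have pos: "0 < 2 * exp (l\<^sup>2/2) - exp (- l)"
    proof -
      have "exp (- l) \<le> 1" "1 \<le> exp (l\<^sup>2/2)" using that(1) by auto
      then show ?thesis by linarith
    qed
    have "ln (2 * exp (l\<^sup>2/2) - exp (- l)) \<le> ln (exp c)"
      using pos that(2) by (subst ln_le_cancel_iff) auto
    then have "ln (2 * exp (l\<^sup>2/2) - exp (- l)) \<le> c" by simp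
    then have "t l \<le> L' + (N - 1) * c" unfolding t_def using N by (intro add_left_mono mult_left_mono) auto
    then have "t l / l \<le> (L' + (N - 1) * c) / l" using that(1) by (intro divide_right_mono) auto
    then show ?thesis by (simp add: add_divide_distrib)
  qed
  have t_eq: "L + ln (real n) + (real n - 1) * ln (2 * exp (l\<^sup>2/2) - exp (- l)) = t l" for l
    by (simp add: t_def L'_def N_def)
  \<comment> \<open>At L' = 9/4 N the exponent 2 sqrt (L' / N) reaches the limit 3 of
    \<open>abs_moment_bound_medium\<close>. From 7/5 ln N \<le> L follows L' \<le> 12/7 L, just
    enough for sqrt (N L') \<le> 93/100 sqrt (2 N L).\<close>
  consider (large) "9/4 * N < L'" | (small) "L' \<le> 9/4 * N" "L < 7/5 * ln N" | (medium) "L' \<le> 9/4 * N" "7/5 * ln N \<le> L"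
    by linarith
  then show ?thesis
  proof cases
    case medium
    \<comment> \<open>Minimizes L' / l + N l / 4, with minimum \<open>v\<close>.\<close>
    define l where "l = 2 * sqrt (L' / N)"
    define v where "v = sqrt (N * L')"
    have l: "0 < l" using L' N by (simp add: l_def)
    have "sqrt (L' / N) \<le> sqrt (9/4)" using medium(1) N by (intro real_sqrt_le_mono) (simp add: field_simps)
    also have "sqrt (9/4) = (3/2 :: real)" by (rule real_sqrt_unique) (simp_all add: power2_eq_square)
    finally have l3: "l \<le> 3" by (simp add: l_def)
    have v: "N * l = 2 * v" "L' / l = v / 2"
    proof -
      have "N * sqrt (L' / N) = v" using N L' by (simp add: v_def real_sqrt_divide real_sqrt_mult field_simps)
      then show "N * l = 2 * v" by (simp add: l_def)
      then have "v * l / 2 = N * l\<^sup>2 / 4" by (simp add: power2_eq_square)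
      also have "\<dots> = L'" using N L' by (simp add: l_def power_mult_distrib)
      finally show "L' / l = v / 2" using l by (simp add: field_simps)
    qed
    have "t l / l \<le> L' / l + (N - 1) * ((l + l\<^sup>2/4) / l)" by (rule tl[OF l abs_moment_bound_medium[OF l l3]])
    also have "(l + l\<^sup>2/4) / l = 1 + l / 4" using l by (simp add: power2_eq_square field_simps)
    also have "L' / l + (N - 1) * (1 + l / 4) = v / 2 + N - 1 + N * l / 4 - l / 4" unfolding v(2) by (simp add: field_simps)
    also have "\<dots> \<le> N - 1 + v" using v(1) l by linarith
    finally have T: "s * T \<le> N - 1 + v" if "T \<le> t l / (l * sqrt r)" for T
      using that Ts[OF l, of T] by linarith
    have vy: "v \<le> 93/100 * y"
    proof (unfold v_def, rule sqrt_le_of_square)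
      have "L' \<le> 12/7 * L" using medium(2) by (simp add: L'_def)
      then have "N * L' \<le> N * (12/7 * L)" using N by (intro mult_left_mono) auto
      also have "\<dots> \<le> (93/100 * y)\<^sup>2" unfolding power_mult_distrib y(2) using N L by (simp add: power2_eq_square)
      finally show "N * L' \<le> (93/100 * y)\<^sup>2" .
    qed (use y in simp)
    show ?thesis
    proof (rule that[OF l]; unfold t_eq)
      fix T assume T1: "T \<le> t l / (l * sqrt r)"
      have "s * (1 + T) \<le> N + s * (1 + X / 2)" using T[OF T1] g by (simp add: v_def algebra_simps)
      then have "1 + T \<le> N / s + (1 + X / 2)" by (rule from_s)
      then show "sqrt (8 * real n + 16 * real n * L / r) + 1 + T \<le> real n / sqrt r + 2 * z + 2 * X"
        using X a by (intro main2[where c=0]) auto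
      fix \<kappa> m :: real assume \<kappa>: "0 \<le> \<kappa>" and m: "0 \<le> m" "1 - \<kappa>\<^sup>2 \<le> m\<^sup>2"
      have "s * 1 \<le> s * a" using a s by (intro mult_left_mono) auto
      moreover have "s * (1 + T) = s + s * T" by (simp add: distrib_left)
      ultimately have "s * (1 + T) \<le> N + s * (93/100 * z)" using T[OF T1] vy sq s(1) sz by linarith
      then show "1 + T \<le> 2 * \<kappa> * (real n / sqrt r + z + X) \<or> 1 + T \<le> real n / sqrt r + sqrt m * z"
        by (intro main1 \<kappa> m from_s)
    qed
  next
    case small
    \<comment> \<open>The fourth root of N. With l = 1 / \<rho> the fourth order excess sums to
      \<rho> / 2 and the remaining cost is L' \<rho>, where L' is at most logarithmic in N.\<close>
    define \<rho> where "\<rho> = sqrt a"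
    have \<rho>2: "\<rho>\<^sup>2 = a" using a by (simp add: \<rho>_def)
    have \<rho>4: "\<rho> ^ 4 = N" using \<rho>2 a(2) by (metis power_mult numeral_Bit0 mult_2 power_add power2_eq_square)
    have \<rho>0: "0 < \<rho>" using a by (simp add: \<rho>_def)
    \<comment> \<open>For N \<le> 2 the case assumption would force L below 1.\<close>
    have N3: "3 \<le> N"
    proof (rule ccontr)
      assume "\<not> 3 \<le> N"
      then have "N = 1 \<or> N = 2" using n unfolding N_def by (cases n) (auto simp: not_le)
      moreover have "ln 2 \<le> (7/10 :: real)" using ln2_le_25_over_36 by simp
      ultimately show False using small(2) L by auto
    qed
    have "(13/10)\<^sup>2 * (13/10)\<^sup>2 \<le> (3 :: real)" by (simp add: power2_eq_square)
    then have "((13/10)\<^sup>2)\<^sup>2 \<le> (\<rho>\<^sup>2)\<^sup>2" using N3 \<rho>4 by (simp add: power2_eq_square power4_eq_xxxx)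
    then have "(13/10)\<^sup>2 \<le> \<rho>\<^sup>2" by (rule power2_le_imp_le) simp
    then have \<rho>: "13/10 \<le> \<rho>" by (rule power2_le_imp_le) (use \<rho>0 in simp)
    have lnN\<rho>: "ln N = 4 * ln \<rho>" using \<rho>0 by (simp add: \<rho>4[symmetric] ln_realpow)
    have lnNa: "ln N = 2 * ln a" using a by (simp add: a(2)[symmetric] ln_realpow)
    have L'1: "L' \<le> 12/5 * ln N" using small(2) by (simp add: L'_def)
    have "L' \<le> 48/5 * ln \<rho>" using L'1 lnN\<rho> by linarith
    then have L'\<rho>: "L' \<le> 356/100 * \<rho>" using ln_le_linear[OF \<rho>0] \<rho>0 by linarith
    have L'a: "L' \<le> 178/100 * a" using L'1 lnNa ln_le_linear[of a] a by linarith
    define l where "l = 1 / \<rho>"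
    have l: "0 < l" "l \<le> 1" using \<rho> by (simp_all add: l_def)
    have "t l / l \<le> L' / l + (N - 1) * ((l + l ^ 4/2) / l)" by (rule tl[OF l(1) abs_moment_bound_small[OF l]])
    also have "(l + l ^ 4/2) / l = 1 + l ^ 3/2" using l by (simp add: field_simps power3_eq_cube power4_eq_xxxx)
    also have "(N - 1) * (1 + l ^ 3/2) \<le> N - 1 + N * l ^ 3 / 2" using N l by (simp add: algebra_simps)
    also have "N * l ^ 3 = \<rho>" using \<rho>0 by (simp add: \<rho>4[symmetric] l_def field_simps power3_eq_cube power4_eq_xxxx)
    finally have T: "s * T \<le> L' * \<rho> + (N - 1 + \<rho> / 2)" if "T \<le> t l / (l * sqrt r)" for T
      using that Ts[OF l(1), of T] by (simp add: l_def)
    have LX: "L' * \<rho> \<le> s * (67/100 * X)"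
    proof -
      have v2: "(sqrt (N * L'))\<^sup>2 = N * L'" using N L' by simp
      have "L' * \<rho> \<le> 134/100 * sqrt (N * L')"
      proof (rule power2_le_imp_le)
        have "(L' * \<rho>)\<^sup>2 = L' * (L' * a)" by (simp add: power_mult_distrib \<rho>2) (simp add: power2_eq_square)
        also have "\<dots> \<le> L' * (178/100 * a * a)" using L'a L' a by (intro mult_left_mono mult_right_mono) auto
        also have "\<dots> = 178/100 * (N * L')" by (simp add: a(2)[symmetric] power2_eq_square)
        also have "\<dots> \<le> (134/100)\<^sup>2 * (N * L')" using N L' by (intro mult_right_mono) (auto simp: power2_eq_square)
        finally show "(L' * \<rho>)\<^sup>2 \<le> (134/100 * sqrt (N * L'))\<^sup>2" unfolding power_mult_distrib v2 .
      qed (use N L' in simp)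
      then show ?thesis using g by linarith
    qed
    have \<rho>a: "13/10 * \<rho> \<le> a" using mult_right_mono[OF \<rho> less_imp_le[OF \<rho>0]] unfolding \<rho>2[symmetric] power2_eq_square .
    have a16: "169/100 \<le> a" using \<rho>a \<rho> by linarith
    show ?thesis
    proof (rule that[OF l(1)]; unfold t_eq)
      fix T assume T1: "T \<le> t l / (l * sqrt r)"
      have "141/100 * \<rho> \<le> s * \<rho>" using s \<rho>0 by (intro mult_right_mono) auto
      moreover have "s * (1 + T) = s + s * T" by (simp add: distrib_left)
      moreover have "s * (1 + 67/100 * X + 36/100 * \<rho>) = s + s * (67/100 * X) + 36/100 * (s * \<rho>)" by (simp add: algebra_simps)
      ultimately have "s * (1 + T) \<le> N + s * (1 + 67/100 * X + 36/100 * \<rho>)" using T[OF T1] LX \<rho>0 by linarith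
      then have "1 + T \<le> N / s + (1 + 67/100 * X + 36/100 * \<rho>)" by (rule from_s)
      then have "1 + T \<le> N / s + 1 + 71/100 * X + 36/100 * a" using X \<rho>a \<rho>0 by linarith
      then show "sqrt (8 * real n + 16 * real n * L / r) + 1 + T \<le> real n / sqrt r + 2 * z + 2 * X"
        using a16 by (intro main2[where c="36/100"]) auto
      fix \<kappa> m :: real assume \<kappa>: "0 \<le> \<kappa>" and m: "0 \<le> m" "1 - \<kappa>\<^sup>2 \<le> m\<^sup>2"
      have "L' * \<rho> \<le> 356/100 * a" using mult_right_mono[OF L'\<rho> less_imp_le[OF \<rho>0]] unfolding \<rho>2[symmetric] power2_eq_square mult.assoc .
      then have st1: "s * T \<le> N - 1 + 395/100 * a" using T[OF T1] \<rho>a a(1) by linarith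
      have "173/100 * a \<le> y"
      proof (rule power2_le_imp_le[OF _ y(1)])
        have "(173/100 * a)\<^sup>2 \<le> 3 * N" unfolding power_mult_distrib a(2) using N by (simp add: power2_eq_square)
        also have "\<dots> \<le> y\<^sup>2" unfolding y(2) using mult_left_mono[OF L, of "2 * N"] N by simp
        finally show "(173/100 * a)\<^sup>2 \<le> y\<^sup>2" .
      qed
      then have st3: "160/100 * a \<le> 93/100 * (s * q)" using sq a(1) by linarith
      have "141/100 * (186/100 * a - 1) \<le> s * (186/100 * a - 1)" using s a by (intro mult_right_mono) auto
      also have "s * (186/100 * a - 1) = 186/100 * (s * a) - s" by (simp add: algebra_simps)
      finally have "s + (26226/10000 * a - 141/100) \<le> 186/100 * (s * a)" by (simp add: algebra_simps)
      then have st2: "s + 262/100 * a - 141/100 \<le> 186/100 * (s * a)" using a(1) by linarith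
      have "s * (1 + T) = s + s * T" by (simp add: distrib_left)
      then have "s * (1 + T) \<le> N + s * (93/100 * z)"
        unfolding sz using st1 st2 st3 a16 by linarith
      then show "1 + T \<le> 2 * \<kappa> * (real n / sqrt r + z + X) \<or> 1 + T \<le> real n / sqrt r + sqrt m * z"
        by (intro main1 \<kappa> m from_s)
    qed
  next
    case large
    \<comment> \<open>In this range 2 exp (l^2/2) alone is kept; this \<open>l\<close> minimizes L'
      / l + N l / 2, with minimum sqrt (2 N L').\<close>
    define l where "l = sqrt (2 * L' / N)"
    have l0: "0 < l" using L' N by (simp add: l_def)
    have l2: "l\<^sup>2 = 2 * L' / N" using L' N by (simp add: l_def)
    have "(212/100)\<^sup>2 \<le> 2 * L' / N" using large N by (simp add: power2_eq_square field_simps)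
    then have l: "212/100 \<le> l" unfolding l_def by (rule real_le_rsqrt)
    define x where "x = sqrt (2 * N * L')"
    have x: "0 \<le> x" "x\<^sup>2 = 2 * N * L'" using N L' by (simp_all add: x_def)
    have Nl: "N * l = x"
    proof -
      have "N * l = sqrt (N\<^sup>2) * sqrt (2 * L' / N)" using N by (simp add: l_def)
      also have "\<dots> = x" unfolding real_sqrt_mult[symmetric] x_def using N by (simp add: power2_eq_square)
      finally show ?thesis .
    qed
    have ln2: "ln 2 \<le> (69445/100000 :: real)" using ln2_le_25_over_36 by simp
    have "2 * exp (l\<^sup>2/2) - exp (- l) \<le> exp (ln 2 + l\<^sup>2/2)" by (simp add: exp_add)
    then have "t l / l \<le> L' / l + (N - 1) * ((ln 2 + l\<^sup>2/2) / l)" by (rule tl[OF l0])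
    also have "(ln 2 + l\<^sup>2/2) / l = ln 2 / l + l / 2" using l0 by (simp add: power2_eq_square field_simps)
    also have "(N - 1) * (ln 2 / l + l / 2) \<le> N * (ln 2 / l + l / 2)" using l0 by (intro mult_right_mono) auto
    also have "L' / l = x / 2"
    proof -
      have "L' = N * l\<^sup>2 / 2" using l2 N by simp
      then show ?thesis using l0 Nl by (simp add: power2_eq_square)
    qed
    also have "N * (ln 2 / l + l / 2) = N * (ln 2 / l) + x / 2" using Nl by (simp add: algebra_simps)
    also have "N * (ln 2 / l) \<le> N * (33/100)"
    proof -
      have "ln 2 \<le> 33/100 * l" using ln2 l by linarith
      then have "ln 2 / l \<le> 33/100" using l0 by (simp add: field_simps)
      then show ?thesis using N by (intro mult_left_mono) auto
    qed
    finally have T: "s * T \<le> x + 33/100 * N" if "T \<le> t l / (l * sqrt r)" for T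
      using that Ts[OF l0, of T] by linarith
    have xX: "x \<le> s * (71/100 * X)"
    proof -
      have "x = sqrt 2 * sqrt (N * L')" by (simp add: x_def real_sqrt_mult)
      also have "\<dots> \<le> 1415/1000 * (s * X / 2)" using sqrt2 g s X N L' by (intro mult_mono) auto
      also have "\<dots> \<le> s * (71/100 * X)" using s X by simp
      finally show ?thesis .
    qed
    show ?thesis
    proof (rule that[OF l0]; unfold t_eq)
      fix T assume T1: "T \<le> t l / (l * sqrt r)" and Tn: "T \<le> real n - 1"
      have "s * (1 + T) \<le> N + s * (1 + 71/100 * X)" using T[OF T1] xX N by (simp add: algebra_simps)
      then have "1 + T \<le> N / s + (1 + 71/100 * X)" by (rule from_s)
      then show "sqrt (8 * real n + 16 * real n * L / r) + 1 + T \<le> real n / sqrt r + 2 * z + 2 * X"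
        using a by (intro main2[where c=0]) auto
      fix \<kappa> m :: real assume \<kappa>: "0 \<le> \<kappa>" and m: "0 \<le> m" "m \<le> 1" "1 - \<kappa>\<^sup>2 \<le> m\<^sup>2"
      show "1 + T \<le> 2 * \<kappa> * (real n / sqrt r + z + X) \<or> 1 + T \<le> real n / sqrt r + sqrt m * z"
      proof (rule disjCI)
        assume neg: "\<not> 1 + T \<le> real n / sqrt r + sqrt m * z"
        show "1 + T \<le> 2 * \<kappa> * (real n / sqrt r + z + X)"
        proof (rule ccontr)
          \<comment> \<open>As 1 + T \<le> N, failure of the first alternative gives 2 \<kappa> X
            \<le> N, while X \<ge> 23/10 L by the \<eta>-part of \<open>X\<close>. So \<kappa> is at
            most of order N / L, and the loss \<kappa>^2 y caused by sqrt m is at most 3/100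
            N.\<close>
          assume "\<not> ?thesis"
          then have "2 * \<kappa> * (N / s + z + X) < N" using Tn by (simp add: N_def s_def)
          moreover have "2 * \<kappa> * X \<le> 2 * \<kappa> * (N / s + z + X)" using \<kappa> N s z0 by (intro mult_left_mono) auto
          ultimately have kX: "2 * \<kappa> * X \<le> N" by linarith
          \<comment> \<open>9/4 - 10/27 exceeds 7/4.\<close>
          have LN: "7/4 * N \<le> L" using large lnN N by (simp add: L'_def)
          have "(23/10 * L)\<^sup>2 \<le> 16/3 * L * L" using L by (simp add: power2_eq_square)
          also have "\<dots> \<le> 16/3 * L * L'" using L L' by (intro mult_left_mono) auto
          finally have "(23/10 * L)\<^sup>2 \<le> X\<^sup>2" using X2 by (simp add: L'_def N_def)
          then have XL: "23/10 * L \<le> X" by (rule power2_le_imp_le[OF _ X])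
          have "2 * \<kappa> * (23/10 * L) \<le> N" using mult_left_mono[OF XL, of "2 * \<kappa>"] \<kappa> kX by linarith
          then have kL: "46/10 * (\<kappa> * L) \<le> N" by (simp add: mult_ac)
          have yN: "187/100 * N \<le> y"
          proof (rule power2_le_imp_le[OF _ y(1)])
            have "(187/100 * N)\<^sup>2 \<le> 2 * N * (7/4 * N)" using N by (simp add: power2_eq_square)
            also have "\<dots> \<le> y\<^sup>2" unfolding y(2) using LN N by (intro mult_left_mono) auto
            finally show "(187/100 * N)\<^sup>2 \<le> y\<^sup>2" .
          qed
          have ky: "\<kappa>\<^sup>2 * y \<le> 3/100 * N \<and> \<kappa>\<^sup>2 \<le> 3/100"
          proof -
            have "\<kappa> * (7/4 * N) \<le> \<kappa> * L" using LN \<kappa> by (intro mult_left_mono) auto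
            then have "805/100 * \<kappa> * N \<le> 1 * N" using kL by (simp add: mult_ac)
            then have "805/100 * \<kappa> \<le> 1" by (rule mult_right_le_imp_le) (use N in simp)
            then have k8: "\<kappa> \<le> 1/8" by linarith
            have "y\<^sup>2 * \<kappa> \<le> 2 * N * (N * (10/46))" unfolding y(2) using kL N mult_left_mono[of "\<kappa> * L" "N * (10/46)" "2 * N"] by (simp add: mult_ac)
            then have "y * (y * \<kappa>) \<le> 20/46 * N\<^sup>2" by (simp add: power2_eq_square mult_ac)
            moreover have "187/100 * N * (y * \<kappa>) \<le> y * (y * \<kappa>)" using yN y \<kappa> by (intro mult_right_mono) auto
            ultimately have "187/100 * (N * (y * \<kappa>)) \<le> 20/46 * (N * N)" by (simp add: power2_eq_square mult_ac)
            then have "N * (187/100 * (y * \<kappa>)) \<le> N * (20/46 * N)" by (simp add: mult_ac)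
            then have "187/100 * (y * \<kappa>) \<le> 20/46 * N" by (rule mult_left_le_imp_le) (use N in simp)
            then have yk: "y * \<kappa> \<le> 24/100 * N" using N by linarith
            have "\<kappa>\<^sup>2 * y = \<kappa> * (y * \<kappa>)" by (simp add: power2_eq_square)
            also have "\<dots> \<le> 1/8 * (24/100 * N)" by (rule mult_mono[OF k8 yk]) (use \<kappa> y in auto)
            finally have "\<kappa>\<^sup>2 * y \<le> 3/100 * N" by simp
            moreover have "\<kappa>\<^sup>2 \<le> (1/8)\<^sup>2" using k8 \<kappa> by (intro power_mono) auto
            ultimately show ?thesis by (simp add: power2_eq_square)
          qed
          have xy: "x \<le> y + 20/100 * N"
          proof (rule power2_le_imp_le)
            have "x\<^sup>2 = y\<^sup>2 + 2 * N * ln N" by (simp add: x(2) y(2) L'_def algebra_simps)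
            also have "2 * N * ln N \<le> 2 * N * (10/27 * N)" using lnN N by (intro mult_left_mono) auto
            also have "y\<^sup>2 + 2 * N * (10/27 * N) \<le> (y + 20/100 * N)\<^sup>2"
            proof -
              have "187/100 * N * N \<le> y * N" using yN N by (intro mult_right_mono) auto
              moreover have "(y + 20/100 * N)\<^sup>2 = y\<^sup>2 + 40/100 * (y * N) + 4/100 * (N * N)"
                by (simp add: power2_eq_square algebra_simps)
              moreover have "2 * N * (10/27 * N) = 20/27 * (N * N)" "187/100 * N * N = 187/100 * (N * N)" by simp_all
              moreover have "0 \<le> N * N" by simp
              ultimately show ?thesis by linarith
            qed
            finally show "x\<^sup>2 \<le> (y + 20/100 * N)\<^sup>2" by simp
          qed (use y N in simp)
          have "1 - \<kappa>\<^sup>2 \<le> sqrt m"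
          proof -
            have "m\<^sup>2 \<le> m" using m by (simp add: power2_eq_square mult_left_le)
            moreover have "m \<le> sqrt m" using m calculation by (intro real_le_rsqrt) auto
            ultimately show ?thesis using m(3) by linarith
          qed
          then have "(1 - \<kappa>\<^sup>2) * (s * z) \<le> sqrt m * (s * z)" using s z0 by (intro mult_right_mono) auto
          moreover have "s * (2 * a) + y \<le> s * z" using sq unfolding zq by (simp add: algebra_simps)
          then have "(1 - \<kappa>\<^sup>2) * (s * (2 * a) + y) \<le> (1 - \<kappa>\<^sup>2) * (s * z)" using ky by (intro mult_left_mono) auto
          moreover have "97/100 * (s * (2 * a)) \<le> (1 - \<kappa>\<^sup>2) * (s * (2 * a))" using ky s a by (intro mult_right_mono) auto
          moreover have "s * 1 \<le> s * a" using a s by (intro mult_left_mono) auto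
          moreover have "s * (1 + T) = s + s * T" by (simp add: distrib_left)
          moreover have "(1 - \<kappa>\<^sup>2) * (s * (2 * a) + y) = (1 - \<kappa>\<^sup>2) * (s * (2 * a)) + y - \<kappa>\<^sup>2 * y" by (simp add: algebra_simps)
          moreover have "sqrt m * (s * z) = s * (sqrt m * z)" by simp
          moreover have "s * (2 * a) = 2 * (s * a)" by simp
          ultimately have "s * (1 + T) \<le> N + s * (sqrt m * z)"
            using T[OF T1] xy conjunct1[OF ky] N s(1) by linarith
          then have "1 + T \<le> N / s + sqrt m * z" by (rule from_s)
          then show False using neg by (simp add: N_def s_def)
        qed
      qed
    qed
  qed
qed

section \<open>The minimization problem for inliers and outliers\<close>

declare transpose_matrix_vector[simp del]

lemma l1obj_nonneg: "0 \<le> l1obj M2 d c"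
  by (simp add: l1obj_def sum_nonneg)

section \<open>Existence of optimal points\<close>

text \<open>On the span of the data the objective is a norm, hence coercive, and compactness gives a
  minimizer there. A component orthogonal to the data changes neither the objective nor the
  constraint.\<close>

lemma opt_point_exists:
  fixes d :: "nat \<Rightarrow> real^'m"
  assumes j: "j < M2" and dj: "d j \<noteq> 0"
  shows "\<exists>c. opt_point M2 d j c"
proof -
  define V where "V = span (d ` {..<M2})"
  let ?f = "l1obj M2 d"
  have cont: "continuous_on S ?f" for S unfolding l1obj_def by (intro continuous_intros)
  have clV: "closed V" unfolding V_def by (rule closed_span)
  have djV: "d j \<in> V" unfolding V_def using j by (intro span_base) auto
  have pos: "0 < ?f c" if c: "c \<in> V" "c \<noteq> 0" for c
  proof (rule ccontr)
    assume "\<not> 0 < ?f c"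
    then have "?f c = 0" using l1obj_nonneg[of M2 d c] by linarith
    then have "\<forall>i<M2. c \<bullet> d i = 0" by (simp add: l1obj_def sum_nonneg_eq_0_iff)
    then have "V \<subseteq> {x. c \<bullet> x = 0}"
      unfolding V_def by (intro span_minimal subspace_hyperplane) auto
    then show False using c by auto
  qed
  have comp: "compact (sphere 0 1 \<inter> V)" using clV by (intro compact_Int_closed) auto
  have ne: "sphere 0 1 \<inter> V \<noteq> {}"
  proof -
    have "d j /\<^sub>R norm (d j) \<in> sphere 0 1 \<inter> V" using dj djV unfolding V_def by (auto intro: span_scale)
    then show ?thesis by blast
  qed
  obtain w where w: "w \<in> sphere 0 1 \<inter> V" "\<And>x. x \<in> sphere 0 1 \<inter> V \<Longrightarrow> ?f w \<le> ?f x"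
    using continuous_attains_inf[OF comp ne cont] by blast
  define e where "e = ?f w"
  have e: "0 < e" unfolding e_def using w by (intro pos) auto
  have scale: "?f (a *\<^sub>R x) = \<bar>a\<bar> * ?f x" for a x by (simp add: l1obj_def abs_mult sum_distrib_left)
  have low: "e * norm x \<le> ?f x" if "x \<in> V" for x
  proof (cases "x = 0")
    case False
    then have "e \<le> ?f (x /\<^sub>R norm x)"
      unfolding e_def using that unfolding V_def[symmetric] by (intro w) (auto simp: V_def intro: span_scale)
    then show ?thesis using False by (simp add: scale field_simps)
  qed (simp add: l1obj_nonneg)
  define c0 where "c0 = d j /\<^sub>R (norm (d j))\<^sup>2"
  have c0: "c0 \<in> V" "c0 \<bullet> d j = 1" using djV dj unfolding V_def c0_def
    by (auto intro: span_scale simp: power2_norm_eq_inner)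
  \<comment> \<open>By \<open>low\<close>, this radius contains every point of the span whose
    objective does not exceed that of \<open>c0\<close>.\<close>
  define C where "C = {c \<in> V. c \<bullet> d j = 1} \<inter> cball 0 (?f c0 / e)"
  have "closed {c \<in> V. c \<bullet> d j = 1}"
    using clV by (intro closed_Collect_conj) (auto intro!: closed_Collect_eq continuous_intros)
  then have cC: "compact C" unfolding C_def by (intro closed_Int_compact) auto
  have small: "norm x \<le> ?f c0 / e" if "x \<in> V" "?f x \<le> ?f c0" for x
    using low[OF that(1)] that(2) e by (simp add: pos_le_divide_eq mult.commute)
  have c0C: "c0 \<in> C" using c0 small unfolding C_def by auto
  obtain c where c: "c \<in> C" "\<And>x. x \<in> C \<Longrightarrow> ?f c \<le> ?f x"
    using continuous_attains_inf[OF cC _ cont] c0C by blast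
  have "?f c \<le> ?f c'" if c': "c' \<bullet> d j = 1" for c'
  proof -
    obtain y z where yz: "y \<in> span (d ` {..<M2})" "\<And>w. w \<in> span (d ` {..<M2}) \<Longrightarrow> orthogonal z w" "c' = y + z"
      using orthogonal_subspace_decomp_exists[of "d ` {..<M2}" c'] by metis
    have zi: "z \<bullet> d i = 0" if "i < M2" for i
      using yz(2)[of "d i"] that by (auto simp: orthogonal_def intro: span_base)
    have "?f c' = ?f y" unfolding l1obj_def by (intro sum.cong) (auto simp: yz(3) inner_add_left zi)
    moreover have "?f c \<le> ?f y"
    proof (cases "?f y \<le> ?f c0")
      case True
      have "y \<bullet> d j = 1" using c' zi[OF j] by (simp add: yz(3) inner_add_left)
      then show ?thesis using small[of y] True yz(1) by (intro c) (auto simp: C_def V_def)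
    next
      case False
      then show ?thesis using c(2)[OF c0C] by linarith
    qed
    ultimately show ?thesis by simp
  qed
  then show ?thesis using c(1) unfolding opt_point_def C_def by blast
qed

section \<open>Spectral norm and isometries\<close>

lemma spec_norm_le: "norm (A *v x) \<le> spec_norm A * norm x"
  unfolding spec_norm_def by (rule onorm) (rule matrix_vector_mul_bounded_linear)

lemma spec_norm_nonneg: "0 \<le> spec_norm A"
  unfolding spec_norm_def by (rule onorm_pos_le) (rule matrix_vector_mul_bounded_linear)

lemma inner_transpose: "(A *v x) \<bullet> y = x \<bullet> (transpose A *v y)" for A :: "real^'n^'m"
  by (metis dot_lmul_matrix inner_commute vector_transpose_matrix transpose_transpose)

lemma inner_gram: "x \<bullet> (A *v (transpose A *v x)) = (norm (transpose A *v x))\<^sup>2" for A :: "real^'n^'m"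
  by (subst inner_commute, subst inner_transpose) (simp add: power2_norm_eq_inner)

lemma spec_norm_transpose_le: "norm (transpose A *v y) \<le> spec_norm A * norm y" for A :: "real^'n^'m"
proof -
  let ?t = "transpose A *v y"
  have "norm ?t * norm ?t = (A *v ?t) \<bullet> y" by (simp add: inner_transpose power2_norm_eq_inner[symmetric] power2_eq_square)
  also have "\<dots> \<le> norm (A *v ?t) * norm y" by (rule norm_cauchy_schwarz)
  also have "\<dots> \<le> norm ?t * (spec_norm A * norm y)"
    using mult_right_mono[OF spec_norm_le[of A ?t] norm_ge_zero[of y]] by (simp add: mult_ac)
  finally show ?thesis
    using spec_norm_nonneg[of A] by (cases "?t = 0") auto
qed

lemma span_columns: "span (columns A) = range (\<lambda>x. A *v x)" for A :: "real^'n^'m"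
proof
  show "span (columns A) \<subseteq> range (\<lambda>x. A *v x)"
  proof (rule span_minimal)
    show "columns A \<subseteq> range (\<lambda>x. A *v x)"
      unfolding columns_def by (auto simp: matrix_vector_mul_component intro!: image_eqI[of _ _ "axis _ 1"] simp: matrix_vector_mult_basis)
    show "subspace (range (\<lambda>x. A *v x))"
      by (intro linear_subspace_image matrix_vector_mul_linear subspace_UNIV)
  qed
  show "range (\<lambda>x. A *v x) \<subseteq> span (columns A)"
    using matrix_vector_mult_in_columnspace by blast
qed

lemma isometry_inner:
  fixes A :: "real^'n^'m"
  assumes "transpose A ** A = mat 1"
  shows "(A *v x) \<bullet> (A *v y) = x \<bullet> y" "norm (A *v x) = norm x" "transpose A *v (A *v x) = x"
proof -
  show t: "transpose A *v (A *v x) = x" for x by (simp add: matrix_vector_mul_assoc assms)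
  show i: "(A *v x) \<bullet> (A *v y) = x \<bullet> y" for x y by (subst inner_transpose) (simp only: t)
  show "norm (A *v x) = norm x" by (simp add: norm_eq_sqrt_inner i)
qed

lemma dim_span_columns_isometry:
  fixes A :: "real^'n^'m"
  assumes "transpose A ** A = mat 1"
  shows "dim (span (columns A)) = CARD('n)"
proof -
  have "inj (\<lambda>x. A *v x)" by (rule injI) (metis isometry_inner(3)[OF assms])
  then have "dim (range (\<lambda>x. A *v x)) = dim (UNIV :: (real^'n) set)"
    by (intro dim_image_eq matrix_vector_mul_linear) (auto intro: inj_on_subset)
  then show ?thesis by (simp add: span_columns)
qed

section \<open>Splitting along the inlier subspace\<close>

locale orthogonal_frames =
  fixes U :: "real^'r^'m" and W :: "real^'q^'m" and Uo :: "real^'ro^'m"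
  assumes U: "transpose U ** U = mat 1" and W: "transpose W ** W = mat 1"
    and perp: "span (columns W) = {x. \<forall>u\<in>span (columns U). x \<bullet> u = 0}"
    and Uo: "transpose Uo ** Uo = mat 1"
begin

definition proj :: "real^'m \<Rightarrow> real^'m" where
  "proj x = W *v (transpose W *v x)"

lemma WU: "(W *v y) \<bullet> (U *v x) = 0"
  using perp unfolding span_columns by blast

lemma WtU: "transpose W *v (U *v x) = 0"
  using WU[of "transpose W *v (U *v x)" x] by (subst (asm) inner_transpose) simp

lemma decomp: "x = U *v (transpose U *v x) + proj x"
proof -
  define w where "w = x - U *v (transpose U *v x)"
  have "w \<bullet> (U *v y) = 0" for y
  proof -
    have "w \<bullet> (U *v y) = (U *v y) \<bullet> w" by (rule inner_commute)
    also have "\<dots> = y \<bullet> (transpose U *v x - transpose U *v (U *v (transpose U *v x)))"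
      by (simp add: inner_transpose w_def matrix_vector_mult_diff_distrib)
    finally show ?thesis by (simp add: isometry_inner(3)[OF U])
  qed
  then have "w \<in> range (\<lambda>y. W *v y)" using perp unfolding span_columns by auto
  then obtain y where y: "w = W *v y" by auto
  have "transpose W *v w = transpose W *v x"
    by (simp add: w_def matrix_vector_mult_diff_distrib WtU)
  then have "y = transpose W *v x" unfolding y by (simp add: isometry_inner(3)[OF W])
  then show ?thesis using y unfolding proj_def w_def by (simp add: algebra_simps)
qed

lemma norm_decomp: "(norm x)\<^sup>2 = (norm (transpose U *v x))\<^sup>2 + (norm (transpose W *v x))\<^sup>2"
proof -
  have "(norm x)\<^sup>2 = x \<bullet> (U *v (transpose U *v x)) + x \<bullet> proj x"
    using decomp[of x] by (metis inner_add_right power2_norm_eq_inner)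
  then show ?thesis by (simp add: proj_def inner_gram)
qed

lemma proj_inner: "proj x \<bullet> y = (transpose W *v x) \<bullet> (transpose W *v y)"
  unfolding proj_def by (rule inner_transpose)

lemma proj_inner_U: "proj x \<bullet> (U *v y) = 0" unfolding proj_def by (rule WU)

lemma in_span_U_iff: "x \<in> span (columns U) \<longleftrightarrow> transpose W *v x = 0"
proof
  assume "x \<in> span (columns U)"
  then show "transpose W *v x = 0" unfolding span_columns by (auto simp: WtU)
next
  assume "transpose W *v x = 0"
  then have "x = U *v (transpose U *v x)" using decomp[of x] by (simp add: proj_def)
  then show "x \<in> span (columns U)" unfolding span_columns by (metis rangeI)
qed

abbreviation \<kappa> where "\<kappa> \<equiv> spec_norm (transpose U ** Uo)"
abbreviation s where "s \<equiv> spec_norm (transpose Uo ** W)"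

lemma UtUo: "norm (transpose U *v (Uo *v z)) \<le> \<kappa> * norm z"
  using spec_norm_le[of "transpose U ** Uo" z] by (simp add: matrix_vector_mul_assoc)

lemma UotU: "norm (transpose Uo *v (U *v g)) \<le> \<kappa> * norm g"
  using spec_norm_transpose_le[of "transpose U ** Uo" g]
  by (simp add: matrix_vector_mul_assoc matrix_transpose_mul transpose_transpose)

lemma UotW: "norm (transpose Uo *v (W *v y)) \<le> s * norm y"
  using spec_norm_le[of "transpose Uo ** W" y] by (simp add: matrix_vector_mul_assoc)

lemma WtUo: "norm (transpose W *v (Uo *v z)) \<le> s * norm z"
  using spec_norm_transpose_le[of "transpose Uo ** W" z]
  by (simp add: matrix_vector_mul_assoc matrix_transpose_mul transpose_transpose)

end

section \<open>Deterministic consequences of the permeance bounds\<close>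

text \<open>A realization of the data stripped of probability. While \<open>upper\<close> concerns
  all directions, \<open>fixed\<close> concerns for each outlier one direction determined by that
  outlier alone, and so admits a sharper constant.\<close>

locale good_data = orthogonal_frames U W Uo
  for U :: "real^'r^'m" and W :: "real^'q^'m" and Uo :: "real^'ro^'m" +
  fixes D :: "nat \<Rightarrow> real^'m" and n_o n_i :: nat and \<A> S T :: real
  assumes n_o: "1 \<le> n_o"
    and outlier: "\<And>i. i < n_o \<Longrightarrow> D i = Uo *v (transpose Uo *v D i)"
    and outlier_norm: "\<And>i. i < n_o \<Longrightarrow> norm (transpose Uo *v D i) = 1"
    and outlier_off: "\<And>i. i < n_o \<Longrightarrow> transpose W *v D i \<noteq> 0"
    and inlier: "\<And>i. n_o \<le> i \<Longrightarrow> i < n_o + n_i \<Longrightarrow> D i = U *v (transpose U *v D i)"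
    and inlier_norm: "\<And>i. n_o \<le> i \<Longrightarrow> i < n_o + n_i \<Longrightarrow> norm (transpose U *v D i) = 1"
    and lower: "\<And>u. norm u = 1 \<Longrightarrow> \<A> \<le> (\<Sum>i\<in>{n_o..<n_o + n_i}. \<bar>u \<bullet> (transpose U *v D i)\<bar>)"
    and upper: "\<And>u. norm u = 1 \<Longrightarrow> (\<Sum>i<n_o. \<bar>u \<bullet> (transpose Uo *v D i)\<bar>) \<le> S"
    and fixed: "\<And>j. j < n_o \<Longrightarrow> (\<Sum>i\<in>{..<n_o}-{j}. \<bar>direction (transpose Uo *v proj (D j)) \<bullet> (transpose Uo *v D i)\<bar>) \<le> T"
begin

abbreviation M2 where "M2 \<equiv> n_o + n_i"

lemma inlier_permeance: "\<A> * norm u \<le> (\<Sum>i\<in>{n_o..<M2}. \<bar>u \<bullet> (transpose U *v D i)\<bar>)"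
proof (cases "u = 0")
  case False
  have "\<A> * norm u \<le> (\<Sum>i\<in>{n_o..<M2}. \<bar>(u /\<^sub>R norm u) \<bullet> (transpose U *v D i)\<bar>) * norm u"
    using False by (intro mult_right_mono lower) auto
  also have "\<dots> = (\<Sum>i\<in>{n_o..<M2}. \<bar>u \<bullet> (transpose U *v D i)\<bar>)"
    unfolding sum_distrib_right using False by (intro sum.cong) (auto simp: abs_mult)
  finally show ?thesis .
qed simp

lemma outlier_permeance: "(\<Sum>i<n_o. \<bar>u \<bullet> (transpose Uo *v D i)\<bar>) \<le> S * norm u"
proof (cases "u = 0")
  case False
  have "(\<Sum>i<n_o. \<bar>u \<bullet> (transpose Uo *v D i)\<bar>) = (\<Sum>i<n_o. \<bar>(u /\<^sub>R norm u) \<bullet> (transpose Uo *v D i)\<bar>) * norm u"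
    unfolding sum_distrib_right using False by (intro sum.cong) (auto simp: abs_mult)
  also have "\<dots> \<le> S * norm u"
    using False by (intro mult_right_mono upper) auto
  finally show ?thesis .
qed simp

lemma S_nonneg: "0 \<le> S"
proof -
  have "0 \<le> (\<Sum>i<n_o. \<bar>(axis undefined 1 :: real^'ro) \<bullet> (transpose Uo *v D i)\<bar>)" by (intro sum_nonneg) auto
  also have "\<dots> \<le> S" by (rule upper) simp
  finally show ?thesis .
qed

lemma T_nonneg: "0 \<le> T"
proof -
  have "0 \<le> (\<Sum>i\<in>{..<n_o}-{0}. \<bar>direction (transpose Uo *v proj (D 0)) \<bullet> (transpose Uo *v D i)\<bar>)"
    by (intro sum_nonneg) auto
  also have "\<dots> \<le> T" by (rule fixed) (use n_o in simp)
  finally show ?thesis .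
qed

definition offset where "offset = Min ((\<lambda>j. norm (transpose W *v D j)) ` {..<n_o})"

lemma offset_le: "j < n_o \<Longrightarrow> offset \<le> norm (transpose W *v D j)"
  unfolding offset_def by (intro Min_le) auto

lemma offset_attained: obtains j where "j < n_o" "offset = norm (transpose W *v D j)"
proof -
  have "offset \<in> (\<lambda>j. norm (transpose W *v D j)) ` {..<n_o}"
    unfolding offset_def using n_o by (intro Min_in) (auto simp: lessThan_empty_iff)
  then show ?thesis using that by auto
qed

lemma offset_pos: "0 < offset" using offset_attained outlier_off by (metis zero_less_norm_iff)

lemma norm_WD: "j < n_o \<Longrightarrow> norm (transpose W *v D j) \<le> s"
  using WtUo[of "transpose Uo *v D j"] outlier[of j] outlier_norm[of j] by simp

lemma offset_le_s: "offset \<le> s" using offset_attained norm_WD by metis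

text \<open>Pythagoras: an outlier has at most \<kappa> of its length in the inlier subspace. A
  small \<kappa> thus forces the offset to be close to 1.\<close>

lemma offset_square: "1 - \<kappa>\<^sup>2 \<le> offset\<^sup>2"
proof -
  obtain j where j: "j < n_o" "offset = norm (transpose W *v D j)" by (rule offset_attained)
  have "norm (D j) = 1" using outlier[OF j(1)] outlier_norm[OF j(1)] isometry_inner(2)[OF Uo] by metis
  moreover have "norm (transpose U *v D j) \<le> \<kappa>"
    using UtUo[of "transpose Uo *v D j"] outlier[OF j(1)] outlier_norm[OF j(1)] by simp
  then have "(norm (transpose U *v D j))\<^sup>2 \<le> \<kappa>\<^sup>2" by (intro power_mono) auto
  ultimately show ?thesis using norm_decomp[of "D j"] j(2) by simp
qed

lemma offset_le_1: "offset \<le> 1"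
proof -
  obtain j where j: "j < n_o" "offset = norm (transpose W *v D j)" by (rule offset_attained)
  have "norm (D j) = 1" using outlier[OF j(1)] outlier_norm[OF j(1)] isometry_inner(2)[OF Uo] by metis
  then have "(norm (D j))\<^sup>2 = 1" by simp
  then have "offset\<^sup>2 \<le> 1\<^sup>2"
    using norm_decomp[of "D j"] zero_le_power2[of "norm (transpose U *v D j)"] unfolding j(2) one_power2 by linarith
  then show ?thesis by (rule power2_le_imp_le) simp
qed

lemma l1obj_split: "l1obj M2 D c = (\<Sum>i<n_o. \<bar>c \<bullet> D i\<bar>) + (\<Sum>i\<in>{n_o..<M2}. \<bar>c \<bullet> D i\<bar>)"
proof -
  have "{..<n_o} \<union> {n_o..<M2} = {..<M2}" by auto
  then show ?thesis unfolding l1obj_def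
    using sum.union_disjoint[of "{..<n_o}" "{n_o..<M2}" "\<lambda>i. \<bar>c \<bullet> D i\<bar>"] by (simp add: ivl_disj_int)
qed

lemma inner_inlier: "n_o \<le> i \<Longrightarrow> i < M2 \<Longrightarrow> c \<bullet> D i = (transpose U *v c) \<bullet> (transpose U *v D i)"
  using inlier[of i] by (metis inner_commute inner_transpose)

lemma inner_outlier: "i < n_o \<Longrightarrow> c \<bullet> D i = (transpose Uo *v c) \<bullet> (transpose Uo *v D i)"
  using outlier[of i] by (metis inner_commute inner_transpose)

lemma inlier_sum: "\<A> * norm (transpose U *v c) \<le> (\<Sum>i\<in>{n_o..<M2}. \<bar>c \<bullet> D i\<bar>)"
proof -
  have "(\<Sum>i\<in>{n_o..<M2}. \<bar>c \<bullet> D i\<bar>) = (\<Sum>i\<in>{n_o..<M2}. \<bar>(transpose U *v c) \<bullet> (transpose U *v D i)\<bar>)"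
    by (intro sum.cong) (auto simp: inner_inlier[of _ c])
  then show ?thesis using inlier_permeance[of "transpose U *v c"] by simp
qed

lemma inlier_objective:
  assumes i: "n_o \<le> i" "i < M2" and c: "c \<bullet> D i = 1" and A: "0 \<le> \<A>"
  shows "\<A> \<le> l1obj M2 D c"
proof -
  have "1 \<le> norm (transpose U *v c) * norm (transpose U *v D i)"
    using c inner_inlier[OF i, of c] norm_cauchy_schwarz[of "transpose U *v c" "transpose U *v D i"] by simp
  then have "\<A> * 1 \<le> \<A> * norm (transpose U *v c)" using A inlier_norm[OF i] by (intro mult_left_mono) auto
  moreover have "0 \<le> (\<Sum>i<n_o. \<bar>c \<bullet> D i\<bar>)" by (intro sum_nonneg) auto
  ultimately show ?thesis using inlier_sum[of c] l1obj_split[of c] by linarith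
qed

text \<open>The reciprocal of the parameter \<xi> of the theorem.\<close>

definition ratio where "ratio = s / offset"

lemma ratio_ge_1: "1 \<le> ratio" using offset_le_s offset_pos by (simp add: ratio_def)

text \<open>The competitor in the minimization problem of an outlier.\<close>

definition comp where "comp j = proj (D j) /\<^sub>R (norm (transpose W *v D j))\<^sup>2"

lemma comp_feasible: "j < n_o \<Longrightarrow> comp j \<bullet> D j = 1"
  using outlier_off[of j] by (simp add: comp_def proj_inner power2_norm_eq_inner)

lemma comp_inlier: "n_o \<le> i \<Longrightarrow> i < M2 \<Longrightarrow> comp j \<bullet> D i = 0"
  using inlier[of i] proj_inner_U[of "D j"] by (metis comp_def inner_scaleR_left mult_zero_right)

text \<open>The term of \<open>D j\<close> is 1 by feasibility. The others are those of
  \<open>fixed\<close>, scaled by the norm of \<open>transpose Uo *v proj (D j)\<close>, at most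
  \<open>s * mj\<close>, over the square of \<open>mj\<close>. That \<open>ratio\<close> is at least
  1 absorbs the isolated 1.\<close>

lemma comp_outliers:
  assumes j: "j < n_o"
  shows "(\<Sum>i<n_o. \<bar>comp j \<bullet> D i\<bar>) \<le> ratio * (1 + T)"
proof -
  define mj where "mj = norm (transpose W *v D j)"
  have mj: "0 < mj" "offset \<le> mj" using outlier_off[OF j] offset_le[OF j] by (simp_all add: mj_def)
  define v where "v = transpose Uo *v proj (D j)"
  have v: "norm v \<le> s * mj" unfolding v_def proj_def mj_def by (rule UotW)
  have "(\<Sum>i<n_o. \<bar>comp j \<bullet> D i\<bar>) = \<bar>comp j \<bullet> D j\<bar> + (\<Sum>i\<in>{..<n_o}-{j}. \<bar>comp j \<bullet> D i\<bar>)"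
    using j by (intro sum.remove) auto
  also have "\<bar>comp j \<bullet> D j\<bar> = 1" using comp_feasible[OF j] by simp
  also have "(\<Sum>i\<in>{..<n_o}-{j}. \<bar>comp j \<bullet> D i\<bar>) = (norm v / mj\<^sup>2) * (\<Sum>i\<in>{..<n_o}-{j}. \<bar>(v /\<^sub>R norm v) \<bullet> (transpose Uo *v D i)\<bar>)"
    unfolding sum_distrib_left
  proof (rule sum.cong)
    fix i assume "i \<in> {..<n_o} - {j}"
    then have "comp j \<bullet> D i = (v \<bullet> (transpose Uo *v D i)) / mj\<^sup>2"
      unfolding comp_def mj_def[symmetric] by (simp add: inner_outlier[of i "proj (D j)"] v_def field_simps)
    then show "\<bar>comp j \<bullet> D i\<bar> = norm v / mj\<^sup>2 * \<bar>(v /\<^sub>R norm v) \<bullet> (transpose Uo *v D i)\<bar>"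
      by (cases "v = 0") (auto simp: abs_mult)
  qed simp
  also have "\<dots> \<le> (s / mj) * T"
  proof (rule mult_mono)
    show "norm v / mj\<^sup>2 \<le> s / mj" using v mj by (simp add: power2_eq_square field_simps)
    show "(\<Sum>i\<in>{..<n_o}-{j}. \<bar>(v /\<^sub>R norm v) \<bullet> (transpose Uo *v D i)\<bar>) \<le> T"
      unfolding v_def by (rule fixed[OF j])
    show "0 \<le> s / mj" using mj spec_norm_nonneg by (intro divide_nonneg_pos) auto
  qed (intro sum_nonneg, simp)
  also have "\<dots> \<le> ratio * T"
    unfolding ratio_def using mj offset_pos spec_norm_nonneg T_nonneg by (intro mult_right_mono divide_left_mono) auto
  finally show ?thesis using ratio_ge_1 by (simp add: distrib_left)
qed

lemma comp_objective: "j < n_o \<Longrightarrow> l1obj M2 D (comp j) \<le> ratio * (1 + T)"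
  using comp_outliers[of j] comp_inlier[of _ j] unfolding l1obj_split by simp

text \<open>If \<open>c\<close> had a component \<open>U *v g\<close>, then deleting it and
  restoring the constraint by a multiple of \<open>comp j\<close> would save at least
  \<open>\<A> * norm g\<close> on the inliers and cost at most
  \<open>\<kappa> * (S + ratio * (1 + T)) * norm g\<close> on the outliers.\<close>

lemma outlier_opt_orthogonal:
  assumes j: "j < n_o" and opt: "opt_point M2 D j c" and A: "\<kappa> * (S + ratio * (1 + T)) < \<A>"
  shows "transpose U *v c = 0"
proof (rule ccontr)
  define g where "g = transpose U *v c"
  assume "transpose U *v c \<noteq> 0"
  then have g: "0 < norm g" by (simp add: g_def)
  \<comment> \<open>The amount by which deleting \<open>U *v g\<close> violates the
    constraint.\<close>
  define \<alpha> where "\<alpha> = (U *v g) \<bullet> D j"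
  define c' where "c' = proj c + \<alpha> *\<^sub>R comp j"
  have c: "c = U *v g + proj c" unfolding g_def by (rule decomp)
  have "c' \<bullet> D j = c \<bullet> D j"
    unfolding c'_def using comp_feasible[OF j] by (subst (2) c) (simp add: inner_add_left \<alpha>_def)
  then have "c' \<bullet> D j = 1" using opt by (simp add: opt_point_def)
  then have le: "l1obj M2 D c \<le> l1obj M2 D c'" using opt by (simp add: opt_point_def)
  have \<alpha>: "\<bar>\<alpha>\<bar> \<le> \<kappa> * norm g"
  proof -
    have "\<bar>\<alpha>\<bar> \<le> norm (transpose Uo *v (U *v g)) * norm (transpose Uo *v D j)"
      unfolding \<alpha>_def inner_outlier[OF j] by (rule Cauchy_Schwarz_ineq2)
    then show ?thesis using UotU[of g] outlier_norm[OF j] by simp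
  qed
  have "l1obj M2 D c' = (\<Sum>i<n_o. \<bar>c' \<bullet> D i\<bar>)"
  proof -
    have "c' \<bullet> D i = 0" if "n_o \<le> i" "i < M2" for i
      using comp_inlier[OF that, of j] inlier[OF that] proj_inner_U[of c] unfolding c'_def
      by (metis add.right_neutral inner_add_left inner_scaleR_left mult_zero_right)
    then show ?thesis unfolding l1obj_split by simp
  qed
  also have "\<dots> \<le> (\<Sum>i<n_o. \<bar>proj c \<bullet> D i\<bar> + \<bar>\<alpha>\<bar> * \<bar>comp j \<bullet> D i\<bar>)"
    unfolding c'_def by (intro sum_mono) (simp add: inner_add_left abs_mult[symmetric] abs_triangle_ineq)
  also have "\<dots> = (\<Sum>i<n_o. \<bar>proj c \<bullet> D i\<bar>) + \<bar>\<alpha>\<bar> * (\<Sum>i<n_o. \<bar>comp j \<bullet> D i\<bar>)"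
    by (simp add: sum.distrib sum_distrib_left)
  also have "\<bar>\<alpha>\<bar> * (\<Sum>i<n_o. \<bar>comp j \<bullet> D i\<bar>) \<le> (\<kappa> * norm g) * (ratio * (1 + T))"
    by (rule mult_mono[OF \<alpha> comp_outliers[OF j]]) (auto intro: mult_nonneg_nonneg spec_norm_nonneg sum_nonneg)
  finally have up: "l1obj M2 D c' \<le> (\<Sum>i<n_o. \<bar>proj c \<bullet> D i\<bar>) + (\<kappa> * norm g) * (ratio * (1 + T))" by simp
  have "(\<Sum>i<n_o. \<bar>(U *v g) \<bullet> D i\<bar>) = (\<Sum>i<n_o. \<bar>(transpose Uo *v (U *v g)) \<bullet> (transpose Uo *v D i)\<bar>)"
    by (intro sum.cong) (auto simp: inner_outlier[of _ "U *v g"])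
  also have "\<dots> \<le> S * norm (transpose Uo *v (U *v g))" by (rule outlier_permeance)
  also have "\<dots> \<le> S * (\<kappa> * norm g)"
    by (intro mult_left_mono UotU S_nonneg)
  finally have out: "(\<Sum>i<n_o. \<bar>(U *v g) \<bullet> D i\<bar>) \<le> S * (\<kappa> * norm g)" .
  have "(\<Sum>i<n_o. \<bar>proj c \<bullet> D i\<bar>) \<le> (\<Sum>i<n_o. \<bar>c \<bullet> D i\<bar> + \<bar>(U *v g) \<bullet> D i\<bar>)"
  proof (intro sum_mono)
    fix i
    have "c \<bullet> D i = (U *v g) \<bullet> D i + proj c \<bullet> D i" by (subst c) (rule inner_add_left)
    then show "\<bar>proj c \<bullet> D i\<bar> \<le> \<bar>c \<bullet> D i\<bar> + \<bar>(U *v g) \<bullet> D i\<bar>" by linarith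
  qed
  then have "(\<Sum>i<n_o. \<bar>proj c \<bullet> D i\<bar>) \<le> (\<Sum>i<n_o. \<bar>c \<bullet> D i\<bar>) + S * (\<kappa> * norm g)"
    using out by (simp add: sum.distrib)
  then have "\<A> * norm g \<le> S * (\<kappa> * norm g) + (\<kappa> * norm g) * (ratio * (1 + T))"
    using le up inlier_sum[of c] unfolding l1obj_split[of c] g_def[symmetric] by linarith
  also have "\<dots> = \<kappa> * (S + ratio * (1 + T)) * norm g" by (simp add: algebra_simps)
  also have "\<dots> < \<A> * norm g" using A g by (rule mult_strict_right_mono)
  finally show False by simp
qed

text \<open>Once \<open>c\<close> lies in the orthogonal complement, the constraint sees only the
  part of the outlier there, and Cauchy-Schwarz applies. This is the source of the lower bound on
  \<open>chi\<close>.\<close>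

lemma outlier_opt_norm:
  assumes j: "j < n_o" and opt: "opt_point M2 D j c" and c: "transpose U *v c = 0"
  shows "1 \<le> norm c * norm (transpose W *v D j)"
proof -
  have cp: "c = proj c" using decomp[of c] c by simp
  have "1 = c \<bullet> D j" using opt by (simp add: opt_point_def)
  also have "\<dots> = (transpose W *v c) \<bullet> (transpose W *v D j)" by (subst cp) (rule proj_inner)
  also have "\<dots> \<le> norm (transpose W *v c) * norm (transpose W *v D j)" by (rule norm_cauchy_schwarz)
  also have "norm (transpose W *v c) \<le> norm c"
    using norm_decomp[of c] c by (simp add: power2_eq_iff_nonneg)
  finally show ?thesis by (simp add: mult_right_mono)
qed

lemma outlier_objective: "j < n_o \<Longrightarrow> opt_point M2 D j c \<Longrightarrow> l1obj M2 D c \<le> ratio * (1 + T)"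
  using comp_objective[of j] comp_feasible[of j] unfolding opt_point_def by (meson order_trans)

lemma opt_objective_ge_1: "j < M2 \<Longrightarrow> opt_point M2 D j c \<Longrightarrow> 1 \<le> l1obj M2 D c"
proof -
  assume j: "j < M2" and opt: "opt_point M2 D j c"
  have "\<bar>c \<bullet> D j\<bar> \<le> l1obj M2 D c" unfolding l1obj_def using j by (intro member_le_sum) auto
  then show ?thesis using opt by (simp add: opt_point_def)
qed

text \<open>A nonzero direction of the subspace orthogonal to all inliers would contradict positive
  permeance.\<close>

lemma inliers_span:
  assumes A: "0 < \<A>"
  shows "span (D ` {n_o..<M2}) = span (columns U)"
proof
  have "D i \<in> span (columns U)" if "i \<in> {n_o..<M2}" for i
    using inlier[of i] that unfolding span_columns by (metis atLeastLessThan_iff rangeI)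
  then show "span (D ` {n_o..<M2}) \<subseteq> span (columns U)" by (intro span_minimal) auto
  let ?a = "\<lambda>i. transpose U *v D i"
  have "span (?a ` {n_o..<M2}) = UNIV"
  proof (rule ccontr)
    assume "span (?a ` {n_o..<M2}) \<noteq> UNIV"
    then obtain a where a: "a \<noteq> 0" "\<forall>x\<in>span (?a ` {n_o..<M2}). a \<bullet> x = 0"
      using span_not_UNIV_orthogonal by blast
    have "a \<bullet> ?a i = 0" if "i \<in> {n_o..<M2}" for i
      using a(2) span_base[OF imageI[OF that, of ?a]] by blast
    then have "\<A> * norm a \<le> 0" using inlier_permeance[of a] by simp
    then show False using A a(1) by (simp add: mult_le_0_iff)
  qed
  then have "range (\<lambda>x. U *v x) = (\<lambda>x. U *v x) ` span (?a ` {n_o..<M2})" by simp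
  also have "\<dots> = span ((\<lambda>x. U *v x) ` ?a ` {n_o..<M2})"
    by (rule linear_span_image[symmetric]) (rule matrix_vector_mul_linear)
  also have "(\<lambda>x. U *v x) ` ?a ` {n_o..<M2} = D ` {n_o..<M2}"
    unfolding image_image using inlier by (intro image_cong) auto
  finally show "span (columns U) \<subseteq> span (D ` {n_o..<M2})" unfolding span_columns by simp
qed

text \<open>In sorted order an initial segment consists of inliers only or contains all of them.
  Either way one of the two spans contains the other, and equal dimensions make them equal.\<close>

lemma recovery:
  fixes v :: "nat \<Rightarrow> real"
  assumes A: "0 < \<A>" and lt: "\<And>i j. i \<in> {n_o..<M2} \<Longrightarrow> j < n_o \<Longrightarrow> v i < v j"
    and \<sigma>: "bij_betw \<sigma> {..<M2} {..<M2}" and sorted: "\<And>s t. s \<le> t \<Longrightarrow> t < M2 \<Longrightarrow> v (\<sigma> s) \<le> v (\<sigma> t)"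
  shows "\<exists>k\<le>M2. dim (span ((\<lambda>t. D (\<sigma> t)) ` {..<k})) = CARD('r)"
    and "\<And>k. k \<le> M2 \<Longrightarrow> dim (span ((\<lambda>t. D (\<sigma> t)) ` {..<k})) = CARD('r) \<Longrightarrow> span ((\<lambda>t. D (\<sigma> t)) ` {..<k}) = span (columns U)"
proof -
  have dimU: "dim (span (columns U)) = CARD('r)" by (rule dim_span_columns_isometry[OF U])
  have dich: "\<sigma> ` {..<k} \<subseteq> {n_o..<M2} \<or> {n_o..<M2} \<subseteq> \<sigma> ` {..<k} \<and> (\<exists>j<n_o. j \<in> \<sigma> ` {..<k})" if k: "k \<le> M2" for k
  proof (rule disjCI)
    assume no: "\<not> ({n_o..<M2} \<subseteq> \<sigma> ` {..<k} \<and> (\<exists>j<n_o. j \<in> \<sigma> ` {..<k}))"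
    show "\<sigma> ` {..<k} \<subseteq> {n_o..<M2}"
    proof (rule ccontr)
      assume "\<not> \<sigma> ` {..<k} \<subseteq> {n_o..<M2}"
      then obtain x where "x \<in> \<sigma> ` {..<k}" "x \<notin> {n_o..<M2}" by blast
      then obtain t where t: "t < k" "\<sigma> t \<notin> {n_o..<M2}" by auto
      have "\<sigma> t < M2" using \<sigma> t k by (auto simp: bij_betw_def)
      then have to: "\<sigma> t < n_o" using t by auto
      have "{n_o..<M2} \<subseteq> \<sigma> ` {..<k}"
      proof
        fix i assume i: "i \<in> {n_o..<M2}"
        then have "i \<in> \<sigma> ` {..<M2}" using \<sigma> by (auto simp: bij_betw_def)
        then obtain u where u: "u < M2" "\<sigma> u = i" by auto
        have "u < t"
        proof (rule ccontr)
          assume "\<not> u < t"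
          then have "v (\<sigma> t) \<le> v (\<sigma> u)" using u by (intro sorted) auto
          then show False using lt[OF i to] u by simp
        qed
        then show "i \<in> \<sigma> ` {..<k}" using u t by auto
      qed
      then show False using no to t by auto
    qed
  qed
  have img: "(\<lambda>t. D (\<sigma> t)) ` {..<k} = D ` \<sigma> ` {..<k}" for k by (simp add: image_image)
  show "span ((\<lambda>t. D (\<sigma> t)) ` {..<k}) = span (columns U)"
    if k: "k \<le> M2" and d: "dim (span ((\<lambda>t. D (\<sigma> t)) ` {..<k})) = CARD('r)" for k
    using dich[OF k]
  proof
    assume "\<sigma> ` {..<k} \<subseteq> {n_o..<M2}"
    then have "span ((\<lambda>t. D (\<sigma> t)) ` {..<k}) \<subseteq> span (columns U)"
      unfolding img inliers_span[OF A, symmetric] by (intro span_mono image_mono)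
    then show ?thesis using d dimU by (intro subspace_dim_equal) auto
  next
    assume *: "{n_o..<M2} \<subseteq> \<sigma> ` {..<k} \<and> (\<exists>j<n_o. j \<in> \<sigma> ` {..<k})"
    then obtain j where j: "j < n_o" "j \<in> \<sigma> ` {..<k}" by auto
    have "span (columns U) \<subseteq> span ((\<lambda>t. D (\<sigma> t)) ` {..<k})"
      unfolding img inliers_span[OF A, symmetric] using * by (intro span_mono image_mono) auto
    then show ?thesis using d dimU by (intro subspace_dim_equal[symmetric]) auto
  qed
  show "\<exists>k\<le>M2. dim (span ((\<lambda>t. D (\<sigma> t)) ` {..<k})) = CARD('r)"
  proof (intro exI conjI)
    \<comment> \<open>The first \<open>n_i\<close> columns in sorted order are exactly the
      inliers.\<close>
    show "n_i \<le> M2" by simp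
    have inj: "inj_on \<sigma> {..<n_i}" using \<sigma> by (auto simp: bij_betw_def intro: inj_on_subset)
    have "\<sigma> ` {..<n_i} = {n_o..<M2}"
      using dich[of n_i]
    proof
      assume "\<sigma> ` {..<n_i} \<subseteq> {n_o..<M2}"
      then show ?thesis by (intro card_subset_eq) (auto simp: card_image[OF inj])
    next
      assume "{n_o..<M2} \<subseteq> \<sigma> ` {..<n_i} \<and> (\<exists>j<n_o. j \<in> \<sigma> ` {..<n_i})"
      then have "{n_o..<M2} = \<sigma> ` {..<n_i}"
        by (intro card_subset_eq) (auto simp: card_image[OF inj])
      then show ?thesis by simp
    qed simp
    then show "dim (span ((\<lambda>t. D (\<sigma> t)) ` {..<n_i})) = CARD('r)"
      unfolding img using inliers_span[OF A] dimU by simp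
  qed
qed

end

section \<open>The event of good data\<close>

text \<open>The random vectors are clipped so that all functionals of them are bounded everywhere and not
  merely almost everywhere.\<close>

definition clip :: "real^'k \<Rightarrow> real^'k" where
  "clip x = (if norm x \<le> 1 then x else 0)"

lemma clip_measurable[measurable]: "clip \<in> borel_measurable borel"
  unfolding clip_def by measurable

lemma clip_unit[simp]: "norm x = 1 \<Longrightarrow> clip x = x"
  by (simp add: clip_def)

lemma integral_unif_sphere_clip:
  fixes f :: "real^'k \<Rightarrow> real"
  assumes [measurable]: "f \<in> borel_measurable borel"
  shows "(\<integral>x. f (clip x) \<partial>unif_sphere) = (\<integral>x. f x \<partial>unif_sphere)"
  by (rule integral_cong_AE) (use AE_unif_sphere_norm in auto)

lemma iid_vectors_unif_sphere: "iid_vectors (unif_sphere :: (real^'k) measure) clip"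
proof -
  interpret prob_space "unif_sphere :: (real^'k) measure" by (rule prob_space_unif_sphere)
  have [measurable]: "(cosh :: real \<Rightarrow> real) \<in> borel_measurable borel"
    by (intro borel_measurable_continuous_onI continuous_intros)
  show ?thesis
  proof
    show "clip \<in> borel_measurable (unif_sphere :: (real^'k) measure)" by measurable
    show "norm (clip y) \<le> 1" for y :: "real^'k" by (simp add: clip_def)
    have "distr unif_sphere borel (\<lambda>y::real^'k. - clip y) = distr unif_sphere borel (\<lambda>y. clip (- y))"
      by (rule distr_cong) (auto simp: clip_def)
    also have "\<dots> = distr (distr unif_sphere borel uminus) borel (clip :: real^'k \<Rightarrow> _)"
      by (subst distr_distr) (auto simp: comp_def)
    finally show "distr unif_sphere borel (\<lambda>y::real^'k. - clip y) = distr unif_sphere borel clip"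
      by (simp add: distr_unif_sphere_uminus)
    fix u :: "real^'k" assume u: "norm u = 1"
    show "(\<integral>y. (u \<bullet> clip y)\<^sup>2 \<partial>unif_sphere) = 1 / real CARD('k)"
      using integral_unif_sphere_clip[of "\<lambda>y. (u \<bullet> y)\<^sup>2"] unif_sphere_inner_square[OF u] by simp
    show "(\<integral>y. cosh (l * (u \<bullet> clip y)) \<partial>unif_sphere) \<le> exp (l\<^sup>2 / (2 * real CARD('k)))" for l
      using integral_unif_sphere_clip[of "\<lambda>y. cosh (l * (u \<bullet> y))"] unif_sphere_cosh[OF u, of l] by simp
  qed
qed

lemma mean_abs_unif_sphere:
  fixes u :: "real^'k"
  assumes "norm u = 1"
  shows "sqrt (2 / pi) / sqrt (real CARD('k)) \<le> iid_vectors.mean_abs unif_sphere clip u"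
  using integral_unif_sphere_clip[of "\<lambda>y. \<bar>u \<bullet> y\<bar>"] unif_sphere_inner_abs[OF assms]
  by (simp add: iid_vectors.mean_abs_def[OF iid_vectors_unif_sphere])

section \<open>Transfer from the probability space to product measures\<close>

text \<open>The map \<open>f\<close> serves to turn the inliers, a block of indices beginning at
  \<open>n_o\<close>, into coordinates numbered from 0.\<close>

lemma (in prob_space) distr_iid_reindex:
  fixes X :: "'i \<Rightarrow> 'a \<Rightarrow> real^'k"
  assumes ind: "indep_vars (\<lambda>_. borel) X J" and J: "J \<noteq> {}"
    and X: "\<And>i. i \<in> J \<Longrightarrow> X i \<in> borel_measurable M" "\<And>i. i \<in> J \<Longrightarrow> distr M borel (X i) = unif_sphere"
    and f: "inj_on f I" "f \<in> I \<rightarrow> J"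
  shows "distr M (PiM I (\<lambda>_. borel)) (\<lambda>\<omega>. \<lambda>i\<in>I. X (f i) \<omega>) = PiM I (\<lambda>_. unif_sphere)"
proof -
  have d: "distr M (PiM J (\<lambda>_. borel)) (\<lambda>\<omega>. \<lambda>i\<in>J. X i \<omega>) = PiM J (\<lambda>_. unif_sphere)"
    using indep_vars_iff_distr_eq_PiM'[OF J X(1)] ind X(2) by (simp cong: PiM_cong)
  have m: "(\<lambda>\<omega>. \<lambda>i\<in>J. X i \<omega>) \<in> measurable M (PiM J (\<lambda>_. borel))"
    using X(1) by (intro measurable_restrict) auto
  have m2: "(\<lambda>x. \<lambda>i\<in>I. x (f i)) \<in> measurable (PiM J (\<lambda>_. borel)) (PiM I (\<lambda>_. borel))"
    using f(2) by (intro measurable_restrict measurable_component_singleton) auto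
  have "distr M (PiM I (\<lambda>_. borel)) (\<lambda>\<omega>. \<lambda>i\<in>I. X (f i) \<omega>)
     = distr (distr M (PiM J (\<lambda>_. borel)) (\<lambda>\<omega>. \<lambda>i\<in>J. X i \<omega>)) (PiM I (\<lambda>_. borel)) (\<lambda>x. \<lambda>i\<in>I. x (f i))"
    unfolding distr_distr[OF m2 m] using f(2) by (intro distr_cong) (auto simp: comp_def restrict_def fun_eq_iff)
  also have "\<dots> = distr (PiM J (\<lambda>_. unif_sphere)) (PiM I (\<lambda>_. unif_sphere)) (\<lambda>x. \<lambda>i\<in>I. x (f i))"
    unfolding d by (intro distr_cong) (auto intro!: sets_PiM_cong)
  also have "\<dots> = PiM I (\<lambda>_. unif_sphere)"
    using distr_PiM_reindex[of J "\<lambda>_. unif_sphere", OF _ f] by (simp add: prob_space_unif_sphere)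
  finally show ?thesis .
qed

lemma (in prob_space) iid_event:
  fixes X :: "'i \<Rightarrow> 'a \<Rightarrow> real^'k"
  assumes ind: "indep_vars (\<lambda>_. borel) X J" and J: "J \<noteq> {}"
    and X: "\<And>i. i \<in> J \<Longrightarrow> X i \<in> borel_measurable M" "\<And>i. i \<in> J \<Longrightarrow> distr M borel (X i) = unif_sphere"
    and f: "inj_on f I" "f \<in> I \<rightarrow> J" and E: "E \<in> sets (PiM I (\<lambda>_. unif_sphere))"
  shows "{\<omega> \<in> space M. (\<lambda>i\<in>I. X (f i) \<omega>) \<in> E} \<in> events"
    and "prob {\<omega> \<in> space M. (\<lambda>i\<in>I. X (f i) \<omega>) \<in> E} = measure (PiM I (\<lambda>_. unif_sphere)) E"
proof -
  have m: "(\<lambda>\<omega>. \<lambda>i\<in>I. X (f i) \<omega>) \<in> measurable M (PiM I (\<lambda>_. borel))"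
    using X(1) f(2) by (intro measurable_restrict) auto
  have "sets (PiM I (\<lambda>_. unif_sphere)) = sets (PiM I (\<lambda>_. borel :: (real^'k) measure))"
    by (intro sets_PiM_cong) auto
  then have E': "E \<in> sets (PiM I (\<lambda>_. borel))" using E by simp
  have v: "(\<lambda>\<omega>. \<lambda>i\<in>I. X (f i) \<omega>) -` E \<inter> space M = {\<omega> \<in> space M. (\<lambda>i\<in>I. X (f i) \<omega>) \<in> E}" by auto
  show "{\<omega> \<in> space M. (\<lambda>i\<in>I. X (f i) \<omega>) \<in> E} \<in> events"
    using measurable_sets[OF m E'] unfolding v .
  show "prob {\<omega> \<in> space M. (\<lambda>i\<in>I. X (f i) \<omega>) \<in> E} = measure (PiM I (\<lambda>_. unif_sphere)) E"
    using measure_distr[OF m E'] arg_cong[OF distr_iid_reindex[OF ind J X f], of "\<lambda>N. measure N E"] unfolding v by simp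
qed

lemma matrix_vector_measurable[measurable]: "(\<lambda>x. (A :: real^'n^'m) *v x) \<in> borel_measurable borel"
  by (intro borel_measurable_continuous_onI matrix_vector_mult_linear_continuous_on)

lemma (in prob_space) unif_sphere_in_coordinates:
  fixes A :: "real^'k^'m" and X :: "'a \<Rightarrow> real^'m"
  assumes A: "transpose A ** A = mat 1" and [measurable]: "X \<in> borel_measurable M" and d: "distr M borel X = unif_sphere_in A"
  shows "distr M borel (\<lambda>\<omega>. transpose A *v X \<omega>) = unif_sphere"
    and "AE \<omega> in M. X \<omega> = A *v (transpose A *v X \<omega>) \<and> norm (transpose A *v X \<omega>) = 1"
proof -
  have "distr M borel (\<lambda>\<omega>. transpose A *v X \<omega>) = distr (distr M borel X) borel (\<lambda>x. transpose A *v x)"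
    by (subst distr_distr) (auto simp: comp_def)
  also have "\<dots> = distr unif_sphere borel (\<lambda>x. x)"
    unfolding d unif_sphere_in_def by (subst distr_distr) (auto simp: comp_def isometry_inner(3)[OF A])
  also have "\<dots> = unif_sphere" by (rule distr_id2) simp
  finally show "distr M borel (\<lambda>\<omega>. transpose A *v X \<omega>) = unif_sphere" .
  have "AE x in distr M borel X. x = A *v (transpose A *v x) \<and> norm (transpose A *v x) = 1"
    unfolding d unif_sphere_in_def
    by (subst AE_distr_iff) (use AE_unif_sphere_norm in \<open>auto simp: isometry_inner(3)[OF A]\<close>)
  then show "AE \<omega> in M. X \<omega> = A *v (transpose A *v X \<omega>) \<and> norm (transpose A *v X \<omega>) = 1"
    by (subst (asm) AE_distr_iff) auto
qed

context good_data
begin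

text \<open>Here \<open>b\<close>, \<open>z\<close>, \<open>X\<close> stand for the leading term, the two deviation terms and the \<open>\<eta>\<close>-term of
  condition (ii). Since \<open>chi \<ge> 1 / offset\<close> by orthogonality of the optimal points to the inliers,
  condition (iii) bounds \<open>b + sqrt offset * z\<close> even though it contains only \<open>sqrt chi\<close>.\<close>

lemma separation:
  assumes opt: "\<And>j. j < M2 \<Longrightarrow> opt_point M2 D j (c j)" and nz: "0 \<le> nz" and b: "0 \<le> b" "0 \<le> z" "0 \<le> X"
    and ii: "2 * \<kappa> / (offset / s) * (b + z + X + nz) < \<A>"
    and iii: "(Max ((\<lambda>j. norm (c j)) ` {..<n_o}) * b + sqrt (Max ((\<lambda>j. norm (c j)) ` {..<n_o})) * z) * s < \<A>"
    and N2: "S + 1 + T \<le> 2 * (b + z + X)"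
    and N1: "1 + T \<le> 2 * \<kappa> * (b + z + X) \<or> 1 + T \<le> b + sqrt offset * z"
  shows "0 < \<A>"
    and "\<And>i j. i \<in> {n_o..<M2} \<Longrightarrow> j < n_o \<Longrightarrow> innov_value M2 D c i < innov_value M2 D c j"
proof -
  define ch where "ch = Max ((\<lambda>j. norm (c j)) ` {..<n_o})"
  have k0: "0 \<le> \<kappa>" and s0: "0 \<le> s" by (rule spec_norm_nonneg)+
  have r1: "1 \<le> ratio" by (rule ratio_ge_1)
  have kr: "2 * \<kappa> / (offset / s) = 2 * \<kappa> * ratio" by (simp add: ratio_def)
  have kr0: "0 \<le> 2 * \<kappa> * ratio" using k0 r1 by simp
  have ii': "ratio * (2 * \<kappa> * (b + z + X)) < \<A>"
  proof -
    have "2 * \<kappa> * ratio * (b + z + X) \<le> 2 * \<kappa> * ratio * (b + z + X + nz)" using kr0 nz by (intro mult_left_mono) auto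
    then show ?thesis using ii unfolding kr by (simp add: mult_ac)
  qed
  have "0 \<le> ratio * (2 * \<kappa> * (b + z + X))" using r1 k0 b by simp
  then show A: "0 < \<A>" using ii' by linarith
  \<comment> \<open>Since \<open>ratio\<close> is at least 1 it may multiply \<open>S\<close> too,
    which brings the sum into the form covered by \<open>ii'\<close>.\<close>
  have "\<kappa> * (S + ratio * (1 + T)) \<le> \<kappa> * (ratio * (S + 1 + T))"
  proof (rule mult_left_mono[OF _ k0])
    have "1 * S \<le> ratio * S" using r1 S_nonneg by (intro mult_right_mono) auto
    then show "S + ratio * (1 + T) \<le> ratio * (S + 1 + T)" by (simp add: algebra_simps)
  qed
  also have "\<dots> \<le> \<kappa> * (ratio * (2 * (b + z + X)))" using N2 k0 r1 by (intro mult_left_mono) auto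
  also have "\<dots> = ratio * (2 * \<kappa> * (b + z + X))" by simp
  also have "\<dots> < \<A>" by (rule ii')
  finally have orth: "\<kappa> * (S + ratio * (1 + T)) < \<A>" .
  have chi: "1 / offset \<le> ch"
  proof -
    obtain j where j: "j < n_o" "offset = norm (transpose W *v D j)" by (rule offset_attained)
    have o: "opt_point M2 D j (c j)" using j by (intro opt) simp
    have "1 \<le> norm (c j) * offset" unfolding j(2)
      by (rule outlier_opt_norm[OF j(1) o outlier_opt_orthogonal[OF j(1) o orth]])
    then have "1 / offset \<le> norm (c j)" using offset_pos by (simp add: field_simps)
    also have "\<dots> \<le> ch" unfolding ch_def using j(1) by (intro Max_ge) auto
    finally show ?thesis .
  qed
  have low: "ratio * (1 + T) < \<A>"
    using N1
  proof
    assume "1 + T \<le> 2 * \<kappa> * (b + z + X)"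
    then have "ratio * (1 + T) \<le> ratio * (2 * \<kappa> * (b + z + X))" using r1 by (intro mult_left_mono) auto
    then show ?thesis using ii' by linarith
  next
    assume "1 + T \<le> b + sqrt offset * z"
    then have "ratio * (1 + T) \<le> ratio * (b + sqrt offset * z)" using r1 by (intro mult_left_mono) auto
    also have "\<dots> = (1 / offset * b + sqrt (1 / offset) * z) * s"
    proof -
      \<comment> \<open>Here sqrt offset is traded for sqrt chi: division by the offset leaves sqrt
        (1 / offset), to which the lower bound on \<open>chi\<close> applies.\<close>
      have "sqrt offset / offset = sqrt (1 / offset)" using offset_pos by (simp add: real_sqrt_divide real_div_sqrt field_simps)
      then have 1: "ratio * (sqrt offset * z) = sqrt (1 / offset) * z * s" unfolding ratio_def by (metis mult.assoc mult.commute times_divide_eq_left)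
      have 2: "ratio * b = 1 / offset * b * s" by (simp add: ratio_def)
      show ?thesis unfolding distrib_left distrib_right 1 2 ..
    qed
    also have "\<dots> \<le> (ch * b + sqrt ch * z) * s"
      using chi b s0 by (intro mult_right_mono add_mono) auto
    also have "\<dots> < \<A>" using iii by (simp add: ch_def)
    finally show ?thesis .
  qed
  fix i j assume i: "i \<in> {n_o..<M2}" and j: "j < n_o"
  have ci: "c i \<bullet> D i = 1" using opt[of i] i by (simp add: opt_point_def)
  have "\<A> \<le> l1obj M2 D (c i)" using i A ci by (intro inlier_objective) auto
  moreover have oj: "opt_point M2 D j (c j)" using j by (intro opt) simp
  have "l1obj M2 D (c j) \<le> ratio * (1 + T)" by (rule outlier_objective[OF j oj])
  moreover have "1 \<le> l1obj M2 D (c j)" using j oj by (intro opt_objective_ge_1[of j]) auto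
  ultimately show "innov_value M2 D c i < innov_value M2 D c j"
    unfolding innov_value_def using low by (intro divide_strict_left_mono) (auto intro: mult_pos_pos)
qed

end

text \<open>Each of three events fails with probability at most \<delta>: lower permeance of the
  inliers, upper permeance of the outliers, and the fixed direction bounds, each at level \<delta> /
  n_o and joined over all outliers. The cap n_o - 1 is the trivial bound for a sum of n_o - 1 inner
  products of vectors of norm at most 1.\<close>

lemma (in prob_space) good_event:
  fixes U :: "real^'r^'m" and W :: "real^'q^'m" and Uo :: "real^'ro^'m"
    and d :: "nat \<Rightarrow> 'a \<Rightarrow> real^'m"
  assumes \<delta>: "0 < \<delta>" "\<delta> < 1" and r: "CARD('r) \<ge> 2" and n_o: "1 \<le> n_o" and l: "0 < l"
    and frames: "orthogonal_frames U W Uo" and not_sub: "\<not> span (columns Uo) \<subseteq> span (columns U)"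
    and dm: "\<And>i. i < n_o + n_i \<Longrightarrow> d i \<in> borel_measurable M"
    and ind: "indep_vars (\<lambda>_. borel) d {..<n_o + n_i}"
    and out: "\<And>i. i < n_o \<Longrightarrow> distr M borel (d i) = unif_sphere_in Uo"
    and inl: "\<And>i. n_o \<le> i \<Longrightarrow> i < n_o + n_i \<Longrightarrow> distr M borel (d i) = unif_sphere_in U"
  shows "\<exists>E\<in>events. 1 - 3 * \<delta> \<le> prob E \<and> (\<forall>\<omega>\<in>E. good_data U W Uo (\<lambda>i. d i \<omega>) n_o n_i
      (sqrt (2 / pi) * n_i / sqrt (real CARD('r)) - 2 * sqrt (real n_i) - sqrt (2 * real n_i * ln (1 / \<delta>) / (real CARD('r) - 1)))
      (n_o / sqrt (real CARD('ro)) + sqrt (8 * real n_o + 16 * real n_o * ln (1 / \<delta>) / real CARD('ro)))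
      (min ((ln (1 / \<delta>) + ln n_o + (real n_o - 1) * ln (2 * exp (l\<^sup>2/2) - exp (- l))) / (l * sqrt (real CARD('ro)))) (real n_o - 1)))"
proof -
  interpret orthogonal_frames U W Uo by (rule frames)
  interpret I: iid_vectors "unif_sphere :: (real^'r) measure" clip by (rule iid_vectors_unif_sphere)
  interpret O: iid_vectors "unif_sphere :: (real^'ro) measure" clip by (rule iid_vectors_unif_sphere)
  define a where "a i \<omega> = transpose U *v d i \<omega>" for i \<omega>
  define z where "z i \<omega> = transpose Uo *v d i \<omega>" for i \<omega>
  define \<A> where "\<A> = sqrt (2 / pi) * n_i / sqrt (real CARD('r)) - 2 * sqrt (real n_i) - sqrt (2 * real n_i * ln (1 / \<delta>) / (real CARD('r) - 1))"
  define S where "S = n_o / sqrt (real CARD('ro)) + sqrt (8 * real n_o + 16 * real n_o * ln (1 / \<delta>) / real CARD('ro))"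
  define T0 where "T0 = (ln (1 / \<delta>) + ln n_o + (real n_o - 1) * ln (2 * exp (l\<^sup>2/2) - exp (- l))) / (l * sqrt (real CARD('ro)))"
  let ?In = "{n_o..<n_o + n_i}"
  have L0: "0 \<le> ln (1 / \<delta>)" using \<delta> by simp
  have am: "a i \<in> borel_measurable M" if "i \<in> ?In" for i
    unfolding a_def using measurable_compose[OF dm[of i] matrix_vector_measurable] that by simp
  have zm: "z i \<in> borel_measurable M" if "i \<in> {..<n_o}" for i
    unfolding z_def using measurable_compose[OF dm[of i] matrix_vector_measurable] that by simp
  have ad: "distr M borel (a i) = unif_sphere" if "i \<in> ?In" for i
    unfolding a_def using that by (intro unif_sphere_in_coordinates(1)[OF U] dm inl) auto
  have zd: "distr M borel (z i) = unif_sphere" if "i \<in> {..<n_o}" for i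
    unfolding z_def using that by (intro unif_sphere_in_coordinates(1)[OF Uo] dm out) auto
  have aind: "indep_vars (\<lambda>_. borel) a ?In"
    unfolding a_def by (rule indep_vars_compose2[OF indep_vars_subset[OF ind]]) auto
  have zind: "indep_vars (\<lambda>_. borel) z {..<n_o}"
    unfolding z_def by (rule indep_vars_compose2[OF indep_vars_subset[OF ind]]) auto

  have AEi: "AE \<omega> in M. d i \<omega> = U *v (transpose U *v d i \<omega>) \<and> norm (transpose U *v d i \<omega>) = 1" if "i \<in> ?In" for i
    using that by (intro unif_sphere_in_coordinates(2)[OF U] dm inl) auto
  have AEo: "AE \<omega> in M. d i \<omega> = Uo *v (transpose Uo *v d i \<omega>) \<and> norm (transpose Uo *v d i \<omega>) = 1" if "i \<in> {..<n_o}" for i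
    using that by (intro unif_sphere_in_coordinates(2)[OF Uo] dm out) auto
  have AEw: "AE \<omega> in M. transpose W *v d i \<omega> \<noteq> 0" if i: "i \<in> {..<n_o}" for i
  proof -
    define V where "V = {x :: real^'ro. transpose W *v (Uo *v x) = 0}"
    have V: "subspace V" unfolding V_def subspace_def
      by (auto simp: matrix_vector_right_distrib matrix_vector_mult_scaleR)
    have "V \<noteq> UNIV"
    proof
      assume "V = UNIV"
      then have "Uo *v x \<in> span (columns U)" for x unfolding in_span_U_iff V_def by auto
      then have "span (columns Uo) \<subseteq> span (columns U)" unfolding span_columns[of Uo] by auto
      then show False using not_sub by simp
    qed
    then have "AE x in unif_sphere. x \<notin> V" by (rule AE_unif_sphere_not_in_subspace[OF V])
    then have "AE x in unif_sphere. transpose W *v (Uo *v x) \<noteq> 0" by (simp add: V_def)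
    then have "AE x in distr M borel (d i). transpose W *v x \<noteq> 0"
      unfolding out[OF i[unfolded lessThan_iff]] unif_sphere_in_def by (subst AE_distr_iff) auto
    then show ?thesis using i by (subst (asm) AE_distr_iff) (auto intro: dm)
  qed
  \<comment> \<open>The almost sure part: every column is a unit vector of its subspace, and no
    outlier lies in the inlier subspace.\<close>
  define G where "G = {\<omega> \<in> space M. (\<forall>i\<in>?In. d i \<omega> = U *v (transpose U *v d i \<omega>) \<and> norm (transpose U *v d i \<omega>) = 1)
      \<and> (\<forall>i\<in>{..<n_o}. d i \<omega> = Uo *v (transpose Uo *v d i \<omega>) \<and> norm (transpose Uo *v d i \<omega>) = 1)
      \<and> (\<forall>i\<in>{..<n_o}. transpose W *v d i \<omega> \<noteq> 0)}"
  have dm'[measurable]: "d i \<in> borel_measurable M" if "i \<in> ?In \<or> i \<in> {..<n_o}" for i using that by (intro dm) auto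
  have Gm: "G \<in> events" unfolding G_def
  proof (intro sets.sets_Collect_conj sets.sets_Collect_finite_All)
    fix i assume i: "i \<in> ?In"
    have [measurable]: "d i \<in> borel_measurable M" using i by (intro dm) auto
    show "{\<omega> \<in> space M. d i \<omega> = U *v (transpose U *v d i \<omega>)} \<in> events" by measurable
    show "{\<omega> \<in> space M. norm (transpose U *v d i \<omega>) = 1} \<in> events" by measurable
  next
    fix i assume i: "i \<in> {..<n_o}"
    have [measurable]: "d i \<in> borel_measurable M" using i by (intro dm) auto
    show "{\<omega> \<in> space M. d i \<omega> = Uo *v (transpose Uo *v d i \<omega>)} \<in> events" by measurable
    show "{\<omega> \<in> space M. norm (transpose Uo *v d i \<omega>) = 1} \<in> events" by measurable
    show "{\<omega> \<in> space M. transpose W *v d i \<omega> \<noteq> 0} \<in> events" by measurable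
  qed auto
  have G1: "prob G = 1"
  proof -
    have "AE \<omega> in M. (\<forall>i\<in>?In. d i \<omega> = U *v (transpose U *v d i \<omega>) \<and> norm (transpose U *v d i \<omega>) = 1)
      \<and> (\<forall>i\<in>{..<n_o}. d i \<omega> = Uo *v (transpose Uo *v d i \<omega>) \<and> norm (transpose Uo *v d i \<omega>) = 1)
      \<and> (\<forall>i\<in>{..<n_o}. transpose W *v d i \<omega> \<noteq> 0)"
      using AEi AEo AEw by (intro AE_conjI AE_finite_allI) auto
    then have "AE \<omega> in M. \<omega> \<in> G" unfolding G_def by (auto elim: AE_mp)
    then show ?thesis using Gm by (simp add: prob_eq_1)
  qed

  obtain A1 where A1: "A1 \<in> events" "1 - \<delta> \<le> prob A1"
    "\<And>\<omega> u. \<omega> \<in> A1 \<Longrightarrow> norm u = 1 \<Longrightarrow> \<A> \<le> (\<Sum>i\<in>?In. \<bar>u \<bullet> clip (a i \<omega>)\<bar>)"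
  proof (cases "n_i = 0")
    \<comment> \<open>Without inliers both \<A> and the sum are 0.\<close>
    case True
    then show ?thesis using \<delta> by (intro that[of "space M"]) (auto simp: \<A>_def prob_space)
  next
    case False
    let ?t = "sqrt (2 * real n_i * ln (1/\<delta>) / real CARD('r))"
    obtain E where E: "E \<in> sets (PiM {..<n_i} (\<lambda>_. unif_sphere :: (real^'r) measure))" "1 - \<delta> \<le> measure (PiM {..<n_i} (\<lambda>_. unif_sphere)) E"
      "\<And>x u. x \<in> E \<Longrightarrow> norm u = 1 \<Longrightarrow> n_i * (sqrt (2 / pi) / sqrt (real CARD('r))) - 2 * sqrt (real n_i) - ?t \<le> (\<Sum>i<n_i. \<bar>u \<bullet> clip (x i)\<bar>)"
      using I.permeance_lower_bound[OF _ \<delta> mean_abs_unif_sphere, of n_i] False by auto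
    have f: "inj_on ((+) n_o) {..<n_i}" "(+) n_o \<in> {..<n_i} \<rightarrow> ?In" by auto
    have J: "?In \<noteq> {}" using False by auto
    note ev = iid_event[OF aind J am ad f E(1)]
    show ?thesis
    proof (rule that[OF ev(1)])
      show "1 - \<delta> \<le> prob {\<omega> \<in> space M. (\<lambda>i\<in>{..<n_i}. a (n_o + i) \<omega>) \<in> E}" using ev(2) E(2) by simp
      fix \<omega> and u :: "real^'r" assume w: "\<omega> \<in> {\<omega> \<in> space M. (\<lambda>i\<in>{..<n_i}. a (n_o + i) \<omega>) \<in> E}" and u: "norm u = 1"
      have mem: "(\<lambda>i\<in>{..<n_i}. a (n_o + i) \<omega>) \<in> E" using w by simp
      have eq: "n_i * (sqrt (2 / pi) / sqrt (real CARD('r))) = sqrt (2 / pi) * n_i / sqrt (real CARD('r))" by simp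
      have "?t \<le> sqrt (2 * real n_i * ln (1/\<delta>) / (real CARD('r) - 1))"
        using r L0 by (intro real_sqrt_le_mono divide_left_mono) auto
      then have "\<A> \<le> (\<Sum>i<n_i. \<bar>u \<bullet> clip ((\<lambda>i\<in>{..<n_i}. a (n_o + i) \<omega>) i)\<bar>)"
        using E(3)[OF mem u] unfolding \<A>_def eq by linarith
      also have "\<dots> = (\<Sum>i<n_i. \<bar>u \<bullet> clip (a (n_o + i) \<omega>)\<bar>)" by (intro sum.cong) auto
      also have "\<dots> = (\<Sum>i\<in>?In. \<bar>u \<bullet> clip (a i \<omega>)\<bar>)"
        by (rule sum.reindex_bij_witness[of _ "\<lambda>i. i - n_o" "\<lambda>i. n_o + i"]) auto
      finally show "\<A> \<le> (\<Sum>i\<in>?In. \<bar>u \<bullet> clip (a i \<omega>)\<bar>)" .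
    qed
  qed

  have J: "{..<n_o} \<noteq> {}" using n_o by (auto simp: lessThan_empty_iff)
  have f: "inj_on (\<lambda>i. i) {..<n_o}" "(\<lambda>i. i) \<in> {..<n_o} \<rightarrow> {..<n_o}" by auto
  obtain A2 where A2: "A2 \<in> events" "1 - \<delta> \<le> prob A2"
    "\<And>\<omega> u. \<omega> \<in> A2 \<Longrightarrow> norm u = 1 \<Longrightarrow> (\<Sum>i<n_o. \<bar>u \<bullet> clip (z i \<omega>)\<bar>) \<le> S"
  proof -
    obtain E where E: "E \<in> sets (PiM {..<n_o} (\<lambda>_. unif_sphere :: (real^'ro) measure))" "1 - \<delta> \<le> measure (PiM {..<n_o} (\<lambda>_. unif_sphere)) E"
      "\<And>x u. x \<in> E \<Longrightarrow> norm u = 1 \<Longrightarrow> (\<Sum>i<n_o. \<bar>u \<bullet> clip (x i)\<bar>) \<le> real n_o / sqrt (real CARD('ro)) + sqrt (8 * real n_o + 16 * real n_o * ln (1/\<delta>) / real CARD('ro))"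
      using O.permeance_upper_bound[OF _ \<delta>, of n_o] n_o by auto
    note ev = iid_event[OF zind J zm zd f E(1)]
    show ?thesis
    proof (rule that[OF ev(1)])
      show "1 - \<delta> \<le> prob {\<omega> \<in> space M. (\<lambda>i\<in>{..<n_o}. z i \<omega>) \<in> E}" using ev(2) E(2) by simp
      fix \<omega> and u :: "real^'ro" assume w: "\<omega> \<in> {\<omega> \<in> space M. (\<lambda>i\<in>{..<n_o}. z i \<omega>) \<in> E}" and u: "norm u = 1"
      have "(\<Sum>i<n_o. \<bar>u \<bullet> clip (z i \<omega>)\<bar>) = (\<Sum>i<n_o. \<bar>u \<bullet> clip ((\<lambda>i\<in>{..<n_o}. z i \<omega>) i)\<bar>)" by (intro sum.cong) auto
      also have "\<dots> \<le> S" using E(3)[of "\<lambda>i\<in>{..<n_o}. z i \<omega>" u] w u by (simp add: S_def)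
      finally show "(\<Sum>i<n_o. \<bar>u \<bullet> clip (z i \<omega>)\<bar>) \<le> S" .
    qed
  qed

  \<comment> \<open>The direction of \<open>fixed\<close> as a function of the coordinates of one
    outlier, so that it is independent of the other outliers. Where its argument vanishes,
    \<open>direction\<close> gives 0.\<close>
  define V where "V x = direction (transpose Uo *v proj (Uo *v x))" for x
  have Vm[measurable]: "V \<in> borel_measurable borel"
    unfolding V_def proj_def by measurable
  have V1: "norm (V x) \<le> 1" for x
    by (cases "transpose Uo *v proj (Uo *v x) = 0") (simp_all add: V_def)
  define B where "B j = {\<omega> \<in> space M. T0 \<le> (\<Sum>i\<in>{..<n_o}-{j}. \<bar>V (z j \<omega>) \<bullet> clip (z i \<omega>)\<bar>)}" for j
  have B: "B j \<in> events" "prob (B j) \<le> \<delta> / n_o" if j: "j < n_o" for j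
  proof -
    let ?P = "PiM {..<n_o} (\<lambda>_. unif_sphere :: (real^'ro) measure)"
    define E where "E = {x \<in> space ?P. T0 \<le> (\<Sum>i\<in>{..<n_o}-{j}. \<bar>V (x j) \<bullet> clip (x i)\<bar>)}"
    have [measurable]: "(\<lambda>x. V (x j)) \<in> borel_measurable ?P"
      by (rule measurable_compose[OF measurable_component_singleton[of j "{..<n_o}" "\<lambda>_. unif_sphere"]]) (use j in auto)
    have Em: "E \<in> sets ?P" unfolding E_def by measurable
    \<comment> \<open>The level ln (1 / \<delta>) + ln n_o corresponds to failure probability
      \<delta> / n_o.\<close>
    have meas: "measure ?P E \<le> exp (- (ln (1 / \<delta>) + ln n_o))"
      unfolding E_def T0_def by (rule O.fixed_direction_deviation[OF _ V1 l j]) measurable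
    have "exp (- (ln (1 / \<delta>) + ln n_o)) = \<delta> / n_o"
      using \<delta> n_o by (simp add: ln_div exp_diff exp_minus field_simps)
    note meas' = meas[unfolded this]
    note ev = iid_event[OF zind J zm zd f Em]
    have "{\<omega> \<in> space M. (\<lambda>i\<in>{..<n_o}. z i \<omega>) \<in> E} = B j"
    proof -
      have "(\<Sum>i\<in>{..<n_o}-{j}. \<bar>V ((\<lambda>i\<in>{..<n_o}. z i \<omega>) j) \<bullet> clip ((\<lambda>i\<in>{..<n_o}. z i \<omega>) i)\<bar>) = (\<Sum>i\<in>{..<n_o}-{j}. \<bar>V (z j \<omega>) \<bullet> clip (z i \<omega>)\<bar>)" for \<omega>
        using j by (intro sum.cong) auto
      then show ?thesis unfolding E_def B_def by (auto simp: space_PiM)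
    qed
    then show "B j \<in> events" "prob (B j) \<le> \<delta> / n_o" using ev meas' by auto
  qed
  define BB where "BB = (\<Union>j\<in>{..<n_o}. B j)"
  have BBm: "BB \<in> events" unfolding BB_def using B(1) by (intro sets.finite_UN) auto
  have BBp: "prob BB \<le> \<delta>"
  proof -
    have "prob BB \<le> (\<Sum>j<n_o. prob (B j))" unfolding BB_def
      using B(1) by (intro finite_measure_subadditive_finite) auto
    also have "\<dots> \<le> (\<Sum>j<n_o. \<delta> / n_o)" using B(2) by (intro sum_mono) auto
    also have "\<dots> = \<delta>" using n_o by simp
    finally show ?thesis .
  qed

  define E where "E = G \<inter> (A1 \<inter> (A2 \<inter> (space M - BB)))"
  have Em: "E \<in> events" unfolding E_def using Gm A1 A2 BBm by auto
  have both: "prob A + prob C - 1 \<le> prob (A \<inter> C)" if "A \<in> events" "C \<in> events" for A C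
  proof -
    have "prob A - prob (A \<inter> C) = prob (A - C)" using that by (simp add: finite_measure_Diff')
    also have "\<dots> \<le> prob (space M - C)"
      using that sets.sets_into_space[OF that(1)] by (intro finite_measure_mono) auto
    also have "\<dots> = 1 - prob C" by (rule prob_compl[OF that(2)])
    finally show ?thesis by linarith
  qed
  have "1 - 3 * \<delta> \<le> prob E"
  proof -
    have "1 - \<delta> \<le> prob (space M - BB)" using prob_compl[OF BBm] BBp by simp
    then have "1 - 2 * \<delta> \<le> prob (A2 \<inter> (space M - BB))" using both[of A2 "space M - BB"] A2 BBm by auto
    then have "1 - 3 * \<delta> \<le> prob (A1 \<inter> (A2 \<inter> (space M - BB)))" using both[of A1 "A2 \<inter> (space M - BB)"] A1 A2 BBm by auto
    then show ?thesis unfolding E_def using both[of G "A1 \<inter> (A2 \<inter> (space M - BB))"] G1 Gm A1 A2 BBm by auto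
  qed
  moreover have "good_data U W Uo (\<lambda>i. d i \<omega>) n_o n_i \<A> S (min T0 (real n_o - 1))" if w: "\<omega> \<in> E" for \<omega>
  proof
    have g: "\<omega> \<in> G" "\<omega> \<in> A1" "\<omega> \<in> A2" "\<omega> \<notin> BB" "\<omega> \<in> space M"
      using w sets.sets_into_space[OF Gm] by (auto simp: E_def)
    have no: "d i \<omega> = Uo *v z i \<omega>" "norm (z i \<omega>) = 1" "transpose W *v d i \<omega> \<noteq> 0" if "i < n_o" for i
      using g(1) that unfolding G_def z_def by auto
    have ni: "d i \<omega> = U *v a i \<omega>" "norm (a i \<omega>) = 1" if "n_o \<le> i" "i < n_o + n_i" for i
      using g(1) that unfolding G_def a_def by auto
    show "1 \<le> n_o" by (rule n_o)
    show "d i \<omega> = Uo *v (transpose Uo *v d i \<omega>)" if "i < n_o" for i using no(1)[OF that] by (simp add: z_def)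
    show "norm (transpose Uo *v d i \<omega>) = 1" if "i < n_o" for i using no(2)[OF that] by (simp add: z_def)
    show "transpose W *v d i \<omega> \<noteq> 0" if "i < n_o" for i using no(3)[OF that] .
    show "d i \<omega> = U *v (transpose U *v d i \<omega>)" if "n_o \<le> i" "i < n_o + n_i" for i using ni(1)[OF that] by (simp add: a_def)
    show "norm (transpose U *v d i \<omega>) = 1" if "n_o \<le> i" "i < n_o + n_i" for i using ni(2)[OF that] by (simp add: a_def)
    show "\<A> \<le> (\<Sum>i\<in>?In. \<bar>u \<bullet> (transpose U *v d i \<omega>)\<bar>)" if "norm u = 1" for u
    proof -
      have "(\<Sum>i\<in>?In. \<bar>u \<bullet> clip (a i \<omega>)\<bar>) = (\<Sum>i\<in>?In. \<bar>u \<bullet> (transpose U *v d i \<omega>)\<bar>)"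
        using ni(2) by (intro sum.cong) (auto simp: a_def)
      then show ?thesis using A1(3)[OF g(2) that] by simp
    qed
    show "(\<Sum>i<n_o. \<bar>u \<bullet> (transpose Uo *v d i \<omega>)\<bar>) \<le> S" if "norm u = 1" for u
    proof -
      have "(\<Sum>i<n_o. \<bar>u \<bullet> clip (z i \<omega>)\<bar>) = (\<Sum>i<n_o. \<bar>u \<bullet> (transpose Uo *v d i \<omega>)\<bar>)"
        using no(2) by (intro sum.cong) (auto simp: z_def)
      then show ?thesis using A2(3)[OF g(3) that] by simp
    qed
    show "(\<Sum>i\<in>{..<n_o}-{j}. \<bar>direction (transpose Uo *v proj (d j \<omega>)) \<bullet> (transpose Uo *v d i \<omega>)\<bar>) \<le> min T0 (real n_o - 1)"
      if j: "j < n_o" for j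
    proof -
      have "(\<Sum>i\<in>{..<n_o}-{j}. \<bar>direction (transpose Uo *v proj (d j \<omega>)) \<bullet> (transpose Uo *v d i \<omega>)\<bar>) = (\<Sum>i\<in>{..<n_o}-{j}. \<bar>V (z j \<omega>) \<bullet> clip (z i \<omega>)\<bar>)"
        using no(2) no(1)[OF j] by (intro sum.cong) (auto simp: V_def z_def)
      moreover have "(\<Sum>i\<in>{..<n_o}-{j}. \<bar>V (z j \<omega>) \<bullet> clip (z i \<omega>)\<bar>) \<le> T0"
        using g(4,5) j by (auto simp: BB_def B_def not_le intro!: less_imp_le)
      moreover have "(\<Sum>i\<in>{..<n_o}-{j}. \<bar>V (z j \<omega>) \<bullet> clip (z i \<omega>)\<bar>) \<le> (\<Sum>i\<in>{..<n_o}-{j}. 1)"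
        using O.inner_p[of "V (z j \<omega>)"] V1[of "z j \<omega>"] by (intro sum_mono) (auto intro: order_trans)
      moreover have "(\<Sum>i\<in>{..<n_o}-{j}. 1 :: real) = real n_o - 1" using j by (simp add: of_nat_diff)
      ultimately show ?thesis by simp
    qed
  qed
  ultimately show ?thesis using Em unfolding \<A>_def S_def T0_def by blast
qed

section \<open>Exact recovery\<close>

lemma three_halves_le_ln_5: "3/2 \<le> ln (5::real)"
proof -
  have "exp (3/2 :: real) = exp 1 * exp (1/2)" by (simp add: exp_add[symmetric])
  also have "\<dots> \<le> 275/100 * (1 + 1/2 + (1/2)\<^sup>2)"
    using exp_one_bounds(2) exp_le_quadratic_half[of "1/2"] by (intro mult_mono) auto
  also have "\<dots> \<le> 5" by (simp add: power2_eq_square)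
  finally have "ln (exp (3/2)) \<le> ln (5::real)" by (subst ln_le_cancel_iff) auto
  then show ?thesis by simp
qed

theorem theorem3:
  fixes M :: "'w measure"
    and U :: "real^'r^'m" and Uperp :: "real^'q^'m" and Uo :: "real^'ro^'m"
    and d :: "nat \<Rightarrow> 'w \<Rightarrow> real^'m"
    and n_o n_i :: nat and \<delta> :: real
  assumes "prob_space M"
    and "0 < \<delta>" "\<delta> < 1"
    and "CARD('r) \<ge> 2" "CARD('ro) \<ge> 2" "n_o \<ge> 1"
    and "transpose U ** U = mat 1"
    and "transpose Uperp ** Uperp = mat 1"
    and "span (columns Uperp) = {x. \<forall>u\<in>span (columns U). x \<bullet> u = 0}"
    and "transpose Uo ** Uo = mat 1"
    and "\<not> span (columns Uo) \<subseteq> span (columns U)"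
    and "\<not> span (columns U) \<subseteq> span (columns Uo)"
    and "\<And>i. i < n_o + n_i \<Longrightarrow> d i \<in> borel_measurable M"
    and "prob_space.indep_vars M (\<lambda>_. borel) d {..<n_o + n_i}"
    and "\<And>i. i < n_o \<Longrightarrow> distr M borel (d i) = unif_sphere_in Uo"
    and "\<And>i. n_o \<le> i \<Longrightarrow> i < n_o + n_i \<Longrightarrow> distr M borel (d i) = unif_sphere_in U"
  shows "\<exists>E \<in> sets M. measure M E \<ge> 1 - 5 * \<delta> \<and>
    (\<forall>\<omega>\<in>E.
      let M2 = n_o + n_i; D = (\<lambda>i. d i \<omega>);
          r = real CARD('r); ro = real CARD('ro);
          nO = real n_o; nI = real n_i;
          nUUo = spec_norm (transpose U ** Uo);
          nUoUp = spec_norm (transpose Uo ** Uperp);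
          \<xi> = Min ((\<lambda>j. norm (transpose Uperp *v D j)) ` {..<n_o}) / nUoUp;
          \<eta> = max (4/3 * ln (2 * ro / \<delta>)) (sqrt (4 * nO / ro * ln (2 * ro / \<delta>)));
          \<A> = sqrt (2 / pi) * nI / sqrt r - 2 * sqrt nI - sqrt (2 * nI * ln (1 / \<delta>) / (r - 1))
      in (\<forall>j<M2. \<exists>c. opt_point M2 D j c) \<and>
         (\<forall>c :: nat \<Rightarrow> real^'m.
            let chi = Max ((\<lambda>j. norm (c j)) ` {..<n_o});
                nz = real (Max ((\<lambda>j. card {i. i < n_o \<and> c j \<bullet> D i = 0}) ` {..<n_o}))
            in ((\<forall>j<M2. opt_point M2 D j (c j))
                \<and> \<A> > 2 * nz * nUUo + 2 * nUUo * sqrt (nO * ln (nO / \<delta>))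
                \<and> \<A> > 2 * nUUo / \<xi> * (nO / sqrt ro + 2 * sqrt nO
                        + sqrt (2 * nO * ln (1 / \<delta>) / (ro - 1))
                        + 2 * sqrt ((nO / ro + \<eta>) * ln (nO / \<delta>)) + nz)
                \<and> \<A> > (chi * nO / sqrt ro + 2 * sqrt (chi * nO)
                        + sqrt (chi * (2 * nO * ln (1 / \<delta>) / (ro - 1)))) * nUoUp)
              \<longrightarrow>
               Max (innov_value M2 D c ` {n_o..<M2}) < Min (innov_value M2 D c ` {..<n_o})
               \<and> (\<forall>\<sigma>. bij_betw \<sigma> {..<M2} {..<M2}
                     \<and> (\<forall>s t. s \<le> t \<and> t < M2 \<longrightarrow> innov_value M2 D c (\<sigma> s) \<le> innov_value M2 D c (\<sigma> t))
                   \<longrightarrow> (\<exists>k\<le>M2. dim (span ((\<lambda>t. D (\<sigma> t)) ` {..<k})) = CARD('r))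
                     \<and> (\<forall>k\<le>M2. dim (span ((\<lambda>t. D (\<sigma> t)) ` {..<k})) = CARD('r)
                          \<longrightarrow> span ((\<lambda>t. D (\<sigma> t)) ` {..<k}) = span (columns U)))))"
proof (cases "5 * \<delta> < 1")
  \<comment> \<open>The required probability is at most 0, so the empty event suffices.\<close>
  case False
  then have "1 - 5 * \<delta> \<le> measure M {}" by simp
  then show ?thesis by (intro bexI[of _ "{}"] conjI ballI) (simp_all only: sets.empty_sets empty_iff)
next
  case small: True
  interpret prob_space M by fact
  have frames: "orthogonal_frames U Uperp Uo" using assms by unfold_locales auto
  define L where "L = ln (1 / \<delta>)"
  \<comment> \<open>From here \<open>r\<close> is the dimension of the outlier subspace; that of the
    inlier subspace stays \<open>CARD('r)\<close>.\<close>
  define r where "r = real CARD('ro)"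
  define \<eta> where "\<eta> = max (4/3 * ln (2 * r / \<delta>)) (sqrt (4 * real n_o / r * ln (2 * r / \<delta>)))"
  define X where "X = 2 * sqrt ((real n_o / r + \<eta>) * ln (real n_o / \<delta>))"
  define z where "z = 2 * sqrt (real n_o) + sqrt (2 * real n_o * L / (r - 1))"
  define S where "S = real n_o / sqrt r + sqrt (8 * real n_o + 16 * real n_o * L / r)"
  have r: "2 \<le> r" using assms(5) by (simp add: r_def)
  have no: "1 \<le> real n_o" using assms(6) by simp
  have L: "3/2 \<le> L"
  proof -
    have "5 \<le> 1 / \<delta>" using small assms(2) by (simp add: field_simps)
    then have "ln 5 \<le> L" unfolding L_def using assms(2) by (subst ln_le_cancel_iff) auto
    then show ?thesis using three_halves_le_ln_5 by linarith
  qed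
  have L': "ln (real n_o / \<delta>) = L + ln (real n_o)" using assms(2) no by (simp add: L_def ln_div)
  have lnn: "0 \<le> ln (real n_o)" using no by simp
  have L2r: "L \<le> ln (2 * r / \<delta>)" unfolding L_def using assms(2) r by (subst ln_le_cancel_iff) (auto simp: field_simps)
  \<comment> \<open>Together with the factor 4 in X^2 this produces the 16/3 demanded by
    \<open>numeric_bounds\<close>.\<close>
  have eta: "4/3 * L \<le> \<eta>" using L2r by (simp add: \<eta>_def le_max_iff_disj)
  have X0: "0 \<le> X" unfolding X_def L' using eta L lnn no r by simp
  have X2: "X\<^sup>2 = 4 * (real n_o / r + \<eta>) * (L + ln (real n_o))"
    unfolding X_def L' using eta L lnn no r by (simp add: power_mult_distrib)
  have X1: "4 * (real n_o / r) * (L + ln (real n_o)) \<le> X\<^sup>2" "16/3 * L * (L + ln (real n_o)) \<le> X\<^sup>2"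
  proof -
    have nn: "0 \<le> L + ln (real n_o)" "0 \<le> real n_o / r" "0 \<le> \<eta>" using L lnn r eta by auto
    show "4 * (real n_o / r) * (L + ln (real n_o)) \<le> X\<^sup>2"
      unfolding X2 using nn by (intro mult_right_mono) simp_all
    have "16/3 * L \<le> 4 * \<eta>" using eta by simp
    also have "\<dots> \<le> 4 * (real n_o / r + \<eta>)" using nn by simp
    finally show "16/3 * L * (L + ln (real n_o)) \<le> X\<^sup>2"
      unfolding X2 using nn by (intro mult_right_mono)
  qed
  \<comment> \<open>The exponent is fixed before the event, because the moment bound behind
    \<open>T\<close> may not depend on the sample. The last property is general in \<open>k\<close>
    and \<open>m\<close> since the offset is known only for a given sample.\<close>
  obtain l where l: "0 < l"
    "\<And>T. T \<le> (L + ln (real n_o) + (real n_o - 1) * ln (2 * exp (l\<^sup>2/2) - exp (- l))) / (l * sqrt r) \<Longrightarrow> T \<le> real n_o - 1 \<Longrightarrow>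
      sqrt (8 * real n_o + 16 * real n_o * L / r) + 1 + T \<le> real n_o / sqrt r + 2 * z + 2 * X"
    "\<And>T k m. T \<le> (L + ln (real n_o) + (real n_o - 1) * ln (2 * exp (l\<^sup>2/2) - exp (- l))) / (l * sqrt r) \<Longrightarrow> T \<le> real n_o - 1 \<Longrightarrow>
      0 \<le> k \<Longrightarrow> 0 \<le> m \<Longrightarrow> m \<le> 1 \<Longrightarrow> 1 - k\<^sup>2 \<le> m\<^sup>2 \<Longrightarrow>
      1 + T \<le> 2 * k * (real n_o / sqrt r + z + X) \<or> 1 + T \<le> real n_o / sqrt r + sqrt m * z"
    using numeric_bounds[OF assms(6) r L X0 X1, folded z_def] by blast
  define T where "T = min ((L + ln (real n_o) + (real n_o - 1) * ln (2 * exp (l\<^sup>2/2) - exp (- l))) / (l * sqrt r)) (real n_o - 1)"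
  define \<A> where "\<A> = sqrt (2 / pi) * real n_i / sqrt (real CARD('r)) - 2 * sqrt (real n_i) - sqrt (2 * real n_i * L / (real CARD('r) - 1))"
  have T: "T \<le> (L + ln (real n_o) + (real n_o - 1) * ln (2 * exp (l\<^sup>2/2) - exp (- l))) / (l * sqrt r)" "T \<le> real n_o - 1"
    by (simp_all add: T_def)
  have N2: "S + 1 + T \<le> 2 * (real n_o / sqrt r + z + X)" using l(2)[OF T] by (simp add: S_def)
  obtain E where E: "E \<in> events" "1 - 3 * \<delta> \<le> prob E"
    and good: "\<And>\<omega>. \<omega> \<in> E \<Longrightarrow> good_data U Uperp Uo (\<lambda>i. d i \<omega>) n_o n_i \<A> S T"
    using good_event[OF assms(2,3,4,6) l(1) frames assms(11,13,14,15,16)]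
    unfolding \<A>_def S_def T_def L_def r_def by blast
  show ?thesis
  proof (intro bexI[of _ E] conjI ballI, goal_cases)
    case 1
    show ?case using E(2) assms(2) by linarith
  next
    case (2 \<omega>)
    define D where "D i = d i \<omega>" for i
    interpret good_data U Uperp Uo D n_o n_i \<A> S T
      using good[OF 2] by (simp add: D_def[abs_def])
    have ex: "\<exists>c. opt_point M2 D j c" if j: "j < M2" for j
    proof (rule opt_point_exists[OF j])
      show "D j \<noteq> 0"
      proof (cases "j < n_o")
        case True
        then show ?thesis using outlier_norm[OF True] by auto
      next
        case False
        then show ?thesis using inlier_norm[of j] j by auto
      qed
    qed
    have main: "Max (innov_value M2 D c ` {n_o..<M2}) < Min (innov_value M2 D c ` {..<n_o})
        \<and> (\<forall>\<sigma>. bij_betw \<sigma> {..<M2} {..<M2}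
              \<and> (\<forall>s t. s \<le> t \<and> t < M2 \<longrightarrow> innov_value M2 D c (\<sigma> s) \<le> innov_value M2 D c (\<sigma> t))
            \<longrightarrow> (\<exists>k\<le>M2. dim (span ((\<lambda>t. D (\<sigma> t)) ` {..<k})) = CARD('r))
              \<and> (\<forall>k\<le>M2. dim (span ((\<lambda>t. D (\<sigma> t)) ` {..<k})) = CARD('r)
                   \<longrightarrow> span ((\<lambda>t. D (\<sigma> t)) ` {..<k}) = span (columns U)))"
      if opt: "\<And>j. j < M2 \<Longrightarrow> opt_point M2 D j (c j)" and nz: "0 \<le> nz"
        and ii: "2 * \<kappa> / (offset / s) * (real n_o / sqrt r + z + X + nz) < \<A>"
        and iii: "(Max ((\<lambda>j. norm (c j)) ` {..<n_o}) * (real n_o / sqrt r) + sqrt (Max ((\<lambda>j. norm (c j)) ` {..<n_o})) * z) * s < \<A>"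
      for c nz
    proof -
      have z0: "0 \<le> z" unfolding z_def using L r by simp
      have b0: "0 \<le> real n_o / sqrt r" using r by simp
      note sep = separation[OF opt nz b0 z0 X0 ii iii N2
          l(3)[OF T spec_norm_nonneg less_imp_le[OF offset_pos] offset_le_1 offset_square]]
      have A: "0 < \<A>" by (rule sep(1))
      have lt: "innov_value M2 D c i < innov_value M2 D c j" if "i \<in> {n_o..<M2}" "j < n_o" for i j
        by (rule sep(2)) (use that in simp_all)
      \<comment> \<open>The maximum over the inliers has to range over a nonempty set.\<close>
      have "n_i \<noteq> 0"
      proof
        assume "n_i = 0"
        then show False using A by (simp add: \<A>_def)
      qed
      then have ne: "{n_o..<M2} \<noteq> {}" "{..<n_o} \<noteq> {}" using n_o by (auto simp: lessThan_empty_iff)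
      have "Max (innov_value M2 D c ` {n_o..<M2}) \<in> innov_value M2 D c ` {n_o..<M2}"
        "Min (innov_value M2 D c ` {..<n_o}) \<in> innov_value M2 D c ` {..<n_o}"
        using ne by (auto intro!: Max_in Min_in)
      then have "Max (innov_value M2 D c ` {n_o..<M2}) < Min (innov_value M2 D c ` {..<n_o})"
      proof (elim imageE)
        fix i j assume "Max (innov_value M2 D c ` {n_o..<M2}) = innov_value M2 D c i" "i \<in> {n_o..<M2}"
          "Min (innov_value M2 D c ` {..<n_o}) = innov_value M2 D c j" "j \<in> {..<n_o}"
        then show ?thesis using lt[of i j] by simp
      qed
      moreover have "(\<exists>k\<le>M2. dim (span ((\<lambda>t. D (\<sigma> t)) ` {..<k})) = CARD('r))
              \<and> (\<forall>k\<le>M2. dim (span ((\<lambda>t. D (\<sigma> t)) ` {..<k})) = CARD('r)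
                   \<longrightarrow> span ((\<lambda>t. D (\<sigma> t)) ` {..<k}) = span (columns U))"
        if \<sigma>: "bij_betw \<sigma> {..<M2} {..<M2}"
          and sorted: "\<And>s t. s \<le> t \<Longrightarrow> t < M2 \<Longrightarrow> innov_value M2 D c (\<sigma> s) \<le> innov_value M2 D c (\<sigma> t)" for \<sigma>
        using recovery[where v = "innov_value M2 D c" and \<sigma> = \<sigma>, OF A lt \<sigma> sorted] by blast
      ultimately show ?thesis by blast
    qed
    have ii_form: "2 * \<kappa> / (offset / s) * (real n_o / sqrt r + z + X + nz) = 2 * \<kappa> / (offset / s) * (real n_o / sqrt r + 2 * sqrt (real n_o)
        + sqrt (2 * real n_o * ln (1 / \<delta>) / (r - 1)) + 2 * sqrt ((real n_o / r + \<eta>) * ln (real n_o / \<delta>)) + nz)" for nz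
      by (simp add: z_def X_def L_def)
    \<comment> \<open>In the statement \<open>chi\<close> stands under the square roots; factoring
      out sqrt chi makes \<open>z\<close> common to both conditions.\<close>
    have iii_form: "(ch * (real n_o / sqrt r) + sqrt ch * z) * s = (ch * real n_o / sqrt r + 2 * sqrt (ch * real n_o)
        + sqrt (ch * (2 * real n_o * ln (1 / \<delta>) / (r - 1)))) * s" for ch
      by (simp only: z_def L_def real_sqrt_mult[of ch]) (simp add: distrib_left)
    note main' = main[unfolded ii_form iii_form, unfolded offset_def r_def \<A>_def \<eta>_def L_def, unfolded D_def[abs_def]]
    show ?case
      unfolding Let_def
    proof (rule conjI, goal_cases)
      case 1
      show ?case using ex unfolding D_def[abs_def] by blast
    next
      case 2
      show ?case
      proof (intro allI impI, goal_cases)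
        case (1 c)
        show ?case
        proof (rule main'[of c "real (Max ((\<lambda>j. card {i. i < n_o \<and> c j \<bullet> d i \<omega> = 0}) ` {..<n_o}))"])
          show "opt_point M2 (\<lambda>i. d i \<omega>) j (c j)" if "j < M2" for j
            using 1[THEN conjunct1] that by blast
        qed (rule of_nat_0_le_iff, rule 1[THEN conjunct2, THEN conjunct2, THEN conjunct1],
            rule 1[THEN conjunct2, THEN conjunct2, THEN conjunct2])
      qed
    qed
  qed (rule E)
qed

end
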